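(* The Ornstein–Uhlenbeck semigroup $(P_t)_{t\ge0}$ on $\mathbb R^d$ is exponentially contractive on $\mathcal P_{0,\mathrm{Id}}(\mathbb R^d)$: for any $\eta_0^1,\eta_0^2\in\mathcal P_{0,\mathrm{Id}}(\mathbb R^d)$ and all $t\ge0$, $$\mathcal W_{0,\mathrm{Id}}(P_t\eta^1_0,P_t\eta^2_0)\le e^{-t}\,\mathcal W_{0,\mathrm{Id}}(\eta^1_0,\eta^2_0).$$
   Context: $\mathcal P_{0,\mathrm{Id}}(\mathbb R^d)$: Borel probability measures with finite second moment, mean $0$ and covariance matrix $\mathrm{Id}$. $\eta_t=P_t\eta$ is the solution of $\partial_t\eta_t=\Delta\eta_t+\nabla\cdot(x\eta_t)$ with $\eta_0=\eta$; it maps $\mathcal P_{0,\mathrm{Id}}$ into itself. $\mathcal W_{0,\mathrm{Id}}(\mu_0,\mu_1)^2=\inf\int_0^1\int\frac12|V_t|^2d\mu_tdt$ over all pairs $(\mu,V)$ where $(\mu_t)_{t\in[0,1]}$ is a weakly continuous curve in $\mathcal P_{0,\mathrm{Id}}(\mathbb R^d)$ from $\mu_0$ to $\mu_1$ and $(V_t)$ is a Borel family of vector fields with $\partial_t\mu_t+\nabla\cdot(\mu_tV_t)=0$ in the sense of distributions. *)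

theory Defs
  imports "HOL-Probability.Probability"
begin

text \<open>The partial derivative in direction \<open>v\<close>; \<^const>\<open>frechet_derivative\<close> carries
  information only where \<open>f\<close> is differentiable, which \<open>Ck_fun\<close> below guarantees.\<close>

definition dir_deriv :: "'a::euclidean_space \<Rightarrow> ('a \<Rightarrow> real) \<Rightarrow> 'a \<Rightarrow> real" where
  "dir_deriv v f z = frechet_derivative f (at z) v"

primrec Ck_fun :: "nat \<Rightarrow> ('a::euclidean_space \<Rightarrow> real) \<Rightarrow> bool" where
  "Ck_fun 0 f \<longleftrightarrow> continuous_on UNIV f"
| "Ck_fun (Suc k) f \<longleftrightarrow>
     (\<forall>z. f differentiable (at z)) \<and> (\<forall>b\<in>Basis. Ck_fun k (dir_deriv b f))"

text \<open>\<open>C\<^sub>c\<^sup>\<infinity>(U)\<close>, each function being extended by zero to the whole space.\<close>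

definition test_functions :: "'a::euclidean_space set \<Rightarrow> ('a \<Rightarrow> real) set" where
  "test_functions U = {\<phi>. (\<forall>k. Ck_fun k \<phi>) \<and>
     compact (closure {z. \<phi> z \<noteq> 0}) \<and> closure {z. \<phi> z \<noteq> 0} \<subseteq> U}"

definition time_deriv :: "(real \<times> (real^'d) \<Rightarrow> real) \<Rightarrow> real \<times> (real^'d) \<Rightarrow> real" where
  "time_deriv \<phi> = dir_deriv (1, 0) \<phi>"

definition space_grad :: "(real \<times> (real^'d) \<Rightarrow> real) \<Rightarrow> real \<times> (real^'d) \<Rightarrow> real^'d" where
  "space_grad \<phi> z = (\<chi> i. dir_deriv (0, axis i 1) \<phi> z)"

definition space_laplacian :: "(real \<times> (real^'d) \<Rightarrow> real) \<Rightarrow> real \<times> (real^'d) \<Rightarrow> real" where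
  "space_laplacian \<phi> z = (\<Sum>i\<in>UNIV. dir_deriv (0, axis i 1) (dir_deriv (0, axis i 1) \<phi>) z)"

definition borel_prob :: "(real^'d) measure set" where
  "borel_prob = {\<mu>. sets \<mu> = sets borel \<and> prob_space \<mu>}"

definition mean_vec :: "(real^'d) measure \<Rightarrow> real^'d" where
  "mean_vec \<mu> = (\<integral>x. x \<partial>\<mu>)"

definition cov_matrix :: "(real^'d) measure \<Rightarrow> real^'d^'d" where
  "cov_matrix \<mu> = (\<chi> i j. \<integral>x. (x - mean_vec \<mu>) $ i * (x - mean_vec \<mu>) $ j \<partial>\<mu>)"

definition P0Id :: "(real^'d) measure set" where
  "P0Id = {\<mu> \<in> borel_prob. integrable \<mu> (\<lambda>x. (norm x)\<^sup>2) \<and>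
     mean_vec \<mu> = 0 \<and> cov_matrix \<mu> = mat 1}"

definition weakly_continuous_on :: "real set \<Rightarrow> (real \<Rightarrow> (real^'d) measure) \<Rightarrow> bool" where
  "weakly_continuous_on T \<mu> \<longleftrightarrow>
     (\<forall>f :: real^'d \<Rightarrow> real. continuous_on UNIV f \<and> bounded (range f) \<longrightarrow>
        continuous_on T (\<lambda>t. \<integral>x. f x \<partial>(\<mu> t)))"

text \<open>Weak solutions \<open>(\<eta>\<^sub>t)\<close>, \<open>t \<ge> 0\<close>, of \<open>\<partial>\<^sub>t\<eta> = \<Delta>\<eta> + \<nabla>\<cdot>(x \<eta>)\<close>
  among curves of probability measures. The equation is in the sense of distributions on
  \<open>(0,\<infinity>) \<times> \<real>\<^sup>d\<close>, and the initial value is attained by weak continuity on \<open>[0,\<infinity>)\<close>. Values at negative times are irrelevant.\<close>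

definition OU_solution :: "(real^'d) measure \<Rightarrow> (real \<Rightarrow> (real^'d) measure) \<Rightarrow> bool" where
  "OU_solution \<eta>0 \<eta> \<longleftrightarrow>
     \<eta> 0 = \<eta>0 \<and> (\<forall>t\<ge>0. \<eta> t \<in> borel_prob) \<and> weakly_continuous_on {0..} \<eta> \<and>
     (\<forall>\<phi>\<in>test_functions ({0<..} \<times> UNIV).
        (LBINT t:{0<..}. (\<integral>x. time_deriv \<phi> (t, x) + space_laplacian \<phi> (t, x)
           - x \<bullet> space_grad \<phi> (t, x) \<partial>(\<eta> t))) = 0)"

definition OU :: "real \<Rightarrow> (real^'d) measure \<Rightarrow> (real^'d) measure" where
  "OU t \<eta>0 = (THE \<nu>. \<exists>\<eta>. OU_solution \<eta>0 \<eta> \<and> \<nu> = \<eta> t)"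

text \<open>\<open>\<partial>\<^sub>t\<mu> + \<nabla>\<cdot>(\<mu> V) = 0\<close> in the sense of distributions on \<open>(0,1) \<times> \<real>\<^sup>d\<close>. Local
  integrability of \<open>V\<close> makes \<open>\<mu> V\<close> a distribution; it holds automatically for pairs of
  finite action.\<close>

definition continuity_eq ::
    "(real \<Rightarrow> (real^'d) measure) \<Rightarrow> (real \<Rightarrow> real^'d \<Rightarrow> real^'d) \<Rightarrow> bool" where
  "continuity_eq \<mu> V \<longleftrightarrow>
     (\<forall>K. compact K \<and> K \<subseteq> {0<..<1} \<times> UNIV \<longrightarrow>
        (\<integral>\<^sup>+ t\<in>{0<..<1}. (\<integral>\<^sup>+ x. ennreal (norm (V t x)) * indicator K (t, x) \<partial>(\<mu> t)) \<partial>lborel) < \<infinity>) \<and>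
     (\<forall>\<phi>\<in>test_functions ({0<..<1} \<times> UNIV).
        (LBINT t:{0<..<1}. (\<integral>x. time_deriv \<phi> (t, x)
           + V t x \<bullet> space_grad \<phi> (t, x) \<partial>(\<mu> t))) = 0)"

definition admissible_pairs :: "(real^'d) measure \<Rightarrow> (real^'d) measure \<Rightarrow>
    ((real \<Rightarrow> (real^'d) measure) \<times> (real \<Rightarrow> real^'d \<Rightarrow> real^'d)) set" where
  "admissible_pairs \<mu>0 \<mu>1 = {(\<mu>, V).
     (\<forall>t\<in>{0..1}. \<mu> t \<in> P0Id) \<and> weakly_continuous_on {0..1} \<mu> \<and> \<mu> 0 = \<mu>0 \<and> \<mu> 1 = \<mu>1 \<and>
     (\<lambda>(t, x). V t x) \<in> borel_measurable (restrict_space borel ({0..1} \<times> UNIV)) \<and>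
     continuity_eq \<mu> V}"

definition action :: "(real \<Rightarrow> (real^'d) measure) \<Rightarrow> (real \<Rightarrow> real^'d \<Rightarrow> real^'d) \<Rightarrow> ennreal" where
  "action \<mu> V =
     (\<integral>\<^sup>+ t\<in>{0..1}. (\<integral>\<^sup>+ x. ennreal (1/2 * (norm (V t x))\<^sup>2) \<partial>(\<mu> t)) \<partial>lborel)"

definition ennreal_sqrt :: "ennreal \<Rightarrow> ennreal" where
  "ennreal_sqrt a = (if a = \<infinity> then \<infinity> else ennreal (sqrt (enn2real a)))"

text \<open>The infimum over the empty set is \<open>\<infinity>\<close>.\<close>

definition W0Id :: "(real^'d) measure \<Rightarrow> (real^'d) measure \<Rightarrow> ennreal" where
  "W0Id \<mu>0 \<mu>1 = ennreal_sqrt (\<Sqinter>(\<mu>, V)\<in>admissible_pairs \<mu>0 \<mu>1. action \<mu> V)"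

lemma ennreal_sqrt_power2: "(ennreal_sqrt a)\<^sup>2 = a"
  by (cases a) (simp_all add: ennreal_sqrt_def ennreal_power)

end

theory Submission
  imports Defs
begin

text \<open>The flow of \<open>\<partial>\<^sub>t\<eta> = \<Delta>\<eta> + \<nabla>\<cdot>(x \<eta>)\<close> is explicit: if \<open>X\<close> has law \<open>\<eta>\<close> and \<open>Z\<close> is an independent standard Gaussian,
then \<open>P\<^sub>t\<eta>\<close> is the law of \<open>a X + s Z\<close> with \<open>a = exp (-t)\<close> and \<open>s\<^sup>2 = 1 - a\<^sup>2\<close> (Mehler's formula). Since
\<open>a\<^sup>2 + s\<^sup>2 = 1\<close>, mean \<open>0\<close> and covariance \<open>Id\<close> are preserved. Given a curve \<open>\<mu>\<^sub>r\<close> with velocity \<open>V\<^sub>r\<close> between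
\<open>\<eta>\<^sub>1\<close> and \<open>\<eta>\<^sub>2\<close>, the smoothed curve \<open>P\<^sub>t\<mu>\<^sub>r\<close> joins \<open>P\<^sub>t\<eta>\<^sub>1\<close> to \<open>P\<^sub>t\<eta>\<^sub>2\<close> inside the constraint set, and it
is driven by the conditional expectation \<open>V'\<^sub>r(y) = a E[V\<^sub>r(X) | a X + s Z = y]\<close>. Jensen's inequality bounds
the kinetic energy of \<open>V'\<close> by \<open>a\<^sup>2\<close> times that of \<open>V\<close>; taking the infimum and a square root gives the
factor \<open>a = exp (-t)\<close>.

Two points need work. First, the semigroup is defined through weak solutions in a class of curves of
probability measures without any moment condition, so Mehler's formula has to be shown to be the only such
solution. Existence (\<open>OU_solution_mehler\<close>) follows by integrating a test function along the paths
\<open>t \<mapsto> a X + s Z\<close> with \<open>X\<close> and \<open>Z\<close> frozen: the time integral vanishes by the fundamental theorem of calculus,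
and Gaussian integration by parts turns the \<open>Z\<close>-part of the velocity into the Laplacian. Uniqueness
(\<open>OU_solution_unique\<close>) is by duality with the explicit solutions
\<open>exp (|\<xi>|\<^sup>2 exp (2 r) / 2) cos (exp r (\<xi> \<bullet> x) + \<beta>)\<close> of the backward equation: after truncation
they show that the cosine transforms of any two solutions agree, and these transforms determine a measure
(\<open>measure_eqI_cos_transform\<close>).

Second, the smoothed pair has to satisfy the continuity equation (\<open>admissible_smoothed\<close>). For each fixed value
\<open>z\<close> of \<open>Z\<close> the function \<open>(r, x) \<mapsto> \<phi> (r, a x + s z)\<close> is again a compactly supported test function, so the equation
for \<open>(\<mu>, V)\<close> can be applied to it directly; averaging over \<open>z\<close> with Fubini's theorem yields the equation
for \<open>(P\<^sub>t\<mu>, V')\<close>.\<close>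

section \<open>Smooth functions\<close>

lemma dir_deriv_eqI: "(f has_derivative f') (at z) \<Longrightarrow> dir_deriv v f z = f' v"
  unfolding dir_deriv_def by (metis frechet_derivative_at)

lemma has_derivative_frechet:
  "f differentiable (at z) \<Longrightarrow> (f has_derivative (\<lambda>v. dir_deriv v f z)) (at z)"
  unfolding dir_deriv_def using frechet_derivative_works[of f "at z"] by simp

text \<open>The predicate is defined with \<^const>\<open>frechet_derivative\<close>, a choice operator; this rule replaces it by any
derivative that one can exhibit, and the closure properties below all go through it.\<close>

lemma Ck_fun_SucI:
  assumes "\<And>z. (f has_derivative f' z) (at z)" "\<And>b. b \<in> Basis \<Longrightarrow> Ck_fun k (\<lambda>z. f' z b)"
  shows "Ck_fun (Suc k) f"
proof -
  have "dir_deriv b f = (\<lambda>z. f' z b)" for b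
    using dir_deriv_eqI[OF assms(1)] by auto
  with assms show ?thesis by (auto simp: differentiable_def)
qed

lemma Ck_fun_mono_Suc: "Ck_fun (Suc k) f \<Longrightarrow> Ck_fun k f"
proof (induction k arbitrary: f)
  case 0
  then have "\<And>z. f differentiable (at z)" by simp
  then show ?case
    by (simp add: continuous_on_eq_continuous_at differentiable_imp_continuous_within)
next
  case (Suc k)
  then show ?case by (metis Ck_fun.simps(2))
qed

lemma Ck_fun_imp_continuous: "Ck_fun k f \<Longrightarrow> continuous_on UNIV f"
proof (induction k)
  case (Suc k) then show ?case using Ck_fun_mono_Suc by blast
qed simp

lemma Ck_fun_const: "Ck_fun k (\<lambda>z. c)"
proof (induction k arbitrary: c)
  case (Suc k)
  show ?case by (rule Ck_fun_SucI[where f'="\<lambda>z v. 0"]) (auto intro: Suc)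
qed simp

lemma Ck_fun_linear:
  assumes "bounded_linear f" shows "Ck_fun k f"
proof (cases k)
  case 0 then show ?thesis using assms by (simp add: linear_continuous_on)
next
  case (Suc k')
  show ?thesis unfolding Suc
    by (rule Ck_fun_SucI[where f'="\<lambda>z v. f v"]) (auto intro: Ck_fun_const bounded_linear_imp_has_derivative assms)
qed

lemma Ck_fun_add: "Ck_fun k f \<Longrightarrow> Ck_fun k g \<Longrightarrow> Ck_fun k (\<lambda>z. f z + g z)"
proof (induction k arbitrary: f g)
  case 0 then show ?case by (auto intro: continuous_on_add)
next
  case (Suc k)
  show ?case
    by (rule Ck_fun_SucI[where f'="\<lambda>z v. dir_deriv v f z + dir_deriv v g z"])
      (use Suc in \<open>auto intro!: has_derivative_add has_derivative_frechet Suc.IH\<close>)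
qed

lemma Ck_fun_mult: "Ck_fun k f \<Longrightarrow> Ck_fun k g \<Longrightarrow> Ck_fun k (\<lambda>z. f z * g z)"
proof (induction k arbitrary: f g)
  case 0 then show ?case by (auto intro: continuous_on_mult)
next
  case (Suc k)
  show ?case
    by (rule Ck_fun_SucI[where f'="\<lambda>z v. f z * dir_deriv v g z + dir_deriv v f z * g z"])
      (use Suc Ck_fun_mono_Suc in \<open>auto intro!: has_derivative_mult has_derivative_frechet Suc.IH Ck_fun_add\<close>)
qed

lemma Ck_fun_cmult: "Ck_fun k f \<Longrightarrow> Ck_fun k (\<lambda>z. c * f z)"
  by (rule Ck_fun_mult[OF Ck_fun_const])

lemma Ck_fun_diff: "Ck_fun k f \<Longrightarrow> Ck_fun k g \<Longrightarrow> Ck_fun k (\<lambda>z. f z - g z)"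
  using Ck_fun_add[OF _ Ck_fun_cmult[of k g "-1"]] by simp

lemma Ck_fun_sum: "(\<And>i. i \<in> I \<Longrightarrow> Ck_fun k (f i)) \<Longrightarrow> Ck_fun k (\<lambda>z. \<Sum>i\<in>I. f i z)"
  by (induction I rule: infinite_finite_induct) (auto intro: Ck_fun_const Ck_fun_add)

lemma Ck_fun_divide_one:
  assumes "\<And>z. f z \<noteq> 0" shows "Ck_fun k f \<Longrightarrow> Ck_fun k (\<lambda>z. 1 / f z)"
proof (induction k)
  case 0 then show ?case using assms by (auto intro!: continuous_intros)
next
  case (Suc k)
  have "Ck_fun k (\<lambda>z. 1 / f z)" using Suc Ck_fun_mono_Suc by auto
  then have *: "Ck_fun k (\<lambda>z. -1 * ((1 / f z) * (1 / f z) * dir_deriv b f z))" if "b \<in> Basis" for b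
    using Suc that by (intro Ck_fun_cmult Ck_fun_mult) auto
  have D: "(f has_derivative (\<lambda>v. dir_deriv v f z)) (at z)" for z
    using Suc by (intro has_derivative_frechet) auto
  show ?case
    by (rule Ck_fun_SucI[where f'="\<lambda>z v. -1 * ((1 / f z) * (1 / f z) * dir_deriv v f z)"])
       (use * in \<open>auto intro!: derivative_eq_intros D simp: assms field_simps\<close>)
qed

text \<open>A real outer function is enough: every nonlinearity that occurs later is a function of one real
variable. The induction generalises over the outer function, since its derivative takes its place.\<close>

lemma Ck_fun_compose:
  fixes h :: "real \<Rightarrow> real"
  shows "Ck_fun k h \<Longrightarrow> Ck_fun k f \<Longrightarrow> Ck_fun k (\<lambda>z. h (f z))"
proof (induction k arbitrary: h)
  case 0 then show ?case by (auto intro: continuous_on_compose2[of UNIV h])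
next
  case (Suc k)
  have *: "dir_deriv v h x = v * dir_deriv 1 h x" for v x
  proof -
    have "linear (\<lambda>v. dir_deriv v h x)"
      using has_derivative_linear[OF has_derivative_frechet[of h x]] Suc(2) by simp
    from linear_cmul[OF this, of v 1] show ?thesis by simp
  qed
  have D: "((\<lambda>z. h (f z)) has_derivative (\<lambda>v. dir_deriv 1 h (f z) * dir_deriv v f z)) (at z)" for z
  proof -
    have "((\<lambda>z. h (f z)) has_derivative (\<lambda>v. dir_deriv (dir_deriv v f z) h (f z))) (at z)"
      by (rule has_derivative_compose[OF has_derivative_frechet has_derivative_frechet])
         (use Suc in auto)
    then show ?thesis by (subst (asm) *) (simp add: mult.commute)
  qed
  have f: "Ck_fun k f" using Suc Ck_fun_mono_Suc by blast
  show ?case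
    by (rule Ck_fun_SucI[OF D], rule Ck_fun_mult, rule Suc.IH) (use Suc f in auto)
qed

text \<open>The derivative of \<open>f \<circ> L\<close> along a basis vector is a combination of derivatives of \<open>f\<close> along all
basis vectors, composed with the same affine map, so the induction closes.\<close>

lemma Ck_fun_affine:
  fixes L :: "'a::euclidean_space \<Rightarrow> 'b::euclidean_space"
  assumes L: "bounded_linear L"
  shows "Ck_fun k f \<Longrightarrow> Ck_fun k (\<lambda>z. f (L z + c))"
proof (induction k arbitrary: f)
  case 0
  have "continuous_on UNIV (\<lambda>z. L z + c)"
    by (intro continuous_on_add linear_continuous_on L continuous_on_const)
  with 0 show ?case using continuous_on_compose2[of UNIV f UNIV] by auto
next
  case (Suc k)
  have D: "((\<lambda>z. f (L z + c)) has_derivative (\<lambda>v. dir_deriv (L v) f (L z + c))) (at z)" for z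
    by (rule has_derivative_compose[OF _ has_derivative_frechet])
       (use Suc in \<open>auto intro!: derivative_eq_intros bounded_linear_imp_has_derivative L\<close>)
  have E: "dir_deriv v f z = (\<Sum>b\<in>Basis. (v \<bullet> b) * dir_deriv b f z)" for v z
  proof -
    have "linear (\<lambda>v. dir_deriv v f z)"
      using has_derivative_linear[OF has_derivative_frechet[of f z]] Suc by auto
    then have "dir_deriv (\<Sum>b\<in>Basis. (v \<bullet> b) *\<^sub>R b) f z = (\<Sum>b\<in>Basis. (v \<bullet> b) * dir_deriv b f z)"
      using linear_sum[of "\<lambda>v. dir_deriv v f z" "\<lambda>b. (v \<bullet> b) *\<^sub>R b" Basis]
      by (simp add: linear_cmul[of "\<lambda>v. dir_deriv v f z"] del: euclidean_representation)
    then show ?thesis by (simp add: euclidean_representation)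
  qed
  show ?case
    by (rule Ck_fun_SucI[OF D], subst E, rule Ck_fun_sum, rule Ck_fun_cmult, rule Suc.IH)
       (use Suc.prems in simp)
qed

text \<open>The flat function \<open>exp (-1/x)\<close> and its multiples by powers of \<open>1/x\<close>. The whole family is needed because
the derivative of a member is a combination of members, which makes smoothness at \<open>0\<close> a plain induction.\<close>

definition exp_flat :: "nat \<Rightarrow> real \<Rightarrow> real" where
  "exp_flat n x = (if x > 0 then (1 / x) ^ n * exp (- (1 / x)) else 0)"

lemma exp_flat_tendsto_0: "(exp_flat n \<longlongrightarrow> 0) (at 0)"
proof -
  have "((\<lambda>y::real. y ^ n / exp y) \<longlongrightarrow> 0) at_top"
    by (rule tendsto_power_div_exp_0)
  then have "((\<lambda>x::real. (inverse x) ^ n / exp (inverse x)) \<longlongrightarrow> 0) (at_right 0)"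
    by (rule filterlim_compose) (rule filterlim_inverse_at_top_right)
  then have R: "(exp_flat n \<longlongrightarrow> 0) (at_right 0)"
    by (rule Lim_transform_eventually)
       (auto simp: exp_flat_def eventually_at_filter exp_minus field_simps)
  have L: "(exp_flat n \<longlongrightarrow> 0) (at_left 0)"
    by (rule Lim_transform_eventually[OF tendsto_const])
       (auto simp: exp_flat_def eventually_at_filter)
  show ?thesis using L R filterlim_split_at by blast
qed

lemma exp_flat_has_derivative:
  "(exp_flat n has_real_derivative exp_flat (n + 2) x - real n * exp_flat (n + 1) x) (at x)"
proof -
  consider "x > 0" | "x < 0" | "x = 0" by linarith
  then show ?thesis
  proof cases
    case 1
    have "((\<lambda>x. (1 / x) ^ n * exp (- (1 / x))) has_real_derivative
        exp_flat (n + 2) x - real n * exp_flat (n + 1) x) (at x)"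
      using 1
      by (auto intro!: derivative_eq_intros simp: exp_flat_def power2_eq_square field_simps)
         (cases n; simp add: field_simps)
    then show ?thesis
      by (rule has_field_derivative_transform_within_open[of _ _ _ "{0<..}"])
         (use 1 in \<open>auto simp: exp_flat_def\<close>)
  next
    case 2
    have "((\<lambda>x. 0) has_real_derivative exp_flat (n + 2) x - real n * exp_flat (n + 1) x) (at x)"
      using 2 by (auto simp: exp_flat_def)
    then show ?thesis
      by (rule has_field_derivative_transform_within_open[of _ _ _ "{..<0}"])
         (use 2 in \<open>auto simp: exp_flat_def\<close>)
  next
    case 3
    have "(\<lambda>h. (exp_flat n (0 + h) - exp_flat n 0) / h) = exp_flat (n + 1)"
      by (auto simp: exp_flat_def fun_eq_iff)
    with exp_flat_tendsto_0[of "n + 1"] show ?thesis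
      unfolding 3 DERIV_def by (simp add: exp_flat_def)
  qed
qed

lemma Ck_fun_exp_flat: "Ck_fun k (exp_flat n)"
proof (induction k arbitrary: n)
  case 0 show ?case
    using exp_flat_has_derivative by (auto simp: continuous_on_eq_continuous_at intro: DERIV_isCont)
next
  case (Suc k)
  show ?case
    by (rule Ck_fun_SucI[OF exp_flat_has_derivative[unfolded has_field_derivative_def]])
       (use Suc[of "n+2"] Suc[of "n+1"] in \<open>auto intro!: Ck_fun_diff Ck_fun_cmult\<close>)
qed

text \<open>The denominator is positive everywhere, as \<open>x\<close> and \<open>1 - x\<close> cannot both be nonpositive.\<close>

definition smooth_step :: "real \<Rightarrow> real" where
  "smooth_step x = exp_flat 0 x / (exp_flat 0 x + exp_flat 0 (1 - x))"

lemma exp_flat_0_denom: "exp_flat 0 x + exp_flat 0 (1 - x) > 0"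
  by (cases "x > 0"; cases "x < 1") (auto simp: exp_flat_def add_pos_pos)

lemma smooth_step_bounds: "0 \<le> smooth_step x" "smooth_step x \<le> 1"
  using exp_flat_0_denom[of x] by (auto simp: smooth_step_def exp_flat_def)

lemma smooth_step_left: "x \<le> 0 \<Longrightarrow> smooth_step x = 0"
  by (auto simp: smooth_step_def exp_flat_def)

lemma smooth_step_right: "1 \<le> x \<Longrightarrow> smooth_step x = 1"
  by (auto simp: smooth_step_def exp_flat_def)

lemma Ck_fun_smooth_step: "Ck_fun k smooth_step"
proof -
  have 1: "Ck_fun k (\<lambda>x. exp_flat 0 (1 - x))"
    using Ck_fun_affine[of uminus k "exp_flat 0" 1] Ck_fun_exp_flat[of k 0]
    by (simp add: bounded_linear_minus[OF bounded_linear_ident] add.commute)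
  have "Ck_fun k (\<lambda>x. exp_flat 0 x * (1 / (exp_flat 0 x + exp_flat 0 (1 - x))))"
    by (intro Ck_fun_mult Ck_fun_divide_one Ck_fun_add Ck_fun_exp_flat 1)
       (use exp_flat_0_denom in \<open>metis less_irrefl\<close>)
  then show ?thesis by (simp add: smooth_step_def[abs_def])
qed

section \<open>The standard Gaussian measure\<close>

text \<open>By translation invariance \<open>G (z + e) - G z\<close> integrates to \<open>0\<close>. By the fundamental theorem of calculus
this increment is \<open>\<integral>\<^sub>0\<^sup>1 G' (z + u e) du\<close>, and by Fubini and translation invariance again its integral
is that of \<open>G'\<close>.\<close>

lemma integral_dir_deriv_eq_0:
  fixes G G' :: "'a::euclidean_space \<Rightarrow> real"
  assumes D: "\<And>z. ((\<lambda>r. G (z + r *\<^sub>R e)) has_real_derivative G' z) (at 0)"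
    and cont: "continuous_on UNIV G'"
    and int: "integrable lborel G" and int': "integrable lborel G'"
  shows "integral\<^sup>L lborel G' = 0"
proof -
  have D': "((\<lambda>r. G (z + r *\<^sub>R e)) has_real_derivative G' (z + r *\<^sub>R e)) (at r)" for z r
    using D[of "z + r *\<^sub>R e"] DERIV_shift[of "\<lambda>s. G (z + s *\<^sub>R e)" _ 0 r]
    by (simp add: algebra_simps)
  have [measurable]: "G' \<in> borel_measurable borel"
    using cont by (rule borel_measurable_continuous_onI)
  have shift: "(\<integral>\<^sup>+z. f (z + c) \<partial>lborel) = (\<integral>\<^sup>+z. f z \<partial>lborel)"
    if [measurable]: "f \<in> borel_measurable borel" for f :: "'a \<Rightarrow> ennreal" and c
    by (subst lborel_distr_plus[of c, symmetric], subst nn_integral_distr) (auto simp: add.commute)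
  have ishift: "(\<integral>z. f (z + c) \<partial>lborel) = (\<integral>z. f z \<partial>lborel)"
    "integrable lborel f \<Longrightarrow> integrable lborel (\<lambda>z. f (z + c))"
    if [measurable]: "f \<in> borel_measurable borel" for f :: "'a \<Rightarrow> real" and c
  proof -
    show "(\<integral>z. f (z + c) \<partial>lborel) = (\<integral>z. f z \<partial>lborel)"
      by (subst (2) lborel_distr_plus[of c, symmetric], subst integral_distr) (auto simp: add.commute)
    show "integrable lborel f \<Longrightarrow> integrable lborel (\<lambda>z. f (z + c))"
      by (subst (asm) lborel_distr_plus[of c, symmetric], subst (asm) integrable_distr_eq) (auto simp: add.commute)
  qed
  let ?H = "\<lambda>(z, u). indicator {0..1} u * G' (z + u *\<^sub>R e)"
  have int2: "integrable (lborel \<Otimes>\<^sub>M lborel) ?H"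
  proof (rule integrableI_bounded)
    show "?H \<in> borel_measurable (lborel \<Otimes>\<^sub>M lborel)"
      by measurable
    have "(\<integral>\<^sup>+x. norm (?H x) \<partial>(lborel \<Otimes>\<^sub>M lborel)) =
       (\<integral>\<^sup>+u. \<integral>\<^sup>+z. indicator {0..1} u * ennreal \<bar>G' (z + u *\<^sub>R e)\<bar> \<partial>lborel \<partial>lborel)"
      by (subst lborel_pair.nn_integral_snd[symmetric])
         (auto intro!: nn_integral_cong simp: abs_mult split: split_indicator)
    also have "\<dots> = (\<integral>\<^sup>+u. indicator {0..1} (u::real) * (\<integral>\<^sup>+z. ennreal \<bar>G' z\<bar> \<partial>lborel) \<partial>lborel)"
      by (intro nn_integral_cong, subst nn_integral_cmult) (auto simp: shift[of "\<lambda>z. ennreal \<bar>G' z\<bar>"])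
    also have "\<dots> = (\<integral>\<^sup>+z. ennreal \<bar>G' z\<bar> \<partial>lborel)"
      by (subst nn_integral_multc) auto
    also have "\<dots> < \<infinity>" using int' by (simp add: integrable_iff_bounded)
    finally show "(\<integral>\<^sup>+x. norm (?H x) \<partial>(lborel \<Otimes>\<^sub>M lborel)) < \<infinity>" .
  qed
  have FTC: "(\<integral>u. indicator {0..1} u * G' (z + u *\<^sub>R e) \<partial>lborel) = G (z + e) - G z" for z
  proof -
    have "(\<integral>u. indicator {0..1} u *\<^sub>R G' (z + u *\<^sub>R e) \<partial>lborel) = G (z + 1 *\<^sub>R e) - G (z + 0 *\<^sub>R e)"
    proof (rule integral_FTC_atLeastAtMost)
      show "((\<lambda>u. G (z + u *\<^sub>R e)) has_vector_derivative G' (z + x *\<^sub>R e)) (at x within {0..1})" for x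
        using D' by (metis has_real_derivative_iff_has_vector_derivative has_vector_derivative_at_within)
      show "continuous_on {0..1} (\<lambda>u. G' (z + u *\<^sub>R e))"
        by (rule continuous_on_compose2[OF cont]) (auto intro!: continuous_intros)
    qed simp
    then show ?thesis by simp
  qed
  have [measurable]: "G \<in> borel_measurable borel" using int by auto
  have "integral\<^sup>L lborel G' = (\<integral>u. indicator {0..1} (u::real) * integral\<^sup>L lborel G' \<partial>lborel)"
    by simp
  also have "\<dots> = (\<integral>u. \<integral>z. indicator {0..1} u * G' (z + u *\<^sub>R e) \<partial>lborel \<partial>lborel)"
    by (intro Bochner_Integration.integral_cong) (auto simp: ishift)
  also have "\<dots> = (\<integral>z. \<integral>u. indicator {0..1} u * G' (z + u *\<^sub>R e) \<partial>lborel \<partial>lborel)"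
    by (rule lborel_pair.Fubini_integral[OF int2])
  also have "\<dots> = (\<integral>z. G (z + e) - G z \<partial>lborel)" by (simp add: FTC)
  also have "\<dots> = 0"
    by (subst Bochner_Integration.integral_diff) (auto intro!: ishift int simp: ishift)
  finally show ?thesis .
qed

text \<open>The product form lets Fubini reduce the total mass and the characteristic function to dimension one.\<close>

definition gauss_density :: "'a::euclidean_space \<Rightarrow> real" where
  "gauss_density z = (\<Prod>b\<in>Basis. std_normal_density (z \<bullet> b))"

definition std_gauss :: "'a::euclidean_space measure" where
  "std_gauss = density lborel (\<lambda>z. ennreal (gauss_density z))"

lemma gauss_density_eq:
  "gauss_density (z::'a::euclidean_space) = (1 / sqrt (2 * pi)) ^ DIM('a) * exp (- (norm z)\<^sup>2 / 2)"
proof -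
  have "(norm z)\<^sup>2 = (\<Sum>b\<in>Basis. (z \<bullet> b)\<^sup>2)"
    unfolding power2_norm_eq_inner by (subst euclidean_inner) (simp add: power2_eq_square)
  then show ?thesis
    by (simp add: gauss_density_def std_normal_density_def prod.distrib exp_sum[symmetric]
        sum_negf sum_divide_distrib power_one_over prod_dividef)
qed

lemma gauss_density_pos: "gauss_density z > 0"
  by (simp add: gauss_density_eq)

lemma gauss_density_nonneg[simp]: "0 \<le> gauss_density z"
  using gauss_density_pos[of z] by simp

lemma continuous_gauss_density: "continuous_on UNIV gauss_density"
  unfolding gauss_density_eq[abs_def] by (intro continuous_intros) auto

lemma gauss_density_bounded: "gauss_density (z::'a::euclidean_space) \<le> (1 / sqrt (2 * pi)) ^ DIM('a)"
  unfolding gauss_density_eq by (intro mult_left_le) auto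

lemma borel_measurable_gauss_density[measurable]: "gauss_density \<in> borel_measurable borel"
  by (rule borel_measurable_continuous_onI[OF continuous_gauss_density])

lemma sets_std_gauss[simp, measurable_cong]: "sets std_gauss = sets borel"
  by (simp add: std_gauss_def)

lemma space_std_gauss[simp]: "space std_gauss = UNIV"
  by (simp add: std_gauss_def)

lemma measurable_std_gauss_eq[simp]: "measurable std_gauss M = measurable borel M"
  by (rule measurable_cong_sets) auto

lemma nn_integral_gauss_density: "(\<integral>\<^sup>+z. ennreal (gauss_density z) \<partial>lborel) = 1"
proof -
  have "(\<integral>\<^sup>+z. (\<Prod>b\<in>(Basis::'a set). ennreal (std_normal_density (z \<bullet> b))) \<partial>lborel) =
    (\<Prod>b\<in>(Basis::'a set). \<integral>\<^sup>+x. ennreal (std_normal_density x) \<partial>lborel)"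
    by (rule nn_integral_lborel_prod) auto
  also have "(\<integral>\<^sup>+x. ennreal (std_normal_density x) \<partial>lborel) = 1"
    using prob_space.emeasure_space_1[OF prob_space_normal_density[of 1 0]]
    by (simp add: emeasure_density)
  finally show ?thesis by (simp add: gauss_density_def prod_ennreal)
qed

lemma prob_space_std_gauss: "prob_space std_gauss"
  by (rule prob_spaceI) (simp add: std_gauss_def emeasure_density nn_integral_gauss_density)

lemma integral_std_gauss:
  fixes f :: "'a::euclidean_space \<Rightarrow> 'b::{banach, second_countable_topology}"
  assumes [measurable]: "f \<in> borel_measurable borel"
  shows "integral\<^sup>L std_gauss f = (\<integral>z. gauss_density z *\<^sub>R f z \<partial>lborel)"
    "integrable std_gauss f \<longleftrightarrow> integrable lborel (\<lambda>z. gauss_density z *\<^sub>R f z)"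
  unfolding std_gauss_def by (simp_all add: integral_density integrable_density)

text \<open>The second moment is absorbed by half of the exponent, \<open>q exp (-q/2) \<le> 4 exp (-q/4)\<close>, and the
remaining Gaussian is a rescaled copy of the original density.\<close>

lemma integrable_std_gauss_norm_square: "integrable std_gauss (\<lambda>z::'a::euclidean_space. (norm z)\<^sup>2)"
proof -
  let ?c = "(1 / sqrt (2 * pi)) ^ DIM('a)"
  have "(\<integral>\<^sup>+z. ennreal (exp (- (norm (z::'a))\<^sup>2 / 4)) \<partial>lborel) < \<infinity>"
  proof -
    have "(\<integral>\<^sup>+z. ennreal (exp (- (norm (z::'a))\<^sup>2 / 4)) \<partial>lborel) =
       (\<integral>\<^sup>+z. ennreal (exp (- (norm (z::'a))\<^sup>2 / 4)) \<partial>density (distr lborel borel (\<lambda>x. 0 + sqrt 2 *\<^sub>R x)) (\<lambda>_. ennreal (\<bar>sqrt 2 ^ DIM('a)\<bar>)))"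
      by (subst lborel_affine[of "sqrt 2" 0]) auto
    also have "\<dots> = (\<integral>\<^sup>+z. ennreal (sqrt 2 ^ DIM('a) / ?c) * ennreal (gauss_density (z::'a)) \<partial>lborel)"
      by (subst nn_integral_density)
         (auto simp: nn_integral_distr gauss_density_eq ennreal_mult[symmetric] power_mult_distrib
            simp del: power_one_over intro!: nn_integral_cong)
    also have "\<dots> < \<infinity>"
      by (subst nn_integral_cmult) (auto simp: nn_integral_gauss_density)
    finally show ?thesis .
  qed
  then have "integrable lborel (\<lambda>z::'a. exp (- (norm z)\<^sup>2 / 4))"
    by (intro integrableI_nonneg) auto
  then have I: "integrable lborel (\<lambda>z::'a. 4 * ?c * exp (- (norm z)\<^sup>2 / 4))" by simp
  have "q * exp (- q / 2) \<le> 4 * exp (- q / 4)" for q :: real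
  proof -
    have "q / 4 \<le> exp (q / 4)" using exp_ge_add_one_self[of "q / 4"] by linarith
    then have "q * exp (- q / 2) \<le> 4 * exp (q / 4) * exp (- q / 2)"
      by (intro mult_right_mono) auto
    also have "\<dots> = 4 * exp (- q / 4)" by (simp add: exp_add[symmetric] mult.assoc)
    finally show ?thesis .
  qed
  then have "norm (gauss_density z *\<^sub>R (norm z)\<^sup>2) \<le> norm (4 * ?c * exp (- (norm z)\<^sup>2 / 4))" for z :: 'a
    using mult_left_mono[of "(norm z)\<^sup>2 * exp (- (norm z)\<^sup>2 / 2)" "4 * exp (- (norm z)\<^sup>2 / 4)" ?c]
    by (simp add: gauss_density_eq abs_mult mult_ac)
  then show ?thesis
    by (subst integral_std_gauss) (auto intro!: Bochner_Integration.integrable_bound[OF I])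
qed

lemma integrable_norm_of_norm_square:
  fixes f :: "'b \<Rightarrow> 'a::euclidean_space"
  assumes "prob_space \<mu>" "integrable \<mu> (\<lambda>x. (norm (f x))\<^sup>2)" "f \<in> borel_measurable \<mu>"
  shows "integrable \<mu> (\<lambda>x. norm (f x))"
  using assms finite_measure.square_integrable_imp_integrable[of \<mu> "\<lambda>x. norm (f x)"]
  by (auto simp: prob_space.finite_measure)

lemma le_one_plus_square: "x \<le> 1 + x\<^sup>2" for x :: real
  using zero_le_power2[of "x - 1 / 2"] by (simp add: power2_eq_square algebra_simps)

text \<open>The derivative of \<open>g\<close> times the density along \<open>e\<close> is the density times \<open>g' - g (z \<bullet> e)\<close>, and it integrates to \<open>0\<close>.\<close>

lemma gauss_integration_by_parts:
  fixes g g' :: "'a::euclidean_space \<Rightarrow> real"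
  assumes e: "e \<in> Basis"
    and D: "\<And>z. ((\<lambda>r. g (z + r *\<^sub>R e)) has_real_derivative g' z) (at 0)"
    and cont: "continuous_on UNIV g" "continuous_on UNIV g'"
    and int: "integrable std_gauss g" "integrable std_gauss g'" "integrable std_gauss (\<lambda>z. g z * (z \<bullet> e))"
  shows "(\<integral>z. g' z \<partial>std_gauss) = (\<integral>z. g z * (z \<bullet> e) \<partial>std_gauss)"
proof -
  have [measurable]: "g \<in> borel_measurable borel" "g' \<in> borel_measurable borel"
    using cont by (auto intro: borel_measurable_continuous_onI)
  have [simp]: "e \<bullet> e = 1" using e by simp
  let ?c = "(1 / sqrt (2 * pi)) ^ DIM('a)"
  have Dw: "((\<lambda>r. gauss_density (z + r *\<^sub>R e)) has_real_derivative - (z \<bullet> e) * gauss_density z) (at 0)" for z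
  proof -
    have *: "(norm (z + r *\<^sub>R e))\<^sup>2 = (norm z)\<^sup>2 + 2 * r * (z \<bullet> e) + r\<^sup>2" for r
      unfolding power2_norm_eq_inner
      by (simp add: inner_add_left inner_add_right inner_commute[of e z] power2_eq_square algebra_simps)
    show ?thesis unfolding gauss_density_eq *
      by (auto intro!: derivative_eq_intros)
  qed
  have "(\<integral>z. gauss_density z * g' z - gauss_density z * (g z * (z \<bullet> e)) \<partial>lborel) = 0"
  proof (rule integral_dir_deriv_eq_0)
    show "((\<lambda>r. gauss_density (z + r *\<^sub>R e) * g (z + r *\<^sub>R e)) has_real_derivative
         gauss_density z * g' z - gauss_density z * (g z * (z \<bullet> e))) (at 0)" for z
      using DERIV_mult[OF Dw D, of z z] by (simp add: algebra_simps)
    show "continuous_on UNIV (\<lambda>z. gauss_density z * g' z - gauss_density z * (g z * (z \<bullet> e)))"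
      by (intro continuous_intros cont continuous_gauss_density)
    show "integrable lborel (\<lambda>z. gauss_density z * g z)"
      using int(1) by (simp add: integral_std_gauss)
    show "integrable lborel (\<lambda>z. gauss_density z * g' z - gauss_density z * (g z * (z \<bullet> e)))"
      using int(2,3) by (simp add: integral_std_gauss)
  qed
  also have "(\<integral>z. gauss_density z * g' z - gauss_density z * (g z * (z \<bullet> e)) \<partial>lborel)
     = (\<integral>z. g' z \<partial>std_gauss) - (\<integral>z. g z * (z \<bullet> e) \<partial>std_gauss)"
    using int(2,3) by (subst Bochner_Integration.integral_diff) (simp_all add: integral_std_gauss)
  finally show ?thesis by simp
qed

lemma integrable_std_gauss_bound:
  fixes f :: "'a::euclidean_space \<Rightarrow> real"
  assumes [measurable]: "f \<in> borel_measurable borel" and "\<And>z. \<bar>f z\<bar> \<le> A + B * (norm z)\<^sup>2"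
  shows "integrable std_gauss f"
proof (rule Bochner_Integration.integrable_bound)
  interpret prob_space "std_gauss :: 'a measure" by (rule prob_space_std_gauss)
  show "integrable std_gauss (\<lambda>z::'a. A + B * (norm z)\<^sup>2)"
    using integrable_std_gauss_norm_square by auto
  show "AE z in std_gauss. norm (f z) \<le> norm (A + B * (norm z)\<^sup>2)"
    using assms(2) by (auto intro!: AE_I2 intro: order_trans[OF _ abs_ge_self])
qed auto

text \<open>Both moment identities are integrations by parts, for a constant and for a coordinate function.\<close>

lemma gauss_moments:
  fixes b c :: "'a::euclidean_space"
  assumes "b \<in> Basis" "c \<in> Basis"
  shows "(\<integral>z. z \<bullet> b \<partial>std_gauss) = 0"
    "(\<integral>z. (z \<bullet> c) * (z \<bullet> b) \<partial>std_gauss) = (if b = c then 1 else 0)"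
    "integrable std_gauss (\<lambda>z. z \<bullet> b)" "integrable std_gauss (\<lambda>z. (z \<bullet> c) * (z \<bullet> b))"
proof -
  interpret prob_space "std_gauss :: 'a measure" by (rule prob_space_std_gauss)
  have le: "\<bar>z \<bullet> b\<bar> \<le> 1 + 1 * (norm z)\<^sup>2" if "b \<in> Basis" for z b :: 'a
    using le_one_plus_square[of "norm z"] Basis_le_norm[OF that, of z] by linarith
  have 1: "integrable std_gauss (\<lambda>z. z \<bullet> b)" if "b \<in> Basis" for b :: 'a
    by (rule integrable_std_gauss_bound[OF _ le]) (auto simp: that)
  have "\<bar>(z \<bullet> c) * (z \<bullet> b)\<bar> \<le> 0 + 1 * (norm z)\<^sup>2" for z
    using mult_mono[OF Basis_le_norm[of c z] Basis_le_norm[of b z]] assms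
    by (auto simp: abs_mult power2_eq_square)
  then show 2: "integrable std_gauss (\<lambda>z. (z \<bullet> c) * (z \<bullet> b))"
    by (rule integrable_std_gauss_bound[rotated]) auto
  have "(\<integral>z. 0 \<partial>(std_gauss :: 'a measure)) = (\<integral>z. 1 * (z \<bullet> b) \<partial>std_gauss)"
    by (rule gauss_integration_by_parts[where g="\<lambda>z. 1" and e=b]) (use assms 1 in auto)
  then show "(\<integral>z. z \<bullet> b \<partial>std_gauss) = 0" by simp
  have "(\<integral>z. b \<bullet> c \<partial>(std_gauss :: 'a measure)) = (\<integral>z. (z \<bullet> c) * (z \<bullet> b) \<partial>std_gauss)"
    by (rule gauss_integration_by_parts[where g="\<lambda>z. z \<bullet> c" and e=b])
       (use assms 1 2 in \<open>auto simp: inner_add_left intro!: derivative_eq_intros continuous_intros\<close>)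
  then show "(\<integral>z. (z \<bullet> c) * (z \<bullet> b) \<partial>std_gauss) = (if b = c then 1 else 0)"
    using assms prob_space by (simp add: inner_Basis split: if_splits)
  show "integrable std_gauss (\<lambda>z. z \<bullet> b)" using 1 assms by simp
qed

lemma char_std_gauss:
  fixes w :: "'a::euclidean_space"
  shows "(\<integral>z. cos (w \<bullet> z) \<partial>std_gauss) = exp (- (norm w)\<^sup>2 / 2)"
proof -
  interpret P: product_sigma_finite "\<lambda>_::'a. lborel :: real measure" ..
  define F where "F b x = complex_of_real (std_normal_density x) * iexp ((w \<bullet> b) * x)" for b x
  have Fint: "integrable lborel (F b)" for b
  proof -
    have [measurable]: "F b \<in> borel_measurable borel" unfolding F_def[abs_def] by measurable
    have "integrable lborel std_normal_density" by (rule integrable_normal_density) simp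
    then show ?thesis
      by (rule Bochner_Integration.integrable_bound) (auto simp: F_def norm_mult)
  qed
  have F1: "integral\<^sup>L lborel (F b) = exp (- (w \<bullet> b)\<^sup>2 / 2)" for b
  proof -
    have "char std_normal_distribution (w \<bullet> b) = integral\<^sup>L lborel (F b)"
      unfolding char_def F_def
      by (subst integral_density) (auto simp: scaleR_conv_of_real)
    then show ?thesis by (simp add: char_std_normal_distribution)
  qed
  have "(\<integral>z. complex_of_real (gauss_density z) * iexp (w \<bullet> z) \<partial>lborel) =
        (\<integral>x. (\<Prod>b\<in>Basis. F b (x b)) \<partial>(\<Pi>\<^sub>M b\<in>(Basis::'a set). lborel))"
  proof (subst lborel_eq, subst integral_distr)
    show "(\<integral>x. complex_of_real (gauss_density (\<Sum>b\<in>Basis. x b *\<^sub>R b)) * iexp (w \<bullet> (\<Sum>b\<in>Basis. x b *\<^sub>R b))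
         \<partial>(\<Pi>\<^sub>M b\<in>(Basis::'a set). lborel)) = (\<integral>x. (\<Prod>b\<in>Basis. F b (x b)) \<partial>(\<Pi>\<^sub>M b\<in>(Basis::'a set). lborel))"
    proof (rule Bochner_Integration.integral_cong[OF refl])
      fix x :: "'a \<Rightarrow> real"
      have "(\<Sum>b\<in>Basis. x b *\<^sub>R b) \<bullet> c = x c" if "c \<in> Basis" for c
        using that by (simp add: inner_sum_left inner_Basis if_distrib sum.delta cong: if_cong)
      then have 1: "gauss_density (\<Sum>b\<in>Basis. x b *\<^sub>R b) = (\<Prod>b\<in>Basis. std_normal_density (x b))"
        by (simp add: gauss_density_def)
      have 2: "iexp (w \<bullet> (\<Sum>b\<in>Basis. x b *\<^sub>R b)) = (\<Prod>b\<in>Basis. iexp ((w \<bullet> b) * x b))"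
        by (simp add: inner_sum_right sum_distrib_left exp_sum mult_ac)
      show "complex_of_real (gauss_density (\<Sum>b\<in>Basis. x b *\<^sub>R b)) * iexp (w \<bullet> (\<Sum>b\<in>Basis. x b *\<^sub>R b)) = (\<Prod>b\<in>Basis. F b (x b))"
        unfolding 1 2 F_def by (simp add: prod.distrib)
    qed
  qed auto
  also have "\<dots> = (\<Prod>b\<in>Basis. integral\<^sup>L lborel (F b))"
    by (rule P.product_integral_prod) (auto simp: Fint)
  also have "\<dots> = exp (- (norm w)\<^sup>2 / 2)"
  proof -
    have "(norm w)\<^sup>2 = (\<Sum>b\<in>Basis. (w \<bullet> b)\<^sup>2)"
      unfolding power2_norm_eq_inner by (subst euclidean_inner) (simp add: power2_eq_square)
    then show ?thesis
      by (simp add: F1 exp_sum[symmetric] sum_negf sum_divide_distrib of_real_prod[symmetric] del: of_real_prod)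
  qed
  finally have *: "(\<integral>z. complex_of_real (gauss_density z) * iexp (w \<bullet> z) \<partial>lborel) = exp (- (norm w)\<^sup>2 / 2)" .
  have int: "integrable lborel (\<lambda>z. complex_of_real (gauss_density z) * iexp (w \<bullet> z))"
  proof (rule ccontr)
    assume "\<not> ?thesis"
    from not_integrable_integral_eq[OF this] * show False by simp
  qed
  have "Re (\<integral>z. complex_of_real (gauss_density z) * iexp (w \<bullet> z) \<partial>lborel) =
     (\<integral>z. Re (complex_of_real (gauss_density z) * iexp (w \<bullet> z)) \<partial>lborel)"
    using integral_Re[OF int] by simp
  also have "\<dots> = (\<integral>z. cos (w \<bullet> z) \<partial>std_gauss)"
    by (subst integral_std_gauss) (auto simp: Re_exp)
  finally show ?thesis unfolding * by simp
qed

section \<open>Gaussian smoothing of measures and Fourier uniqueness\<close>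

text \<open>The functions \<open>max 0 (1 - n infdist x F)\<close> decrease to the indicator of the closed set \<open>F\<close>. This
makes \<open>measure M F\<close> a limit of integrals of bounded continuous functions, which serves both to identify
measures and to prove measurability of weakly continuous curves.\<close>

lemma integral_infdist_tendsto_measure:
  fixes M :: "'a::euclidean_space measure"
  assumes F: "closed F" "F \<noteq> {}" and M: "prob_space M" "sets M = sets borel"
  shows "(\<lambda>n. \<integral>x. max 0 (1 - real n * infdist x F) \<partial>M) \<longlonglongrightarrow> measure M F"
proof -
  interpret M: prob_space M by fact
  have [measurable_cong]: "sets M = sets borel" by fact
  have "(\<lambda>n. \<integral>x. max 0 (1 - real n * infdist x F) \<partial>M) \<longlonglongrightarrow> (\<integral>x. indicator F x \<partial>M)"
  proof (rule integral_dominated_convergence[where w="\<lambda>_. 1"])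
    show "AE x in M. (\<lambda>n. max 0 (1 - real n * infdist x F)) \<longlonglongrightarrow> indicator F x"
    proof (rule AE_I2)
      fix x show "(\<lambda>n. max 0 (1 - real n * infdist x F)) \<longlonglongrightarrow> indicator F x"
      proof (cases "x \<in> F")
        case True then show ?thesis by simp
      next
        case False
        then have d: "infdist x F > 0" using F infdist_pos_not_in_closed by blast
        then obtain N where N: "real N * infdist x F > 1" using ex_less_of_nat_mult by blast
        have "max 0 (1 - real n * infdist x F) = 0" if "n \<ge> N" for n
        proof -
          have "real N * infdist x F \<le> real n * infdist x F"
            using d that by (intro mult_right_mono) auto
          with N show ?thesis by linarith
        qed
        then have "\<forall>\<^sub>F n in sequentially. 0 = max 0 (1 - real n * infdist x F)"
          by (auto simp: eventually_sequentially intro!: exI[of _ N])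
        from Lim_transform_eventually[OF tendsto_const this] show ?thesis using False by simp
      qed
    qed
    show "(\<lambda>x. max 0 (1 - real i * infdist x F)) \<in> borel_measurable M" for i
      by (auto intro!: borel_measurable_continuous_onI continuous_intros simp: measurable_cong_sets[OF \<open>sets M = sets borel\<close> refl])
    show "indicator F \<in> borel_measurable M"
      using F M(2) by (intro borel_measurable_indicator) auto
    show "AE x in M. norm (max 0 (1 - real i * infdist x F)) \<le> 1" for i
      by (auto simp: infdist_nonneg)
  qed auto
  then show ?thesis using F M(2) by (simp add: sets_eq_imp_space_eq[OF M(2)])
qed

lemma measure_eqI_bounded_continuous:
  fixes \<mu> \<nu> :: "'a::euclidean_space measure"
  assumes \<mu>: "prob_space \<mu>" "sets \<mu> = sets borel" and \<nu>: "prob_space \<nu>" "sets \<nu> = sets borel"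
    and eq: "\<And>f :: 'a \<Rightarrow> real. continuous_on UNIV f \<Longrightarrow> bounded (range f) \<Longrightarrow> (\<integral>x. f x \<partial>\<mu>) = (\<integral>x. f x \<partial>\<nu>)"
  shows "\<mu> = \<nu>"
proof -
  interpret \<mu>: prob_space \<mu> by fact
  interpret \<nu>: prob_space \<nu> by fact
  have *: "emeasure \<mu> F = emeasure \<nu> F" if F: "closed F" for F
  proof (cases "F = {}")
    case False
    have "(\<integral>x. max 0 (1 - real n * infdist x F) \<partial>\<mu>) = (\<integral>x. max 0 (1 - real n * infdist x F) \<partial>\<nu>)" for n
      by (rule eq) (auto intro!: continuous_intros boundedI[of _ 1] simp: infdist_nonneg)
    then have "measure \<mu> F = measure \<nu> F"
      using LIMSEQ_unique integral_infdist_tendsto_measure[OF F False \<mu>] integral_infdist_tendsto_measure[OF F False \<nu>] by simp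
    then show ?thesis by (simp add: \<mu>.emeasure_eq_measure \<nu>.emeasure_eq_measure)
  qed simp
  show ?thesis
    by (rule measure_eqI_generator_eq[where E="Collect closed" and \<Omega>=UNIV and A="\<lambda>_. UNIV"])
       (auto simp: * \<mu>(2) \<nu>(2) borel_eq_closed Int_stable_def)
qed

text \<open>The law of \<open>a X + s Z\<close> for \<open>X\<close> distributed by \<open>\<mu>\<close> and an independent standard Gaussian \<open>Z\<close>. With
\<open>a = 1\<close> and \<open>s \<rightarrow> 0\<close> this is an approximate identity; with \<open>a\<^sup>2 + s\<^sup>2 = 1\<close> it is the Ornstein--Uhlenbeck
flow.\<close>

definition affine_gauss :: "real \<Rightarrow> real \<Rightarrow> 'a::euclidean_space measure \<Rightarrow> 'a measure" where
  "affine_gauss a s \<mu> = distr (\<mu> \<Otimes>\<^sub>M std_gauss) borel (\<lambda>(x, z). a *\<^sub>R x + s *\<^sub>R z)"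

text \<open>The density of \<open>s Z\<close> for \<open>s > 0\<close>.\<close>

definition gauss_kernel :: "real \<Rightarrow> 'a::euclidean_space \<Rightarrow> real" where
  "gauss_kernel s u = gauss_density ((1 / s) *\<^sub>R u) / s ^ DIM('a)"

text \<open>For \<open>s > 0\<close> this is the Lebesgue density of \<^term>\<open>affine_gauss a s \<mu>\<close>.\<close>

definition smoothed_density :: "real \<Rightarrow> real \<Rightarrow> 'a::euclidean_space measure \<Rightarrow> 'a \<Rightarrow> real" where
  "smoothed_density a s \<mu> y = (\<integral>x. gauss_kernel s (y - a *\<^sub>R x) \<partial>\<mu>)"

lemma sets_affine_gauss[simp, measurable_cong]: "sets (affine_gauss a s \<mu>) = sets borel"
  by (simp add: affine_gauss_def)

lemma space_affine_gauss[simp]: "space (affine_gauss a s \<mu>) = UNIV"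
  by (simp add: affine_gauss_def)

lemma measurable_affine_gauss_eq[simp]: "measurable (affine_gauss a s \<mu>) M = measurable borel M"
  by (rule measurable_cong_sets) auto

lemma borel_measurable_gauss_kernel[measurable]: "gauss_kernel s \<in> borel_measurable borel"
  unfolding gauss_kernel_def by measurable

lemma gauss_kernel_pos: "s > 0 \<Longrightarrow> gauss_kernel s u > 0"
  by (simp add: gauss_kernel_def gauss_density_pos)

lemma gauss_kernel_nonneg: "s > 0 \<Longrightarrow> 0 \<le> gauss_kernel s u"
  using gauss_kernel_pos[of s u] by simp

lemma gauss_kernel_bounded:
  assumes "s > 0" shows "gauss_kernel s (u::'a::euclidean_space) \<le> (1 / sqrt (2 * pi)) ^ DIM('a) / s ^ DIM('a)"
  unfolding gauss_kernel_def using assms by (intro divide_right_mono gauss_density_bounded) auto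

lemma nn_integral_std_gauss_affine:
  fixes f :: "'a::euclidean_space \<Rightarrow> ennreal"
  assumes [measurable]: "f \<in> borel_measurable borel" and s: "s > 0"
  shows "(\<integral>\<^sup>+z. f (c + s *\<^sub>R z) \<partial>std_gauss) = (\<integral>\<^sup>+y. ennreal (gauss_kernel s (y - c)) * f y \<partial>lborel)"
proof -
  have "(\<integral>\<^sup>+y. ennreal (gauss_kernel s (y - c)) * f y \<partial>lborel) =
    (\<integral>\<^sup>+y. ennreal (gauss_kernel s (y - c)) * f y \<partial>density (distr lborel borel (\<lambda>x. c + s *\<^sub>R x)) (\<lambda>_. ennreal (\<bar>s ^ DIM('a)\<bar>)))"
    by (subst lborel_affine[of s c]) (use s in auto)
  also have "\<dots> = (\<integral>\<^sup>+z. ennreal (gauss_density z) * f (c + s *\<^sub>R z) \<partial>lborel)"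
    by (subst nn_integral_density)
       (use s in \<open>auto simp: nn_integral_distr gauss_kernel_def mult.assoc[symmetric] ennreal_mult[symmetric] intro!: nn_integral_cong\<close>)
  also have "\<dots> = (\<integral>\<^sup>+z. f (c + s *\<^sub>R z) \<partial>std_gauss)"
    by (simp add: std_gauss_def nn_integral_density)
  finally show ?thesis by simp
qed

lemma integral_std_gauss_affine:
  fixes f :: "'a::euclidean_space \<Rightarrow> real"
  assumes [measurable]: "f \<in> borel_measurable borel" and s: "s > 0"
  shows "(\<integral>z. f (c + s *\<^sub>R z) \<partial>std_gauss) = (\<integral>y. gauss_kernel s (y - c) * f y \<partial>lborel)"
proof -
  have "distr std_gauss borel (\<lambda>z. c + s *\<^sub>R z) = density lborel (\<lambda>y. ennreal (gauss_kernel s (y - c)))"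
  proof (rule measure_eqI)
    fix A assume "A \<in> sets (distr std_gauss borel (\<lambda>z. c + s *\<^sub>R z))"
    then have [measurable]: "A \<in> sets borel" by simp
    have "emeasure (distr std_gauss borel (\<lambda>z. c + s *\<^sub>R z)) A
        = (\<integral>\<^sup>+y. indicator A y \<partial>distr std_gauss borel (\<lambda>z. c + s *\<^sub>R z))" by simp
    also have "\<dots> = (\<integral>\<^sup>+z. indicator A (c + s *\<^sub>R z) \<partial>std_gauss)"
      by (rule nn_integral_distr) auto
    finally show "emeasure (distr std_gauss borel (\<lambda>z. c + s *\<^sub>R z)) A
        = emeasure (density lborel (\<lambda>y. ennreal (gauss_kernel s (y - c)))) A"
      by (simp add: nn_integral_std_gauss_affine[OF _ s] emeasure_density)
  qed simp
  then have "(\<integral>y. f y \<partial>distr std_gauss borel (\<lambda>z. c + s *\<^sub>R z)) = (\<integral>y. gauss_kernel s (y - c) * f y \<partial>lborel)"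
    by (simp add: integral_density gauss_kernel_nonneg[OF s])
  then show ?thesis by (simp add: integral_distr)
qed

context
  fixes \<mu> :: "'a::euclidean_space measure"
  assumes \<mu>: "prob_space \<mu>" and sets_\<mu>[measurable_cong]: "sets \<mu> = sets borel"
begin

interpretation \<mu>: prob_space \<mu> by (rule \<mu>)
interpretation \<gamma>: prob_space "std_gauss :: 'a measure" by (rule prob_space_std_gauss)
interpretation pair_prob_space \<mu> "std_gauss :: 'a measure" ..

lemma prob_space_affine_gauss: "prob_space (affine_gauss a s \<mu>)"
  unfolding affine_gauss_def by (rule prob_space_distr) measurable

lemma nn_integral_affine_gauss:
  assumes [measurable]: "f \<in> borel_measurable borel"
  shows "(\<integral>\<^sup>+y. f y \<partial>affine_gauss a s \<mu>) = (\<integral>\<^sup>+x. \<integral>\<^sup>+z. f (a *\<^sub>R x + s *\<^sub>R z) \<partial>std_gauss \<partial>\<mu>)"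
  unfolding affine_gauss_def
  by (subst nn_integral_distr, measurable, subst \<gamma>.nn_integral_fst[symmetric]) auto

lemma integral_affine_gauss_pair:
  fixes f :: "'a \<Rightarrow> 'b::{banach, second_countable_topology}"
  assumes [measurable]: "f \<in> borel_measurable borel"
  shows "(\<integral>y. f y \<partial>affine_gauss a s \<mu>) = (\<integral>p. f (a *\<^sub>R fst p + s *\<^sub>R snd p) \<partial>(\<mu> \<Otimes>\<^sub>M std_gauss))"
    "integrable (affine_gauss a s \<mu>) f \<longleftrightarrow> integrable (\<mu> \<Otimes>\<^sub>M std_gauss) (\<lambda>p. f (a *\<^sub>R fst p + s *\<^sub>R snd p))"
  unfolding affine_gauss_def
  by (subst integral_distr; auto simp: case_prod_unfold) (subst integrable_distr_eq; auto simp: case_prod_unfold)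

lemma integral_affine_gauss:
  fixes f :: "'a \<Rightarrow> 'b::{banach, second_countable_topology}"
  assumes int: "integrable (affine_gauss a s \<mu>) f"
  shows "(\<integral>y. f y \<partial>affine_gauss a s \<mu>) = (\<integral>x. \<integral>z. f (a *\<^sub>R x + s *\<^sub>R z) \<partial>std_gauss \<partial>\<mu>)"
proof -
  have [measurable]: "f \<in> borel_measurable borel" using int by auto
  show ?thesis using int
    by (simp add: integral_affine_gauss_pair integral_fst'[symmetric])
qed

lemma integrable_gauss_kernel:
  assumes s: "s > 0" shows "integrable \<mu> (\<lambda>x. gauss_kernel s (y - a *\<^sub>R x))"
  by (rule \<mu>.integrable_const_bound[where B="(1 / sqrt (2 * pi)) ^ DIM('a) / s ^ DIM('a)"])
     (auto simp: gauss_kernel_nonneg[OF s] gauss_kernel_bounded[OF s])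

lemma affine_gauss_eq_density:
  assumes s: "s > 0"
  shows "affine_gauss a s \<mu> = density lborel (\<lambda>y. ennreal (smoothed_density a s \<mu> y))"
proof (rule measure_eqI)
  have [measurable]: "smoothed_density a s \<mu> \<in> borel_measurable borel" unfolding smoothed_density_def by measurable
  have eq: "(\<integral>\<^sup>+x. ennreal (gauss_kernel s (y - a *\<^sub>R x)) \<partial>\<mu>) = ennreal (smoothed_density a s \<mu> y)" for y
    unfolding smoothed_density_def
    by (rule nn_integral_eq_integral[OF integrable_gauss_kernel[OF s]]) (simp add: gauss_kernel_nonneg[OF s])
  fix A assume "A \<in> sets (affine_gauss a s \<mu>)"
  then have [measurable]: "A \<in> sets borel" by simp
  interpret L: pair_sigma_finite \<mu> "lborel :: 'a measure" ..
  have "emeasure (affine_gauss a s \<mu>) A = (\<integral>\<^sup>+y. indicator A y \<partial>affine_gauss a s \<mu>)" by simp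
  also have "\<dots> = (\<integral>\<^sup>+x. \<integral>\<^sup>+y. ennreal (gauss_kernel s (y - a *\<^sub>R x)) * indicator A y \<partial>lborel \<partial>\<mu>)"
    by (subst nn_integral_affine_gauss) (auto simp: nn_integral_std_gauss_affine[OF _ s])
  also have "\<dots> = (\<integral>\<^sup>+y. \<integral>\<^sup>+x. ennreal (gauss_kernel s (y - a *\<^sub>R x)) * indicator A y \<partial>\<mu> \<partial>lborel)"
    by (rule L.Fubini'[symmetric]) measurable
  also have "\<dots> = (\<integral>\<^sup>+y. ennreal (smoothed_density a s \<mu> y) * indicator A y \<partial>lborel)"
    by (subst nn_integral_multc) (auto simp: eq)
  finally show "emeasure (affine_gauss a s \<mu>) A = emeasure (density lborel (\<lambda>y. ennreal (smoothed_density a s \<mu> y))) A"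
    by (subst emeasure_density) auto
qed simp

lemma affine_gauss_1_0: "affine_gauss 1 0 \<mu> = \<mu>"
proof -
  have "affine_gauss 1 0 \<mu> = distr (\<mu> \<Otimes>\<^sub>M (std_gauss :: 'a measure)) \<mu> fst"
    unfolding affine_gauss_def by (rule distr_cong) (auto simp: sets_\<mu>)
  then show ?thesis by (simp add: \<gamma>.distr_pair_fst)
qed

lemma continuous_integral_affine_gauss:
  fixes f :: "'a \<Rightarrow> real"
  assumes f: "continuous_on UNIV f" "bounded (range f)"
    and lim: "(\<lambda>n. a' n) \<longlonglongrightarrow> a0" "(\<lambda>n. s' n) \<longlonglongrightarrow> s0"
  shows "(\<lambda>n. \<integral>y. f y \<partial>affine_gauss (a' n) (s' n) \<mu>) \<longlonglongrightarrow> (\<integral>y. f y \<partial>affine_gauss a0 s0 \<mu>)"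
proof -
  have [measurable]: "f \<in> borel_measurable borel"
    using f by (rule_tac borel_measurable_continuous_onI)
  obtain B where B: "\<And>x. \<bar>f x\<bar> \<le> B" using f(2) by (auto simp: bounded_iff)
  show ?thesis unfolding integral_affine_gauss_pair(1)[OF \<open>f \<in> borel_measurable borel\<close>]
  proof (rule integral_dominated_convergence[where w="\<lambda>_. B"])
    show "AE p in \<mu> \<Otimes>\<^sub>M std_gauss. (\<lambda>n. f (a' n *\<^sub>R fst p + s' n *\<^sub>R snd p)) \<longlonglongrightarrow> f (a0 *\<^sub>R fst p + s0 *\<^sub>R snd p)"
      using f(1) by (intro AE_I2 isCont_tendsto_compose[of _ f] tendsto_intros lim)
         (auto simp: continuous_on_eq_continuous_at)
  qed (auto simp: B)
qed

end

text \<open>A Gaussian is its own Fourier transform, so the density of the smoothed measure \<open>affine_gauss 1 s \<mu>\<close> at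
\<open>y\<close> is, up to a constant factor, a Gaussian average over \<open>\<zeta>\<close> of the integrals of \<open>cos (\<zeta> \<bullet> (x - y) / s)\<close>. Equal transforms thus
give equal smoothed measures for every \<open>s > 0\<close>, and \<open>s \<rightarrow> 0\<close> recovers the measures themselves.\<close>

lemma measure_eqI_cos_transform:
  fixes \<mu> \<nu> :: "'a::euclidean_space measure"
  assumes \<mu>: "prob_space \<mu>" "sets \<mu> = sets borel" and \<nu>: "prob_space \<nu>" "sets \<nu> = sets borel"
    and eq: "\<And>\<xi> \<beta>. (\<integral>x. cos (\<xi> \<bullet> x + \<beta>) \<partial>\<mu>) = (\<integral>x. cos (\<xi> \<bullet> x + \<beta>) \<partial>\<nu>)"
  shows "\<mu> = \<nu>"
proof -
  interpret \<gamma>: prob_space "std_gauss :: 'a measure" by (rule prob_space_std_gauss)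
  have smoothed: "smoothed_density 1 s M y =
      (1 / sqrt (2 * pi)) ^ DIM('a) / s ^ DIM('a) *
        (\<integral>\<zeta>. \<integral>x. cos (((1 / s) *\<^sub>R \<zeta>) \<bullet> x + - (\<zeta> \<bullet> y) / s) \<partial>M \<partial>std_gauss)"
    if M: "prob_space M" "sets M = sets borel" for M :: "'a measure" and s :: real and y
  proof -
    interpret M: prob_space M by fact
    interpret P: pair_prob_space M "std_gauss :: 'a measure" ..
    note [measurable_cong] = M(2)
    have kern: "gauss_kernel s (y - x) = (1 / sqrt (2 * pi)) ^ DIM('a) / s ^ DIM('a) *
       (\<integral>\<zeta>. cos (((1 / s) *\<^sub>R \<zeta>) \<bullet> x + - (\<zeta> \<bullet> y) / s) \<partial>std_gauss)" for x
    proof -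
      have "cos (((1 / s) *\<^sub>R \<zeta>) \<bullet> x + - (\<zeta> \<bullet> y) / s) = cos (((1 / s) *\<^sub>R (y - x)) \<bullet> \<zeta>)" for \<zeta>
        by (subst cos_minus[symmetric], rule arg_cong[where f=cos])
           (simp add: inner_diff_left inner_diff_right inner_commute diff_divide_distrib)
      then show ?thesis by (simp only: char_std_gauss gauss_kernel_def gauss_density_eq times_divide_eq_left)
    qed
    have [measurable]: "(\<lambda>(x, \<zeta>). cos (((1 / s) *\<^sub>R \<zeta>) \<bullet> x + - (\<zeta> \<bullet> y) / s)) \<in> borel_measurable (M \<Otimes>\<^sub>M std_gauss)"
      by measurable
    have "integrable (M \<Otimes>\<^sub>M std_gauss) (\<lambda>(x, \<zeta>). cos (((1 / s) *\<^sub>R \<zeta>) \<bullet> x + - (\<zeta> \<bullet> y) / s))"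
      by (intro P.integrable_const_bound[where B=1]) (simp add: case_prod_unfold, measurable)
    from P.Fubini_integral[OF this] show ?thesis
      by (simp add: smoothed_density_def kern)
  qed
  have *: "affine_gauss 1 s \<mu> = affine_gauss 1 s \<nu>" if s: "s > 0" for s
    unfolding affine_gauss_eq_density[OF \<mu> s] affine_gauss_eq_density[OF \<nu> s]
      smoothed[OF \<mu>] smoothed[OF \<nu>] eq ..
  show ?thesis
  proof (rule measure_eqI_bounded_continuous[OF \<mu> \<nu>])
    fix f :: "'a \<Rightarrow> real" assume f: "continuous_on UNIV f" "bounded (range f)"
    have lim: "(\<lambda>n. inverse (real (Suc n))) \<longlonglongrightarrow> 0"
      by (rule LIMSEQ_inverse_real_of_nat)
    have "(\<lambda>n. \<integral>y. f y \<partial>affine_gauss 1 (inverse (real (Suc n))) \<mu>) \<longlonglongrightarrow> (\<integral>y. f y \<partial>affine_gauss 1 0 \<mu>)"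
      by (rule continuous_integral_affine_gauss[OF \<mu> f tendsto_const lim])
    moreover have "(\<lambda>n. \<integral>y. f y \<partial>affine_gauss 1 (inverse (real (Suc n))) \<nu>) \<longlonglongrightarrow> (\<integral>y. f y \<partial>affine_gauss 1 0 \<nu>)"
      by (rule continuous_integral_affine_gauss[OF \<nu> f tendsto_const lim])
    ultimately have "(\<integral>y. f y \<partial>affine_gauss 1 0 \<mu>) = (\<integral>y. f y \<partial>affine_gauss 1 0 \<nu>)"
      by (simp add: * LIMSEQ_unique)
    then show "(\<integral>x. f x \<partial>\<mu>) = (\<integral>x. f x \<partial>\<nu>)"
      by (simp add: affine_gauss_1_0[OF \<mu>] affine_gauss_1_0[OF \<nu>])
  qed
qed

section \<open>Test functions on space-time\<close>

text \<open>The set \<open>K\<close> is carried along because, unlike the support itself, it stays the same for all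
derivatives of \<open>f\<close>.\<close>

definition smooth_supported :: "'a::euclidean_space set \<Rightarrow> ('a \<Rightarrow> real) \<Rightarrow> bool" where
  "smooth_supported K f \<longleftrightarrow> (\<forall>k. Ck_fun k f) \<and> (\<forall>z. z \<notin> K \<longrightarrow> f z = 0)"

lemma smooth_supported_dir_deriv:
  assumes "smooth_supported K f" "closed K" "b \<in> Basis"
  shows "smooth_supported K (dir_deriv b f)"
  unfolding smooth_supported_def
proof (intro conjI allI impI)
  show "Ck_fun k (dir_deriv b f)" for k
    using assms Ck_fun.simps(2)[of k f] by (auto simp: smooth_supported_def simp del: Ck_fun.simps)
  fix z assume z: "z \<notin> K"
  have "((\<lambda>_. 0) has_derivative (\<lambda>_. 0)) (at z)" by simp
  then have "(f has_derivative (\<lambda>_. 0)) (at z)"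
    by (rule has_derivative_transform_within_open[where s="- K"])
       (use assms z in \<open>auto simp: smooth_supported_def\<close>)
  then show "dir_deriv b f z = 0" by (rule dir_deriv_eqI)
qed

lemma smooth_supported_continuous: "smooth_supported K f \<Longrightarrow> continuous_on S f"
  unfolding smooth_supported_def using Ck_fun_imp_continuous continuous_on_subset by blast

lemma compact_support_bounded:
  fixes f :: "'a::topological_space \<Rightarrow> 'b::real_normed_vector"
  assumes "continuous_on K f" "compact K" "\<And>z. z \<notin> K \<Longrightarrow> f z = 0"
  obtains B where "0 < B" "\<And>z. norm (f z) \<le> B"
proof -
  have "bounded (f ` K)" using assms by (intro compact_imp_bounded compact_continuous_image)
  then obtain B where B: "\<forall>z\<in>K. norm (f z) \<le> B" by (auto simp: bounded_iff)
  show thesis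
  proof (rule that[of "max B 1"])
    show "norm (f z) \<le> max B 1" for z
      using B assms(3)[of z] by (cases "z \<in> K") (auto simp: le_max_iff_disj)
  qed simp
qed

lemma smooth_supported_bounded:
  assumes "smooth_supported K f" "compact K" obtains B where "0 < B" "\<And>z. \<bar>f z\<bar> \<le> B"
  using compact_support_bounded[OF smooth_supported_continuous[OF assms(1)] assms(2)] assms(1)
  unfolding smooth_supported_def real_norm_def by metis

lemma smooth_supported_has_derivative:
  "smooth_supported K f \<Longrightarrow> (f has_derivative (\<lambda>v. dir_deriv v f z)) (at z)"
  by (rule has_derivative_frechet) (metis Ck_fun.simps(2) smooth_supported_def)

lemma test_function_smooth_supported:
  assumes "\<phi> \<in> test_functions U"
  obtains K where "compact K" "K \<subseteq> U" "smooth_supported K \<phi>"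
proof (rule that[of "closure {z. \<phi> z \<noteq> 0}"])
  show "smooth_supported (closure {z. \<phi> z \<noteq> 0}) \<phi>"
    using assms closure_subset[of "{z. \<phi> z \<noteq> 0}"]
    by (auto simp: test_functions_def smooth_supported_def)
qed (use assms in \<open>auto simp: test_functions_def\<close>)

lemma time_space_Basis: "(1, 0) \<in> (Basis :: (real \<times> (real^'d)) set)" "(0, axis i 1) \<in> (Basis :: (real \<times> (real^'d)) set)"
  by (auto simp: Basis_prod_def axis_in_Basis_iff image_iff Basis_real_def)

lemma has_derivative_time_space:
  fixes \<phi> :: "real \<times> (real^'d) \<Rightarrow> real"
  assumes "smooth_supported K \<phi>"
  shows "(\<phi> has_derivative (\<lambda>(r, v). r * time_deriv \<phi> z + v \<bullet> space_grad \<phi> z)) (at z)"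
proof -
  have D: "(\<phi> has_derivative (\<lambda>v. dir_deriv v \<phi> z)) (at z)"
    using smooth_supported_has_derivative[OF assms] .
  then interpret L: linear "\<lambda>v. dir_deriv v \<phi> z" by (rule has_derivative_linear)
  have "dir_deriv (r, v) \<phi> z = r * time_deriv \<phi> z + v \<bullet> space_grad \<phi> z" for r and v :: "real^'d"
  proof -
    have "(r, v) = r *\<^sub>R (1, 0) + (\<Sum>i\<in>UNIV. (v $ i) *\<^sub>R (0, axis i 1))"
      using basis_expansion[of v] by (simp add: sum_prod scalar_mult_eq_scaleR)
    then have "dir_deriv (r, v) \<phi> z = r * dir_deriv (1, 0) \<phi> z + (\<Sum>i\<in>UNIV. v $ i * dir_deriv (0, axis i 1) \<phi> z)"
      by (simp only: L.add L.scale L.sum real_scaleR_def)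
    then show ?thesis by (simp add: time_deriv_def space_grad_def inner_vec_def)
  qed
  then have "(\<lambda>v. dir_deriv v \<phi> z) = (\<lambda>(r, v). r * time_deriv \<phi> z + v \<bullet> space_grad \<phi> z)"
    by (auto simp: fun_eq_iff)
  then show ?thesis using D by simp
qed

lemma smooth_supported_space_time:
  fixes \<phi> :: "real \<times> (real^'d) \<Rightarrow> real"
  assumes "smooth_supported K \<phi>" "compact K"
  shows "smooth_supported K (time_deriv \<phi>)" "smooth_supported K (\<lambda>z. space_grad \<phi> z $ i)"
    "smooth_supported K (space_laplacian \<phi>)"
proof -
  have "closed K" using assms(2) by (rule compact_imp_closed)
  note * = smooth_supported_dir_deriv[OF _ this]
  show "smooth_supported K (time_deriv \<phi>)" "smooth_supported K (\<lambda>z. space_grad \<phi> z $ i)"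
    using *[OF assms(1)] by (auto simp: time_deriv_def space_grad_def time_space_Basis)
  have "smooth_supported K (dir_deriv (0, axis i 1) (dir_deriv (0, axis i 1) \<phi>))" for i
    by (intro * assms(1) time_space_Basis)
  then show "smooth_supported K (space_laplacian \<phi>)"
    by (auto simp: smooth_supported_def space_laplacian_def[abs_def] intro!: Ck_fun_sum)
qed

lemma continuous_space_grad:
  assumes "smooth_supported K \<phi>" "compact K"
  shows "continuous_on UNIV (space_grad \<phi>)"
proof -
  have "continuous_on UNIV (\<lambda>z. \<chi> i. space_grad \<phi> z $ i)"
    by (intro continuous_on_vec_lambda smooth_supported_continuous[OF smooth_supported_space_time(2)[OF assms]])
  then show ?thesis by simp
qed

lemma borel_measurable_test:
  assumes "smooth_supported K \<phi>" "compact K"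
  shows "time_deriv \<phi> \<in> borel_measurable (borel \<Otimes>\<^sub>M borel)" "space_grad \<phi> \<in> borel_measurable (borel \<Otimes>\<^sub>M borel)"
    "space_laplacian \<phi> \<in> borel_measurable (borel \<Otimes>\<^sub>M borel)"
  using smooth_supported_space_time[OF assms] continuous_space_grad[OF assms] unfolding borel_prod
  by (auto intro!: borel_measurable_continuous_onI smooth_supported_continuous)

lemma space_grad_eq_0:
  assumes "smooth_supported K \<phi>" "compact K" "z \<notin> K" shows "space_grad \<phi> z = 0"
proof -
  have "space_grad \<phi> z $ i = 0" for i
    using smooth_supported_space_time(2)[OF assms(1,2), of i] assms(3) unfolding smooth_supported_def by blast
  then show ?thesis by (simp add: vec_eq_iff)
qed

lemma space_grad_bounded:
  assumes "smooth_supported K \<phi>" "compact K" obtains B where "0 < B" "\<And>z. norm (space_grad \<phi> z) \<le> B"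
  using compact_support_bounded[OF continuous_on_subset[OF continuous_space_grad[OF assms]] assms(2) space_grad_eq_0[OF assms]]
  by (metis subset_UNIV)

lemma compact_time_bounds:
  fixes K :: "(real \<times> 'a::euclidean_space) set"
  assumes "compact K" "K \<subseteq> {0<..} \<times> UNIV"
  obtains a b where "0 < a" "a \<le> b" "\<And>t x. (t, x) \<in> K \<Longrightarrow> a \<le> t \<and> t \<le> b"
proof (cases "K = {}")
  case True then show thesis using that[of 1 1] by auto
next
  case False
  have c: "compact (fst ` K)" by (intro compact_continuous_image continuous_intros assms)
  obtain a where a: "a \<in> fst ` K" "\<And>t. t \<in> fst ` K \<Longrightarrow> a \<le> t"
    using compact_attains_inf[OF c] False by auto
  obtain b where b: "b \<in> fst ` K" "\<And>t. t \<in> fst ` K \<Longrightarrow> t \<le> b"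
    using compact_attains_sup[OF c] False by auto
  show thesis
  proof (rule that)
    show "0 < a" using a(1) assms(2) by auto
    show "a \<le> b" using a(2)[OF b(1)] .
    show "a \<le> t \<and> t \<le> b" if "(t, x) \<in> K" for t x
      using a(2)[of t] b(2)[of t] that by force
  qed
qed

lemma integrable_prod_mult:
  fixes f :: "'a \<Rightarrow> real" and g :: "'b \<Rightarrow> real"
  assumes "sigma_finite_measure M1" "sigma_finite_measure M2" "integrable M1 f" "integrable M2 g"
  shows "integrable (M1 \<Otimes>\<^sub>M M2) (\<lambda>(x, y). f x * g y)"
proof -
  interpret M1: sigma_finite_measure M1 by fact
  interpret M2: sigma_finite_measure M2 by fact
  interpret pair_sigma_finite M1 M2 ..
  have [measurable]: "f \<in> borel_measurable M1" "g \<in> borel_measurable M2" using assms by auto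
  show ?thesis
    by (rule Fubini_integrable) (use assms in \<open>auto simp: abs_mult\<close>)
qed

text \<open>In probabilistic notation, \<open>E[Z \<bullet> \<nabla>\<phi>(t, c + s Z)] = s E[\<Delta>\<phi>(t, c + s Z)]\<close>: integration by parts in
each coordinate. This is how the noise produces the Laplacian.\<close>

lemma gauss_ibp_space:
  fixes \<phi> :: "real \<times> (real^'d) \<Rightarrow> real"
  assumes \<phi>: "smooth_supported K \<phi>" "compact K"
  shows "(\<integral>z. z \<bullet> space_grad \<phi> (t, c + s *\<^sub>R z) \<partial>std_gauss) = s * (\<integral>z. space_laplacian \<phi> (t, c + s *\<^sub>R z) \<partial>std_gauss)"
proof -
  interpret \<gamma>: prob_space "std_gauss :: (real^'d) measure" by (rule prob_space_std_gauss)
  define d where "d i = dir_deriv (0, axis i 1) \<phi>" for i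
  define d2 where "d2 i = dir_deriv (0, axis i 1) (d i)" for i
  have d: "smooth_supported K (d i)" and d2: "smooth_supported K (d2 i)" for i
    unfolding d_def d2_def by (intro smooth_supported_dir_deriv \<phi> compact_imp_closed time_space_Basis)+
  have cont: "continuous_on UNIV (\<lambda>z. d i (t, c + s *\<^sub>R z))" "continuous_on UNIV (\<lambda>z. d2 i (t, c + s *\<^sub>R z))" for i
    by (rule continuous_on_compose2[OF smooth_supported_continuous[OF d, of UNIV]]
             continuous_on_compose2[OF smooth_supported_continuous[OF d2, of UNIV]];
        auto intro!: continuous_intros)+
  note [measurable] = cont[THEN borel_measurable_continuous_onI]
  have int: "integrable std_gauss (\<lambda>z. d i (t, c + s *\<^sub>R z))"
            "integrable std_gauss (\<lambda>z. d2 i (t, c + s *\<^sub>R z))"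
            "integrable std_gauss (\<lambda>z. d i (t, c + s *\<^sub>R z) * (z \<bullet> axis i 1))" for i
  proof -
    obtain B where B: "0 < B" "\<And>z. \<bar>d i z\<bar> \<le> B" using smooth_supported_bounded[OF d[of i] \<phi>(2)] by metis
    obtain B2 where B2: "0 < B2" "\<And>z. \<bar>d2 i z\<bar> \<le> B2" using smooth_supported_bounded[OF d2[of i] \<phi>(2)] by metis
    show "integrable std_gauss (\<lambda>z. d i (t, c + s *\<^sub>R z))"
      by (rule integrable_std_gauss_bound[where A=B and B=0]) (use B in auto)
    show "integrable std_gauss (\<lambda>z. d2 i (t, c + s *\<^sub>R z))"
      by (rule integrable_std_gauss_bound[where A=B2 and B=0]) (use B2 in auto)
    have "integrable std_gauss (\<lambda>z :: real^'d. B * \<bar>z \<bullet> axis i 1\<bar>)"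
      using gauss_moments(3)[of "axis i (1::real) :: real^'d" "axis i 1"] by (auto simp: axis_in_Basis_iff Basis_real_def)
    then show "integrable std_gauss (\<lambda>z. d i (t, c + s *\<^sub>R z) * (z \<bullet> axis i 1))"
    proof (rule Bochner_Integration.integrable_bound)
      show "(\<lambda>z. d i (t, c + s *\<^sub>R z) * (z \<bullet> axis i 1)) \<in> borel_measurable std_gauss"
        by (simp, measurable)
    qed (use B in \<open>auto simp: abs_mult intro!: mult_right_mono\<close>)
  qed
  have "(\<integral>z. s * d2 i (t, c + s *\<^sub>R z) \<partial>std_gauss) = (\<integral>z. d i (t, c + s *\<^sub>R z) * (z \<bullet> axis i 1) \<partial>std_gauss)" for i
  proof (rule gauss_integration_by_parts)
    show "((\<lambda>r. d i (t, c + s *\<^sub>R (z + r *\<^sub>R axis i 1))) has_real_derivative s * d2 i (t, c + s *\<^sub>R z)) (at 0)" for z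
    proof -
      have D: "(d i has_derivative (\<lambda>v. dir_deriv v (d i) (t, c + s *\<^sub>R z))) (at (t, c + s *\<^sub>R (z + 0 *\<^sub>R axis i 1)))"
        using smooth_supported_has_derivative[OF d] by simp
      have "((\<lambda>r. d i (t, c + s *\<^sub>R (z + r *\<^sub>R axis i 1))) has_derivative
           (\<lambda>r. dir_deriv (0, (s * r) *\<^sub>R axis i 1) (d i) (t, c + s *\<^sub>R z))) (at 0)"
        by (rule has_derivative_compose[where g="d i" and f="\<lambda>r. (t, c + s *\<^sub>R (z + r *\<^sub>R axis i 1))", OF _ D])
           (auto intro!: derivative_eq_intros)
      moreover have "dir_deriv (0, (s * r) *\<^sub>R axis i 1) (d i) (t, c + s *\<^sub>R z) = s * d2 i (t, c + s *\<^sub>R z) * r" for r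
        using linear_cmul[OF has_derivative_linear[OF D], of "s * r" "(0, axis i 1)"] by (simp add: d2_def)
      ultimately show ?thesis by (simp add: has_field_derivative_def)
    qed
  qed (use int cont in \<open>auto simp: axis_in_Basis_iff intro!: continuous_intros\<close>)
  then have *: "(\<integral>z. d i (t, c + s *\<^sub>R z) * (z \<bullet> axis i 1) \<partial>std_gauss) = s * (\<integral>z. d2 i (t, c + s *\<^sub>R z) \<partial>std_gauss)" for i
    by simp
  have "z \<bullet> space_grad \<phi> w = (\<Sum>i\<in>UNIV. d i w * (z \<bullet> axis i 1))" for z w
    unfolding inner_axis by (subst inner_vec_def) (simp add: space_grad_def d_def mult.commute)
  then have "(\<integral>z. z \<bullet> space_grad \<phi> (t, c + s *\<^sub>R z) \<partial>std_gauss) =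
        (\<integral>z. (\<Sum>i\<in>UNIV. d i (t, c + s *\<^sub>R z) * (z \<bullet> axis i 1)) \<partial>std_gauss)"
    by simp
  also have "\<dots> = (\<Sum>i\<in>UNIV. s * (\<integral>z. d2 i (t, c + s *\<^sub>R z) \<partial>std_gauss))"
    using int by (simp add: *)
  also have "\<dots> = s * (\<integral>z. space_laplacian \<phi> (t, c + s *\<^sub>R z) \<partial>std_gauss)"
    using int by (simp add: space_laplacian_def d2_def d_def sum_distrib_left)
  finally show ?thesis .
qed

text \<open>The left side is the generator at \<open>c + s Z\<close>, the right side the transport along a path. For \<open>c = exp (-t) x\<close>
and \<open>s\<^sup>2 = 1 - exp (-2 t)\<close> one has \<open>(1 - s\<^sup>2) / s = s'\<close>, so the velocity on the right is the time
derivative of \<open>c + s z\<close>.\<close>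

lemma gauss_drift_exchange:
  fixes \<phi> :: "real \<times> (real^'d) \<Rightarrow> real"
  assumes \<phi>: "smooth_supported K \<phi>" "compact K" and s: "0 < s"
  shows "(\<integral>z. time_deriv \<phi> (t, c + s *\<^sub>R z) + space_laplacian \<phi> (t, c + s *\<^sub>R z)
        - (c + s *\<^sub>R z) \<bullet> space_grad \<phi> (t, c + s *\<^sub>R z) \<partial>std_gauss)
    = (\<integral>z. time_deriv \<phi> (t, c + s *\<^sub>R z)
        + (- c + ((1 - s\<^sup>2) / s) *\<^sub>R z) \<bullet> space_grad \<phi> (t, c + s *\<^sub>R z) \<partial>std_gauss)" (is "?L = ?R")
proof -
  note ss = smooth_supported_space_time[OF \<phi>]
  have [measurable]: "time_deriv \<phi> \<in> borel_measurable (borel \<Otimes>\<^sub>M borel)" "space_grad \<phi> \<in> borel_measurable (borel \<Otimes>\<^sub>M borel)"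
    "space_laplacian \<phi> \<in> borel_measurable (borel \<Otimes>\<^sub>M borel)"
    by (rule borel_measurable_test[OF \<phi>])+
  obtain B1 where B1: "0 < B1" "\<And>z. \<bar>time_deriv \<phi> z\<bar> \<le> B1" using smooth_supported_bounded[OF ss(1) \<phi>(2)] by metis
  obtain B2 where B2: "0 < B2" "\<And>z. norm (space_grad \<phi> z) \<le> B2" using space_grad_bounded[OF \<phi>] by metis
  obtain B3 where B3: "0 < B3" "\<And>z. \<bar>space_laplacian \<phi> z\<bar> \<le> B3" using smooth_supported_bounded[OF ss(3) \<phi>(2)] by metis
  have i1: "integrable std_gauss (\<lambda>z. time_deriv \<phi> (t, c + s *\<^sub>R z))"
    by (rule integrable_std_gauss_bound[where A=B1 and B=0]) (use B1 in auto)
  have i2: "integrable std_gauss (\<lambda>z. space_laplacian \<phi> (t, c + s *\<^sub>R z))"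
    by (rule integrable_std_gauss_bound[where A=B3 and B=0]) (use B3 in auto)
  have i4: "integrable std_gauss (\<lambda>z. c \<bullet> space_grad \<phi> (t, c + s *\<^sub>R z))"
    by (rule integrable_std_gauss_bound[where A="norm c * B2" and B=0])
       (use B2 in \<open>auto intro!: order_trans[OF Cauchy_Schwarz_ineq2] mult_left_mono\<close>)
  have i3: "integrable std_gauss (\<lambda>z. z \<bullet> space_grad \<phi> (t, c + s *\<^sub>R z))"
  proof (rule integrable_std_gauss_bound[where A="B2" and B=B2])
    fix z :: "real^'d"
    have "norm z * norm (space_grad \<phi> (t, c + s *\<^sub>R z)) \<le> (1 + (norm z)\<^sup>2) * B2"
      using B2 by (intro mult_mono le_one_plus_square) auto
    then show "\<bar>z \<bullet> space_grad \<phi> (t, c + s *\<^sub>R z)\<bar> \<le> B2 + B2 * (norm z)\<^sup>2"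
      using Cauchy_Schwarz_ineq2[of z "space_grad \<phi> (t, c + s *\<^sub>R z)"] by (simp add: algebra_simps)
  qed measurable
  \<comment> \<open>The two sides differ by \<open>E[\<Delta>\<phi>]\<close> minus this multiple of \<open>E[Z \<bullet> \<nabla>\<phi>]\<close>.\<close>
  have e: "s + (1 - s\<^sup>2) / s = 1 / s" using s by (simp add: field_simps power2_eq_square)
  have "?L - ?R = (\<integral>z. space_laplacian \<phi> (t, c + s *\<^sub>R z) \<partial>std_gauss) -
      (s + (1 - s\<^sup>2) / s) * (\<integral>z. z \<bullet> space_grad \<phi> (t, c + s *\<^sub>R z) \<partial>std_gauss)"
    using i1 i2 i3 i4 by (simp add: inner_add_left inner_diff_left distrib_right)
  also have "\<dots> = 0" unfolding e gauss_ibp_space[OF \<phi>] using s by simp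
  finally show ?thesis by simp
qed

section \<open>Mehler's formula solves the Ornstein--Uhlenbeck equation\<close>

definition mehler :: "real \<Rightarrow> 'a::euclidean_space measure \<Rightarrow> 'a measure" where
  "mehler t \<mu> = affine_gauss (exp (- t)) (sqrt (1 - exp (- (2 * t)))) \<mu>"

lemma weakly_continuous_mehler:
  assumes "prob_space \<mu>" "sets \<mu> = sets borel"
  shows "weakly_continuous_on {0..} (\<lambda>t. mehler t \<mu>)"
  unfolding weakly_continuous_on_def mehler_def
proof (intro allI impI)
  fix f :: "real^'a \<Rightarrow> real" assume f: "continuous_on UNIV f \<and> bounded (range f)"
  show "continuous_on {0..} (\<lambda>t. \<integral>x. f x \<partial>affine_gauss (exp (- t)) (sqrt (1 - exp (- (2 * t)))) \<mu>)"
    unfolding continuous_on_sequentially comp_def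
    using f by (intro ballI allI impI continuous_integral_affine_gauss[OF assms]) (auto intro!: tendsto_intros)
qed

text \<open>Write \<open>Y\<^sub>t = exp (-t) X + s\<^sub>t Z\<close>. For fixed \<open>(X, Z)\<close> the curve \<open>t \<mapsto> \<phi> (t, Y\<^sub>t)\<close> has compact support in
\<open>(0, \<infinity>)\<close>, so its derivative \<open>\<partial>\<^sub>t\<phi> + Y'\<^sub>t \<bullet> \<nabla>\<phi>\<close> has integral \<open>0\<close>. The velocity \<open>Y'\<^sub>t\<close> grows linearly in
\<open>(X, Z)\<close>, and first moments are what Fubini's theorem needs. For fixed \<open>t\<close>, \<open>gauss_drift_exchange\<close> shows
that this derivative has the same expectation as \<open>\<partial>\<^sub>t\<phi> + \<Delta>\<phi> - Y\<^sub>t \<bullet> \<nabla>\<phi>\<close>.\<close>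

lemma OU_solution_mehler:
  fixes \<mu> :: "(real^'d) measure"
  assumes \<mu>: "prob_space \<mu>" "sets \<mu> = sets borel" "integrable \<mu> (\<lambda>x. norm x)"
  shows "OU_solution \<mu> (\<lambda>t. mehler t \<mu>)"
  unfolding OU_solution_def
proof (intro conjI ballI allI impI)
  show "mehler 0 \<mu> = \<mu>" by (simp add: mehler_def affine_gauss_1_0[OF \<mu>(1,2)])
  show "mehler t \<mu> \<in> borel_prob" for t
    by (simp add: mehler_def borel_prob_def prob_space_affine_gauss[OF \<mu>(1,2)])
  show "weakly_continuous_on {0..} (\<lambda>t. mehler t \<mu>)"
    by (rule weakly_continuous_mehler[OF \<mu>(1,2)])
  fix \<phi> :: "real \<times> (real^'d) \<Rightarrow> real" assume "\<phi> \<in> test_functions ({0<..} \<times> UNIV)"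
  then obtain K where K: "compact K" "K \<subseteq> {0<..} \<times> UNIV" and \<phi>: "smooth_supported K \<phi>"
    by (rule test_function_smooth_supported)
  obtain a b where ab: "0 < a" "a \<le> b" and Kab: "\<And>t x. (t, x) \<in> K \<Longrightarrow> a \<le> t \<and> t \<le> b"
    using compact_time_bounds[OF K] by metis
  interpret \<mu>: prob_space \<mu> by fact
  interpret \<gamma>: prob_space "std_gauss :: (real^'d) measure" by (rule prob_space_std_gauss)
  interpret P: pair_prob_space \<mu> "std_gauss :: (real^'d) measure" ..
  let ?P = "\<mu> \<Otimes>\<^sub>M (std_gauss :: (real^'d) measure)"
  interpret LP: pair_sigma_finite lborel ?P ..
  note [measurable_cong] = \<mu>(2)
  note ss = smooth_supported_space_time[OF \<phi> K(1)]
  have [measurable]: "time_deriv \<phi> \<in> borel_measurable (borel \<Otimes>\<^sub>M borel)" "space_grad \<phi> \<in> borel_measurable (borel \<Otimes>\<^sub>M borel)"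
    "space_laplacian \<phi> \<in> borel_measurable (borel \<Otimes>\<^sub>M borel)"
    by (rule borel_measurable_test[OF \<phi> K(1)])+
  obtain B1 where B1: "0 < B1" "\<And>z. \<bar>time_deriv \<phi> z\<bar> \<le> B1" using smooth_supported_bounded[OF ss(1) K(1)] by metis
  obtain B2 where B2: "0 < B2" "\<And>z. norm (space_grad \<phi> z) \<le> B2" using space_grad_bounded[OF \<phi> K(1)] by metis
  obtain B3 where B3: "0 < B3" "\<And>z. \<bar>space_laplacian \<phi> z\<bar> \<le> B3" using smooth_supported_bounded[OF ss(3) K(1)] by metis
  define s where "s t = sqrt (1 - exp (- (2 * t)))" for t :: real
  have s_pos: "s t > 0" if "t > 0" for t using that by (simp add: s_def)
  define Y where "Y t p = exp (- t) *\<^sub>R fst p + s t *\<^sub>R snd p" for t and p :: "(real^'d) \<times> (real^'d)"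
  define Y' where "Y' t p = - exp (- t) *\<^sub>R fst p + (exp (- (2 * t)) / s t) *\<^sub>R snd p" for t and p :: "(real^'d) \<times> (real^'d)"
  define Q where "Q t p = time_deriv \<phi> (t, Y t p) + Y' t p \<bullet> space_grad \<phi> (t, Y t p)" for t p
  have Q0: "Q t p = 0" if "\<not> (a \<le> t \<and> t \<le> b)" for t p
  proof -
    have "(t, Y t p) \<notin> K" using that Kab by blast
    then have "time_deriv \<phi> (t, Y t p) = 0" "space_grad \<phi> (t, Y t p) = 0"
      using ss(1) space_grad_eq_0[OF \<phi> K(1)] unfolding smooth_supported_def by blast+
    then show ?thesis by (simp add: Q_def)
  qed
  have path: "((\<lambda>t. \<phi> (t, Y t p)) has_real_derivative Q t p) (at t)" if "t > 0" for t p
  proof -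
    have s': "(s has_real_derivative exp (- (2 * t)) / s t) (at t)"
      unfolding s_def[abs_def] using that
      by (auto intro!: derivative_eq_intros simp: s_def divide_simps)
    have "((\<lambda>t. (t, Y t p)) has_derivative (\<lambda>h. (h, h *\<^sub>R Y' t p))) (at t)"
      unfolding Y_def Y'_def
      by (auto intro!: derivative_eq_intros s'[unfolded has_field_derivative_def] simp: algebra_simps)
    from has_derivative_compose[OF this has_derivative_time_space[OF \<phi>]]
    have "((\<lambda>t. \<phi> (t, Y t p)) has_derivative (\<lambda>h. h * time_deriv \<phi> (t, Y t p) + (h *\<^sub>R Y' t p) \<bullet> space_grad \<phi> (t, Y t p))) (at t)"
      by simp
    moreover have "(\<lambda>h. h * time_deriv \<phi> (t, Y t p) + (h *\<^sub>R Y' t p) \<bullet> space_grad \<phi> (t, Y t p)) = (*) (Q t p)"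
      by (auto simp: Q_def algebra_simps fun_eq_iff)
    ultimately show ?thesis by (simp only: has_field_derivative_def)
  qed
  have Qcont: "continuous_on {0<..} (\<lambda>t. Q t p)" for p
  proof -
    have "continuous_on {0<..} (\<lambda>t. (t, Y t p))" "continuous_on {0<..} (\<lambda>t. Y' t p)"
      unfolding Y_def Y'_def s_def by (intro continuous_intros; auto)+
    then show ?thesis unfolding Q_def
      by (intro continuous_on_add continuous_on_inner continuous_on_compose2[OF smooth_supported_continuous[OF ss(1), of UNIV]]
          continuous_on_compose2[OF continuous_space_grad[OF \<phi> K(1)]]) auto
  qed
  have zero: "(\<integral>t. indicator {0<..} t * Q t p \<partial>lborel) = 0" for p
  proof -
    \<comment> \<open>The interval is enlarged so that \<open>\<phi>\<close> vanishes at both of its ends.\<close>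
    have "(\<integral>t. indicator {0<..} t * Q t p \<partial>lborel) = (\<integral>t. indicator {a / 2..b + 1} t *\<^sub>R Q t p \<partial>lborel)"
    proof (rule Bochner_Integration.integral_cong[OF refl])
      show "indicator {0<..} t * Q t p = indicator {a / 2..b + 1} t *\<^sub>R Q t p" for t
        using ab Q0[of t p] by (cases "a \<le> t \<and> t \<le> b") (auto split: split_indicator)
    qed
    also have "\<dots> = \<phi> (b + 1, Y (b + 1) p) - \<phi> (a / 2, Y (a / 2) p)"
    proof (rule integral_FTC_atLeastAtMost)
      show "((\<lambda>t. \<phi> (t, Y t p)) has_vector_derivative Q t p) (at t within {a / 2..b + 1})" if "a / 2 \<le> t" for t
        using path[of t p] that ab
        by (auto simp: has_real_derivative_iff_has_vector_derivative intro: has_vector_derivative_at_within)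
      show "continuous_on {a / 2..b + 1} (\<lambda>t. Q t p)"
        by (rule continuous_on_subset[OF Qcont]) (use ab in auto)
    qed (use ab in auto)
    also have "\<dots> = 0"
      using Kab[of "b + 1"] Kab[of "a / 2"] ab \<phi> by (force simp: smooth_supported_def)
    finally show ?thesis .
  qed
  \<comment> \<open>A time-independent bound on the support of \<open>\<phi>\<close>; it is integrable because \<open>X\<close> and \<open>Z\<close> have first moments.\<close>
  define h where "h p = B1 + B2 * (norm (fst p) + 1 / s a * norm (snd p))" for p :: "(real^'d) \<times> (real^'d)"
  have Qbound: "\<bar>Q t p\<bar> \<le> indicator {a..b} t * h p" for t p
  proof (cases "a \<le> t \<and> t \<le> b")
    case True
    then have t: "t > 0" using ab by auto
    have "s a \<le> s t" using True by (simp add: s_def)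
    then have "exp (- (2 * t)) / s t \<le> 1 / s a"
      using t s_pos[of a] ab by (intro frac_le) auto
    then have "exp (- (2 * t)) / s t * norm (snd p) \<le> 1 / s a * norm (snd p)"
      by (rule mult_right_mono) simp
    then have "norm (Y' t p) \<le> norm (fst p) + 1 / s a * norm (snd p)"
      unfolding Y'_def using t s_pos[OF t]
      by (intro order_trans[OF norm_triangle_ineq] add_mono) (auto intro!: mult_right_mono simp: mult_left_le_one_le)
    then have "\<bar>Y' t p \<bullet> space_grad \<phi> (t, Y t p)\<bar> \<le> (norm (fst p) + 1 / s a * norm (snd p)) * B2"
      by (intro order_trans[OF Cauchy_Schwarz_ineq2] mult_mono B2) (use s_pos[of a] ab in auto)
    then show ?thesis using True B1(2)[of "(t, Y t p)"] by (auto simp: Q_def h_def mult.commute)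
  qed (use Q0 in \<open>auto split: split_indicator\<close>)
  have hint: "integrable ?P h"
  proof -
    have 1: "integrable ?P (\<lambda>p. norm (fst p))"
      using integrable_prod_mult[of \<mu> "std_gauss :: (real^'d) measure" norm "\<lambda>_. 1"] \<mu>(3)
      by (auto simp: case_prod_unfold \<mu>.sigma_finite_measure_axioms \<gamma>.sigma_finite_measure_axioms)
    have "integrable std_gauss (norm :: real^'d \<Rightarrow> real)"
      using integrable_norm_of_norm_square[OF prob_space_std_gauss, of "\<lambda>x. x"] integrable_std_gauss_norm_square by simp
    then have 2: "integrable ?P (\<lambda>p. norm (snd p))"
      using integrable_prod_mult[of \<mu> "std_gauss :: (real^'d) measure" "\<lambda>_. 1" norm]
      by (auto simp: case_prod_unfold \<mu>.sigma_finite_measure_axioms \<gamma>.sigma_finite_measure_axioms)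
    show ?thesis unfolding h_def using 1 2 by auto
  qed
  have [measurable]: "(\<lambda>x. Q (fst x) (snd x)) \<in> borel_measurable (lborel \<Otimes>\<^sub>M ?P)"
    unfolding Q_def Y_def Y'_def s_def by measurable
  have int: "integrable (lborel \<Otimes>\<^sub>M ?P) (\<lambda>(t, p). indicator {0<..} t * Q t p)"
  proof (rule Bochner_Integration.integrable_bound)
    show "integrable (lborel \<Otimes>\<^sub>M ?P) (\<lambda>(t, p). indicator {a..b} t * h p)"
      by (rule integrable_prod_mult) (auto simp: hint ab intro!: integrable_real_indicator simp: P.sigma_finite_measure_axioms lborel.sigma_finite_measure_axioms)
    show "AE x in lborel \<Otimes>\<^sub>M ?P. norm (case x of (t, p) \<Rightarrow> indicator {0<..} t * Q t p) \<le> norm (case x of (t, p) \<Rightarrow> indicator {a..b} t * h p)"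
    proof (intro AE_I2, clarify)
      fix t x z
      show "norm (indicator {0<..} t * Q t (x, z)) \<le> norm (indicator {a..b} t * h (x, z))"
        using order_trans[OF Qbound[of t "(x, z)"] abs_ge_self] by (auto split: split_indicator)
    qed
    show "(\<lambda>(t, p). indicator {0<..} t * Q t p) \<in> borel_measurable (lborel \<Otimes>\<^sub>M ?P)"
      unfolding case_prod_unfold by measurable
  qed
  have key: "(\<integral>x. time_deriv \<phi> (t, x) + space_laplacian \<phi> (t, x) - x \<bullet> space_grad \<phi> (t, x) \<partial>mehler t \<mu>)
      = (\<integral>p. Q t p \<partial>?P)" if t: "t > 0" for t
  proof -
    define r where "r = exp (- t)"
    define F where "F y = time_deriv \<phi> (t, y) + space_laplacian \<phi> (t, y) - y \<bullet> space_grad \<phi> (t, y)" for y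
    have Fm: "F \<in> borel_measurable borel" unfolding F_def by measurable
    have norm_K: "bounded (snd ` K)" using K(1) by (intro compact_imp_bounded compact_continuous_image continuous_intros)
    then obtain R where R: "\<And>t y. (t, y) \<in> K \<Longrightarrow> norm y \<le> R" by (force simp: bounded_iff)
    have Fb: "\<bar>F y\<bar> \<le> B1 + B3 + max R 0 * B2" for y
    proof -
      have "\<bar>y \<bullet> space_grad \<phi> (t, y)\<bar> \<le> max R 0 * B2"
      proof (cases "(t, y) \<in> K")
        case True
        then show ?thesis using R[OF True] B2
          by (intro order_trans[OF Cauchy_Schwarz_ineq2] mult_mono) auto
      qed (use space_grad_eq_0[OF \<phi> K(1)] B2 in auto)
      then show ?thesis using B1(2)[of "(t, y)"] B3(2)[of "(t, y)"] unfolding F_def by linarith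
    qed
    interpret A: prob_space "mehler t \<mu>" unfolding mehler_def by (rule prob_space_affine_gauss[OF \<mu>(1,2)])
    have Fi: "integrable (mehler t \<mu>) F"
      by (rule A.integrable_const_bound[where B="B1 + B3 + max R 0 * B2"]) (use Fb Fm in \<open>auto simp: mehler_def\<close>)
    have Qi: "integrable ?P (Q t)"
    proof (rule Bochner_Integration.integrable_bound[OF hint])
      have "norm (Q t p) \<le> norm (h p)" for p
        using Qbound[of t p] by (cases "t \<in> {a..b}") auto
      then show "AE p in ?P. norm (Q t p) \<le> norm (h p)" by simp
      show "Q t \<in> borel_measurable ?P" unfolding Q_def Y_def Y'_def by measurable
    qed
    have "1 - (s t)\<^sup>2 = exp (- (2 * t))" using t by (simp add: s_def)
    then have inner: "(\<integral>z. F (r *\<^sub>R x + s t *\<^sub>R z) \<partial>std_gauss) = (\<integral>z. Q t (x, z) \<partial>std_gauss)" for x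
      using gauss_drift_exchange[OF \<phi> K(1) s_pos[OF t], of t "r *\<^sub>R x"]
      by (simp add: F_def Q_def Y_def Y'_def r_def)
    have "(\<integral>x. F x \<partial>mehler t \<mu>) = (\<integral>x. \<integral>z. F (r *\<^sub>R x + s t *\<^sub>R z) \<partial>std_gauss \<partial>\<mu>)"
      using integral_affine_gauss[OF \<mu>(1,2) Fi[unfolded mehler_def]] by (simp add: mehler_def r_def s_def)
    also have "\<dots> = (\<integral>p. Q t p \<partial>?P)"
      unfolding inner by (rule P.integral_fst'[OF Qi])
    finally show ?thesis by (simp add: F_def)
  qed
  have "(LBINT t:{0<..}. (\<integral>x. time_deriv \<phi> (t, x) + space_laplacian \<phi> (t, x) - x \<bullet> space_grad \<phi> (t, x) \<partial>mehler t \<mu>))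
     = (LBINT t:{0<..}. (\<integral>p. Q t p \<partial>?P))"
    by (rule set_lebesgue_integral_cong) (auto simp: key)
  also have "\<dots> = (\<integral>t. \<integral>p. indicator {0<..} t * Q t p \<partial>?P \<partial>lborel)"
    by (simp add: set_lebesgue_integral_def)
  also have "\<dots> = (\<integral>p. \<integral>t. indicator {0<..} t * Q t p \<partial>lborel \<partial>?P)"
    by (rule LP.Fubini_integral[OF int, symmetric])
  also have "\<dots> = 0" by (simp add: zero)
  finally show "(LBINT t:{0<..}. (\<integral>x. time_deriv \<phi> (t, x) + space_laplacian \<phi> (t, x) - x \<bullet> space_grad \<phi> (t, x) \<partial>mehler t \<mu>)) = 0" .
qed

section \<open>Preservation of the moment constraints\<close>

lemma P0IdD:
  assumes "\<mu> \<in> P0Id"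
  shows "prob_space \<mu>" "sets \<mu> = sets borel" "integrable \<mu> (\<lambda>x. (norm x)\<^sup>2)" "mean_vec \<mu> = 0" "cov_matrix \<mu> = mat 1"
  using assms by (auto simp: P0Id_def borel_prob_def)

lemma integral_prod_mult:
  fixes f :: "'a \<Rightarrow> real" and g :: "'b \<Rightarrow> real"
  assumes "sigma_finite_measure M1" "sigma_finite_measure M2" "integrable M1 f" "integrable M2 g"
  shows "(\<integral>p. f (fst p) * g (snd p) \<partial>(M1 \<Otimes>\<^sub>M M2)) = (\<integral>x. f x \<partial>M1) * (\<integral>y. g y \<partial>M2)"
proof -
  interpret M1: sigma_finite_measure M1 by fact
  interpret M2: sigma_finite_measure M2 by fact
  interpret pair_sigma_finite M1 M2 ..
  show ?thesis
    using integral_fst'[OF integrable_prod_mult[OF assms]] by (simp add: case_prod_unfold)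
qed

lemma integral_vec_nth:
  fixes f :: "'b \<Rightarrow> real^'d"
  assumes "integrable M f"
  shows "integrable M (\<lambda>x. f x $ i)" "(\<integral>x. f x $ i \<partial>M) = (\<integral>x. f x \<partial>M) $ i"
  using integrable_bounded_linear[OF bounded_linear_vec_nth assms]
    integral_bounded_linear[OF bounded_linear_vec_nth assms] by auto

text \<open>Expand the products of coordinates of \<open>a X + s Z\<close>: the mixed terms vanish because \<open>X\<close> and \<open>Z\<close> are
independent and centred, and the rest adds up to \<open>a\<^sup>2 Id + s\<^sup>2 Id\<close>.\<close>

lemma affine_gauss_P0Id:
  fixes \<mu> :: "(real^'d) measure"
  assumes \<mu>: "\<mu> \<in> P0Id" and as: "a\<^sup>2 + s\<^sup>2 = 1"
  shows "affine_gauss a s \<mu> \<in> P0Id"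
proof -
  note \<mu>1 = P0IdD(1,2)[OF \<mu>]
  let ?\<gamma> = "std_gauss :: (real^'d) measure"
  let ?P = "\<mu> \<Otimes>\<^sub>M ?\<gamma>"
  let ?A = "affine_gauss a s \<mu>"
  interpret \<mu>: prob_space \<mu> by (rule \<mu>1)
  interpret \<gamma>: prob_space ?\<gamma> by (rule prob_space_std_gauss)
  interpret P: pair_prob_space \<mu> ?\<gamma> ..
  interpret A: prob_space ?A by (rule prob_space_affine_gauss[OF \<mu>1])
  note [measurable_cong] = \<mu>1(2)
  have sf: "sigma_finite_measure \<mu>" "sigma_finite_measure ?\<gamma>" by unfold_locales
  have int_id: "integrable M (\<lambda>x. x)" if "prob_space M" "sets M = sets borel" "integrable M (\<lambda>x. (norm x)\<^sup>2)" for M :: "(real^'d) measure"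
  proof -
    have m: "(\<lambda>x. x) \<in> borel_measurable M"
      using that(2) by (simp add: measurable_cong_sets[OF that(2) refl])
    show ?thesis
      using integrable_norm_of_norm_square[OF that(1,3) m] m by (simp add: integrable_norm_iff)
  qed
  have prod_le: "\<bar>x $ i * x $ j\<bar> \<le> (norm x)\<^sup>2" for x :: "real^'d" and i j
    using mult_mono[OF component_le_norm_cart[of x i] component_le_norm_cart[of x j]]
    by (simp add: abs_mult power2_eq_square)
  have int_prod: "integrable M (\<lambda>x. x $ i * x $ j)" if "sets M = sets borel" "integrable M (\<lambda>x. (norm x)\<^sup>2)" for M :: "(real^'d) measure" and i j
    by (rule Bochner_Integration.integrable_bound[OF that(2)])
       (use prod_le in \<open>auto simp: measurable_cong_sets[OF that(1) refl]\<close>)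
  have x1: "integrable \<mu> (\<lambda>x. x $ i)" "(\<integral>x. x $ i \<partial>\<mu>) = 0" for i
    using integral_vec_nth[OF int_id[OF P0IdD(1-3)[OF \<mu>]], of i] P0IdD(4)[OF \<mu>] by (auto simp: mean_vec_def)
  have x2: "integrable \<mu> (\<lambda>x. x $ i * x $ j)" "(\<integral>x. x $ i * x $ j \<partial>\<mu>) = (if i = j then 1 else 0)" for i j
  proof -
    show "integrable \<mu> (\<lambda>x. x $ i * x $ j)" by (rule int_prod[OF P0IdD(2,3)[OF \<mu>]])
    have "cov_matrix \<mu> $ i $ j = mat 1 $ i $ j" by (simp add: P0IdD(5)[OF \<mu>])
    then show "(\<integral>x. x $ i * x $ j \<partial>\<mu>) = (if i = j then 1 else 0)"
      by (simp add: cov_matrix_def P0IdD(4)[OF \<mu>] mat_def)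
  qed
  have ax: "axis i (1::real) \<in> (Basis :: (real^'d) set)" for i by (simp add: axis_in_Basis_iff)
  have z1: "integrable ?\<gamma> (\<lambda>z. z $ i)" "(\<integral>z. z $ i \<partial>?\<gamma>) = 0" for i
    using gauss_moments(1,3)[OF ax[of i] ax[of i]] by (auto simp: inner_axis)
  have z2: "integrable ?\<gamma> (\<lambda>z. z $ i * z $ j)" "(\<integral>z. z $ i * z $ j \<partial>?\<gamma>) = (if i = j then 1 else 0)" for i j
    using gauss_moments(2,4)[OF ax[of j] ax[of i]] by (auto simp: inner_axis axis_eq_axis)
  have pair1: "integrable ?P (\<lambda>p. f (fst p) * g (snd p))" if "integrable \<mu> f" "integrable ?\<gamma> g" for f g :: "real^'d \<Rightarrow> real"
    using integrable_prod_mult[OF sf that] by (simp add: case_prod_unfold)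
  note pair2 = integral_prod_mult[OF sf]
  have sq: "integrable ?A (\<lambda>y. (norm y)\<^sup>2)"
  proof -
    have "integrable ?P (\<lambda>p. 2 * a\<^sup>2 * ((norm (fst p))\<^sup>2 * 1) + 2 * s\<^sup>2 * (1 * (norm (snd p))\<^sup>2))"
      using pair1[of "\<lambda>x. (norm x)\<^sup>2" "\<lambda>_. 1"] pair1[of "\<lambda>_. 1" "\<lambda>x. (norm x)\<^sup>2"] P0IdD(3)[OF \<mu>]
      by (auto simp: integrable_std_gauss_norm_square)
    then have "integrable ?P (\<lambda>p. (norm (a *\<^sub>R fst p + s *\<^sub>R snd p))\<^sup>2)"
    proof (rule Bochner_Integration.integrable_bound)
      show "(\<lambda>p. (norm (a *\<^sub>R fst p + s *\<^sub>R snd p))\<^sup>2) \<in> borel_measurable ?P" by measurable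
      have "(norm (x + y))\<^sup>2 \<le> 2 * (norm x)\<^sup>2 + 2 * (norm y)\<^sup>2" for x y :: "real^'d"
      proof -
        have "(norm (x + y))\<^sup>2 \<le> (norm x + norm y)\<^sup>2" by (intro power_mono norm_triangle_ineq) auto
        also have "\<dots> \<le> 2 * (norm x)\<^sup>2 + 2 * (norm y)\<^sup>2"
          using zero_le_power2[of "norm x - norm y"] by (simp add: power2_eq_square algebra_simps)
        finally show ?thesis .
      qed
      from this[of "a *\<^sub>R _" "s *\<^sub>R _"] show "AE p in ?P. norm ((norm (a *\<^sub>R fst p + s *\<^sub>R snd p))\<^sup>2)
        \<le> norm (2 * a\<^sup>2 * ((norm (fst p))\<^sup>2 * 1) + 2 * s\<^sup>2 * (1 * (norm (snd p))\<^sup>2))"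
        by (auto simp: power_mult_distrib mult.assoc)
    qed
    then show ?thesis by (subst integral_affine_gauss_pair(2)[OF \<mu>1]) auto
  qed
  have mean: "mean_vec ?A = 0"
  proof -
    have "mean_vec ?A $ i = 0" for i
    proof -
      have "mean_vec ?A $ i = (\<integral>y. y $ i \<partial>?A)"
        using integral_vec_nth[OF int_id[OF A.prob_space_axioms _ sq], of i] by (simp add: mean_vec_def)
      also have "\<dots> = (\<integral>p. a * (fst p $ i * 1) + s * (1 * snd p $ i) \<partial>?P)"
        by (subst integral_affine_gauss_pair(1)[OF \<mu>1]) auto
      also have "\<dots> = 0"
        using pair1[OF x1(1)[of i], of "\<lambda>_. 1"] pair1[OF _ z1(1)[of i], of "\<lambda>_. 1"]
          pair2[OF x1(1)[of i], of "\<lambda>_. 1"] pair2[OF _ z1(1)[of i], of "\<lambda>_. 1"]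
        by (simp add: x1 z1)
      finally show ?thesis .
    qed
    then show ?thesis by (simp add: vec_eq_iff)
  qed
  have cov: "cov_matrix ?A = mat 1"
  proof -
    have "cov_matrix ?A $ i $ j = mat 1 $ i $ j" for i j
    proof -
      have "cov_matrix ?A $ i $ j = (\<integral>y. y $ i * y $ j \<partial>?A)" by (simp add: cov_matrix_def mean)
      also have "\<dots> = (\<integral>p. (a * fst p $ i + s * snd p $ i) * (a * fst p $ j + s * snd p $ j) \<partial>?P)"
        by (subst integral_affine_gauss_pair(1)[OF \<mu>1]) auto
      also have "\<dots> = (\<integral>p. (a\<^sup>2 * ((fst p $ i * fst p $ j) * 1) + s\<^sup>2 * (1 * (snd p $ i * snd p $ j)))
           + (a * s * (fst p $ i * snd p $ j) + a * s * (fst p $ j * snd p $ i)) \<partial>?P)"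
        by (rule Bochner_Integration.integral_cong) (auto simp: power2_eq_square algebra_simps)
      also have "\<dots> = a\<^sup>2 * (if i = j then 1 else 0) + s\<^sup>2 * (if i = j then 1 else 0)"
        using pair1[OF x2(1)[of i j], of "\<lambda>_. 1"] pair1[OF _ z2(1)[of i j], of "\<lambda>_. 1"]
          pair2[OF x2(1)[of i j], of "\<lambda>_. 1"] pair2[OF _ z2(1)[of i j], of "\<lambda>_. 1"]
          pair1[OF x1(1)[of i] z1(1)[of j]] pair1[OF x1(1)[of j] z1(1)[of i]]
          pair2[OF x1(1)[of i] z1(1)[of j]] pair2[OF x1(1)[of j] z1(1)[of i]]
        by (simp add: x1 z1 x2 z2 \<mu>.prob_space \<gamma>.prob_space[simplified])
      also have "\<dots> = mat 1 $ i $ j" using as by (simp add: mat_def)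
      finally show ?thesis .
    qed
    then show ?thesis by (simp add: vec_eq_iff)
  qed
  show ?thesis
    by (simp add: P0Id_def borel_prob_def A.prob_space_axioms sq mean cov)
qed

section \<open>Recovering increments from weak time derivatives\<close>

lemma Ck_fun_exp: "Ck_fun k (exp :: real \<Rightarrow> real)"
proof (induction k)
  case (Suc k)
  show ?case
    by (rule Ck_fun_SucI[where f'="\<lambda>z v. exp z * v"])
       (use Suc in \<open>auto intro!: derivative_eq_intros\<close>)
qed (auto intro!: continuous_intros)

lemma Ck_fun_cos_sin: "Ck_fun k (cos :: real \<Rightarrow> real)" "Ck_fun k (sin :: real \<Rightarrow> real)"
proof (induction k)
  case (Suc k)
  case 1 show ?case
    by (rule Ck_fun_SucI[where f'="\<lambda>z v. -1 * sin z * v"])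
       (use Ck_fun_cmult[OF Suc(2), of "-1"] in \<open>auto intro!: derivative_eq_intros\<close>)
  case 2 show ?case
    by (rule Ck_fun_SucI[where f'="\<lambda>z v. cos z * v"])
       (use Suc in \<open>auto intro!: derivative_eq_intros\<close>)
qed (auto intro!: continuous_intros)

definition step_deriv :: "real \<Rightarrow> real" where "step_deriv = dir_deriv 1 smooth_step"
definition step_deriv2 :: "real \<Rightarrow> real" where "step_deriv2 = dir_deriv 1 step_deriv"

lemma Ck_fun_real_has_derivative:
  fixes f :: "real \<Rightarrow> real"
  assumes "\<And>k. Ck_fun k f"
  shows "(f has_real_derivative dir_deriv 1 f x) (at x)"
proof -
  have D: "(f has_derivative (\<lambda>v. dir_deriv v f x)) (at x)"
    using assms[of 1] by (intro has_derivative_frechet) simp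
  have *: "dir_deriv v f x = dir_deriv 1 f x * v" for v
  proof -
    have "dir_deriv v f x = v * dir_deriv 1 f x"
      using linear_cmul[OF has_derivative_linear[OF D], of v 1] by simp
    then show ?thesis by (rule trans) (rule mult.commute)
  qed
  have "(\<lambda>v. dir_deriv v f x) = (*) (dir_deriv 1 f x)" by (rule ext) (rule *)
  with D show ?thesis by (simp only: has_field_derivative_def)
qed

lemma smooth_step_has_derivative: "(smooth_step has_real_derivative step_deriv x) (at x)"
  unfolding step_deriv_def by (rule Ck_fun_real_has_derivative[OF Ck_fun_smooth_step])

text \<open>Outside \<open>[0, 1]\<close> the step is locally constant, so its derivative vanishes there.\<close>

lemma smooth_supported_step_deriv: "smooth_supported {0..1} step_deriv"
  unfolding smooth_supported_def
proof (intro conjI allI impI)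
  show "Ck_fun k step_deriv" for k
    using Ck_fun_smooth_step[of "Suc k"] by (simp add: step_deriv_def)
  fix x :: real assume "x \<notin> {0..1}"
  then consider "x < 0" | "x > 1" by force
  then show "step_deriv x = 0"
  proof cases
    case 1
    have "(smooth_step has_real_derivative 0) (at x)"
      by (rule has_field_derivative_transform_within_open[of "\<lambda>_. 0" _ _ "{..<0}"])
         (use 1 in \<open>auto simp: smooth_step_left\<close>)
    then show ?thesis using smooth_step_has_derivative DERIV_unique by blast
  next
    case 2
    have "(smooth_step has_real_derivative 0) (at x)"
      by (rule has_field_derivative_transform_within_open[of "\<lambda>_. 1" _ _ "{1<..}"])
         (use 2 in \<open>auto simp: smooth_step_right\<close>)
    then show ?thesis using smooth_step_has_derivative DERIV_unique by blast
  qed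
qed

lemma step_deriv_has_derivative: "(step_deriv has_real_derivative step_deriv2 x) (at x)"
  unfolding step_deriv2_def
  by (rule Ck_fun_real_has_derivative) (use smooth_supported_step_deriv in \<open>auto simp: smooth_supported_def\<close>)

lemma smooth_supported_step_deriv2: "smooth_supported {0..1} step_deriv2"
  unfolding step_deriv2_def by (rule smooth_supported_dir_deriv[OF smooth_supported_step_deriv]) auto

lemma step_derivs_eq_0: "x \<notin> {0..1} \<Longrightarrow> step_deriv x = 0" "x \<notin> {0..1} \<Longrightarrow> step_deriv2 x = 0"
  using smooth_supported_step_deriv smooth_supported_step_deriv2 by (auto simp: smooth_supported_def)

lemma continuous_step: "continuous_on S smooth_step" "continuous_on S step_deriv" "continuous_on S step_deriv2"
  using Ck_fun_imp_continuous[OF Ck_fun_smooth_step[of 0]] continuous_on_subset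
    smooth_supported_continuous[OF smooth_supported_step_deriv] smooth_supported_continuous[OF smooth_supported_step_deriv2]
  by blast+

lemma step_derivs_bounded: obtains B where "0 < B" "\<And>x. \<bar>step_deriv x\<bar> \<le> B" "\<And>x. \<bar>step_deriv2 x\<bar> \<le> B"
proof -
  obtain B1 where "0 < B1" "\<And>x. \<bar>step_deriv x\<bar> \<le> B1"
    using smooth_supported_bounded[OF smooth_supported_step_deriv compact_Icc] by metis
  moreover obtain B2 where "0 < B2" "\<And>x. \<bar>step_deriv2 x\<bar> \<le> B2"
    using smooth_supported_bounded[OF smooth_supported_step_deriv2 compact_Icc] by metis
  ultimately show thesis by (intro that[of "max B1 B2"]) (auto simp: le_max_iff_disj)
qed

text \<open>A smooth approximation of the indicator of \<open>(a, b]\<close>, supported in \<open>[a, b + \<epsilon>]\<close>; its derivative is an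
approximate unit mass at \<open>a\<close> minus one at \<open>b\<close>. The support lies to the right of \<open>a\<close>, so \<open>a > 0\<close> keeps it
inside \<open>(0, \<infinity>)\<close>.\<close>

definition window :: "real \<Rightarrow> real \<Rightarrow> real \<Rightarrow> real \<Rightarrow> real" where
  "window a b \<epsilon> s = smooth_step ((s - a) / \<epsilon>) - smooth_step ((s - b) / \<epsilon>)"

definition window_deriv :: "real \<Rightarrow> real \<Rightarrow> real \<Rightarrow> real \<Rightarrow> real" where
  "window_deriv a b \<epsilon> s = step_deriv ((s - a) / \<epsilon>) / \<epsilon> - step_deriv ((s - b) / \<epsilon>) / \<epsilon>"

lemma window_has_derivative: "(window a b \<epsilon> has_real_derivative window_deriv a b \<epsilon> s) (at s)"
proof (cases "\<epsilon> = 0")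
  case False
  have *: "((\<lambda>s. smooth_step ((s - c) / \<epsilon>)) has_real_derivative step_deriv ((s - c) / \<epsilon>) * (1 / \<epsilon>)) (at s)" for c
    by (rule DERIV_chain2[OF smooth_step_has_derivative]) (use False in \<open>auto intro!: derivative_eq_intros\<close>)
  show ?thesis
    unfolding window_def[abs_def] window_deriv_def using DERIV_diff[OF *[of a] *[of b]] by simp
qed (simp add: window_def[abs_def] window_deriv_def)

lemma Ck_fun_window: "Ck_fun k (window a b \<epsilon>)"
proof -
  have "Ck_fun k (\<lambda>s. smooth_step ((s - c) / \<epsilon>))" for c
    using Ck_fun_affine[of "\<lambda>s. s / \<epsilon>" k smooth_step "- c / \<epsilon>"] Ck_fun_smooth_step[of k]
    by (simp add: bounded_linear_divide diff_divide_distrib)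
  then show ?thesis unfolding window_def[abs_def] by (intro Ck_fun_diff)
qed

lemma window_eq_0:
  assumes "0 < \<epsilon>" "a \<le> b" "s < a \<or> b + \<epsilon> < s"
  shows "window a b \<epsilon> s = 0" "window_deriv a b \<epsilon> s = 0"
proof -
  consider "(s - a) / \<epsilon> < 0" "(s - b) / \<epsilon> < 0" | "1 < (s - a) / \<epsilon>" "1 < (s - b) / \<epsilon>"
    using assms by (auto simp: divide_simps)
  then show "window a b \<epsilon> s = 0" "window_deriv a b \<epsilon> s = 0"
    by (cases; simp add: window_def window_deriv_def smooth_step_left smooth_step_right step_derivs_eq_0)+
qed

lemma integral_step_deriv: "(\<integral>r. step_deriv r \<partial>lborel) = 1"
proof -
  have "(\<integral>r. step_deriv r \<partial>lborel) = (\<integral>r. indicator {0..1} r *\<^sub>R step_deriv r \<partial>lborel)"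
    using step_derivs_eq_0 by (intro Bochner_Integration.integral_cong) (auto split: split_indicator)
  also have "\<dots> = smooth_step 1 - smooth_step 0"
    by (rule integral_FTC_atLeastAtMost)
       (auto intro!: continuous_step has_field_derivative_at_within smooth_step_has_derivative
             simp: has_real_derivative_iff_has_vector_derivative[symmetric])
  finally show ?thesis by (simp add: smooth_step_left smooth_step_right)
qed

text \<open>Testing \<open>m' = e\<close> in the weak sense with the windows and letting \<open>\<epsilon> \<rightarrow> 0\<close>: the terms with \<open>m\<close> converge
to \<open>m a - m b\<close> by continuity of \<open>m\<close>, and the terms with \<open>e\<close> converge by dominated convergence.\<close>

lemma weak_derivative_imp_increment:
  fixes m e :: "real \<Rightarrow> real"
  assumes m: "continuous_on UNIV m" and e: "continuous_on UNIV e" and ab: "a < b"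
    and eq: "\<And>\<epsilon>. 0 < \<epsilon> \<Longrightarrow> \<epsilon> \<le> 1 \<Longrightarrow> (\<integral>s. window_deriv a b \<epsilon> s * m s + window a b \<epsilon> s * e s \<partial>lborel) = 0"
  shows "m b - m a = (\<integral>s. indicator {a<..b} s * e s \<partial>lborel)"
proof -
  have [measurable]: "m \<in> borel_measurable borel" "e \<in> borel_measurable borel"
    "step_deriv \<in> borel_measurable borel" "smooth_step \<in> borel_measurable borel"
    using m e continuous_step by (auto intro!: borel_measurable_continuous_onI)
  obtain B where B: "0 < B" "\<And>x. \<bar>step_deriv x\<bar> \<le> B" using step_derivs_bounded by metis
  define d where "d n = inverse (real (Suc n))" for n
  have d: "0 < d n" "d n \<le> 1" for n by (auto simp: d_def field_simps)
  have dlim: "d \<longlonglongrightarrow> 0" unfolding d_def by (rule LIMSEQ_inverse_real_of_nat)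
  have bounded_on: "\<exists>C. \<forall>x\<in>{a..b+1}. \<bar>f x\<bar> \<le> C" if "continuous_on UNIV f" for f :: "real \<Rightarrow> real"
  proof -
    have "bounded (f ` {a..b+1})"
      using that by (intro compact_imp_bounded compact_continuous_image) (auto intro: continuous_on_subset)
    then show ?thesis by (auto simp: bounded_iff)
  qed
  obtain M where M: "\<And>x. x \<in> {a..b+1} \<Longrightarrow> \<bar>m x\<bar> \<le> M" using bounded_on[OF m] by blast
  obtain E where E: "\<And>x. x \<in> {a..b+1} \<Longrightarrow> \<bar>e x\<bar> \<le> E" using bounded_on[OF e] by blast
  have iI: "integrable lborel (\<lambda>r. indicator {u..v} r * C)" for u v C :: real
    by (cases "u \<le> v") (auto intro!: integrable_mult_left integrable_real_indicator)
  have point: "(\<integral>s. step_deriv ((s - c) / d n) / d n * m s \<partial>lborel) = (\<integral>r. step_deriv r * m (c + d n * r) \<partial>lborel)"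
    (is "?I n = ?J n")
    "integrable lborel (\<lambda>s. step_deriv ((s - c) / d n) / d n * m s)"
    if c: "a \<le> c" "c \<le> b" for c n
  proof -
    show "?I n = ?J n"
      using d[of n] by (subst lborel_integral_real_affine[of "d n" _ c]) auto
    show "integrable lborel (\<lambda>s. step_deriv ((s - c) / d n) / d n * m s)"
    proof (rule Bochner_Integration.integrable_bound[OF iI[of a "b + 1" "B / d n * M"]])
      show "AE s in lborel. norm (step_deriv ((s - c) / d n) / d n * m s) \<le> norm (indicator {a..b + 1} s * (B / d n * M))"
      proof (rule AE_I2)
        fix s
        show "norm (step_deriv ((s - c) / d n) / d n * m s) \<le> norm (indicator {a..b + 1} s * (B / d n * M))"
        proof (cases "(s - c) / d n \<in> {0..1}")
          case True
          then have s: "s \<in> {a..b+1}" using c d[of n] by (auto simp: divide_simps)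
          have "\<bar>step_deriv ((s - c) / d n) / d n * m s\<bar> \<le> B / d n * M"
            using B(2)[of "(s - c) / d n"] M[OF s] d[of n] B(1)
            by (auto simp: abs_mult intro!: mult_mono divide_right_mono)
          then show ?thesis using s order_trans[OF _ abs_ge_self, of _ "B / d n * M"] by simp
        qed (simp add: step_derivs_eq_0)
      qed
    qed auto
  qed
  have plim: "(\<lambda>n. \<integral>r. step_deriv r * m (c + d n * r) \<partial>lborel) \<longlonglongrightarrow> m c" if c: "a \<le> c" "c \<le> b" for c
  proof -
    have "(\<lambda>n. \<integral>r. step_deriv r * m (c + d n * r) \<partial>lborel) \<longlonglongrightarrow> (\<integral>r. step_deriv r * m (c + 0 * r) \<partial>lborel)"
    proof (rule integral_dominated_convergence[OF _ _ iI[of 0 1 "B * M"]])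
      show "AE r in lborel. (\<lambda>n. step_deriv r * m (c + d n * r)) \<longlonglongrightarrow> step_deriv r * m (c + 0 * r)"
        using m by (intro AE_I2 tendsto_intros isCont_tendsto_compose[of _ m] dlim)
          (auto simp: continuous_on_eq_continuous_at)
      show "AE r in lborel. norm (step_deriv r * m (c + d n * r)) \<le> indicator {0..1} r * (B * M)" for n
      proof (rule AE_I2)
        fix r
        show "norm (step_deriv r * m (c + d n * r)) \<le> indicator {0..1} r * (B * M)"
        proof (cases "r \<in> {0..1}")
          case True
          then have "d n * r \<le> 1 * 1" "0 \<le> d n * r"
            using d[of n] by (intro mult_mono, auto)
          then have "c + d n * r \<in> {a..b+1}" using c by auto
          then show ?thesis using True B(2)[of r] M[of "c + d n * r"] B(1)
            by (auto simp: abs_mult intro!: mult_mono)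
        qed (simp add: step_derivs_eq_0)
      qed
    qed auto
    then show ?thesis using integral_step_deriv by simp
  qed
  have wb: "\<bar>window a b (d n) s\<bar> \<le> indicator {a..b+1} s" for n s
  proof (cases "s < a \<or> b + d n < s")
    case True
    then show ?thesis using window_eq_0[of "d n" a b s] d ab by (auto simp: indicator_def)
  next
    case False
    then show ?thesis using smooth_step_bounds[of "(s - a) / d n"] smooth_step_bounds[of "(s - b) / d n"] d(2)[of n]
      by (auto simp: window_def)
  qed
  have we: "\<bar>window a b (d n) s * e s\<bar> \<le> indicator {a..b+1} s * E" for n s
    using wb[of n s] E[of s] by (cases "s \<in> {a..b+1}") (use mult_mono[of "\<bar>window a b (d n) s\<bar>" 1 "\<bar>e s\<bar>" E] in \<open>auto simp: abs_mult\<close>)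
  have wm[measurable]: "window a b (d n) \<in> borel_measurable borel" for n unfolding window_def[abs_def] by measurable
  have wint: "integrable lborel (\<lambda>s. window a b (d n) s * e s)" for n
    by (rule Bochner_Integration.integrable_bound[OF iI[of a "b + 1" E]])
       (use we order_trans[OF _ abs_ge_self] in \<open>auto intro!: AE_I2\<close>)
  have elim: "(\<lambda>n. \<integral>s. window a b (d n) s * e s \<partial>lborel) \<longlonglongrightarrow> (\<integral>s. indicator {a<..b} s * e s \<partial>lborel)"
  proof (rule integral_dominated_convergence[OF _ _ iI[of a "b + 1" E]])
    show "AE s in lborel. (\<lambda>n. window a b (d n) s * e s) \<longlonglongrightarrow> indicator {a<..b} s * e s"
    proof (intro AE_I2 tendsto_mult tendsto_const)
      fix s :: real
      have step_lim: "(\<lambda>n. smooth_step ((s - c) / d n)) \<longlonglongrightarrow> (if c < s then 1 else 0)" for c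
      proof (cases "c < s")
        case True
        have "\<forall>\<^sub>F n in sequentially. d n < s - c"
          using order_tendstoD(2)[OF dlim] True by simp
        then have "\<forall>\<^sub>F n in sequentially. 1 = smooth_step ((s - c) / d n)"
          by eventually_elim (use d in \<open>auto simp: smooth_step_right divide_simps\<close>)
        then show ?thesis using True by (simp add: Lim_transform_eventually[OF tendsto_const])
      next
        case False
        then have "(s - c) / d n \<le> 0" for n using d[of n] by (simp add: divide_nonpos_pos)
        then show ?thesis using False by (simp add: smooth_step_left)
      qed
      have "indicator {a<..b} s = (if a < s then 1 else 0) - (if b < s then 1 else (0::real))" using ab by auto
      then show "(\<lambda>n. window a b (d n) s) \<longlonglongrightarrow> indicator {a<..b} s"
        unfolding window_def by (simp only:) (intro tendsto_diff step_lim)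
    qed
  qed (use we in auto)
  have "(\<integral>r. step_deriv r * m (a + d n * r) \<partial>lborel) - (\<integral>r. step_deriv r * m (b + d n * r) \<partial>lborel)
      + (\<integral>s. window a b (d n) s * e s \<partial>lborel) = 0" for n
  proof -
    have "0 = (\<integral>s. (step_deriv ((s - a) / d n) / d n * m s - step_deriv ((s - b) / d n) / d n * m s) + window a b (d n) s * e s \<partial>lborel)"
      using eq[of "d n"] d[of n] by (simp add: window_deriv_def left_diff_distrib)
    then show ?thesis
      using point[of a n] point[of b n] wint[of n] ab by simp
  qed
  moreover have "(\<lambda>n. (\<integral>r. step_deriv r * m (a + d n * r) \<partial>lborel) - (\<integral>r. step_deriv r * m (b + d n * r) \<partial>lborel)
      + (\<integral>s. window a b (d n) s * e s \<partial>lborel)) \<longlonglongrightarrow> m a - m b + (\<integral>s. indicator {a<..b} s * e s \<partial>lborel)"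
    using ab by (intro tendsto_add tendsto_diff plim elim) auto
  ultimately have "(\<lambda>n::nat. 0) \<longlonglongrightarrow> m a - m b + (\<integral>s. indicator {a<..b} s * e s \<partial>lborel)" by simp
  then show ?thesis using LIMSEQ_unique[OF tendsto_const] by fastforce
qed

text \<open>Compact support in space makes \<open>F (t, x)\<close> uniformly close to \<open>F (t0, x)\<close>, so only the variation of the
measure against a fixed function remains.\<close>

lemma weakly_continuous_integral_time_dependent:
  fixes F :: "real \<times> (real^'d) \<Rightarrow> real"
  assumes \<eta>: "weakly_continuous_on T \<eta>" and pr: "\<And>t. t \<in> T \<Longrightarrow> \<eta> t \<in> borel_prob"
    and F: "continuous_on UNIV F" and supp: "\<And>t x. norm x > R \<Longrightarrow> F (t, x) = 0"
  shows "continuous_on T (\<lambda>t. \<integral>x. F (t, x) \<partial>\<eta> t)"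
  unfolding continuous_on_iff
proof (intro ballI allI impI)
  fix t0 \<epsilon> :: real assume t0: "t0 \<in> T" and \<epsilon>: "\<epsilon> > 0"
  let ?C = "{t0 - 1..t0 + 1} \<times> cball (0 :: real^'d) R"
  have C: "compact ?C" by (intro compact_Times) auto
  have unif: "uniformly_continuous_on ?C F"
    using compact_uniformly_continuous[OF continuous_on_subset[OF F] C] by auto
  have Fx: "continuous_on UNIV (\<lambda>x. F (t, x))" for t
    by (rule continuous_on_compose2[OF F]) (auto intro!: continuous_intros)
  have bd: "\<exists>B. \<forall>x. \<bar>F (t, x)\<bar> \<le> B" for t
  proof -
    have "bounded ((\<lambda>x. F (t, x)) ` cball 0 R)"
      by (intro compact_imp_bounded compact_continuous_image continuous_on_subset[OF Fx]) auto
    then obtain B where "\<And>x. norm x \<le> R \<Longrightarrow> \<bar>F (t, x)\<bar> \<le> B" by (fastforce simp: bounded_iff)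
    then have "\<bar>F (t, x)\<bar> \<le> max B 0" for x using supp[of x t] by (cases "norm x \<le> R") (auto simp: le_max_iff_disj)
    then show ?thesis by blast
  qed
  have int: "integrable (\<eta> t) (\<lambda>x. F (t', x))" if "t \<in> T" for t t'
  proof -
    interpret prob_space "\<eta> t" using pr[OF that] by (simp add: borel_prob_def)
    obtain B where "\<forall>x. \<bar>F (t', x)\<bar> \<le> B" using bd by blast
    then show ?thesis
      using borel_measurable_continuous_onI[OF Fx[of t']] pr[OF that]
      by (intro integrable_const_bound[where B=B]) (auto simp: borel_prob_def measurable_cong_sets[of "\<eta> t" borel])
  qed
  obtain \<delta>1 where \<delta>1: "\<delta>1 > 0" "\<And>p q. p \<in> ?C \<Longrightarrow> q \<in> ?C \<Longrightarrow> dist p q < \<delta>1 \<Longrightarrow> dist (F p) (F q) < \<epsilon> / 3"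
    using unif \<epsilon> unfolding uniformly_continuous_on_def by (metis zero_less_divide_iff zero_less_numeral)
  have "continuous_on T (\<lambda>t. \<integral>x. F (t0, x) \<partial>\<eta> t)"
    using \<eta> Fx[of t0] bd[of t0] unfolding weakly_continuous_on_def by (auto simp: bounded_iff)
  then obtain \<delta>2 where \<delta>2: "\<delta>2 > 0" "\<And>t. t \<in> T \<Longrightarrow> dist t t0 < \<delta>2 \<Longrightarrow> dist (\<integral>x. F (t0, x) \<partial>\<eta> t) (\<integral>x. F (t0, x) \<partial>\<eta> t0) < \<epsilon> / 3"
    using t0 \<epsilon> unfolding continuous_on_iff by (metis zero_less_divide_iff zero_less_numeral)
  show "\<exists>d>0. \<forall>t\<in>T. dist t t0 < d \<longrightarrow> dist (\<integral>x. F (t, x) \<partial>\<eta> t) (\<integral>x. F (t0, x) \<partial>\<eta> t0) < \<epsilon>"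
  proof (intro exI[of _ "min (min \<delta>1 \<delta>2) 1"] conjI ballI impI)
    fix t assume t: "t \<in> T" and d: "dist t t0 < min (min \<delta>1 \<delta>2) 1"
    interpret prob_space "\<eta> t" using pr[OF t] by (simp add: borel_prob_def)
    have le: "\<bar>F (t, x) - F (t0, x)\<bar> \<le> \<epsilon> / 3" for x
    proof (cases "norm x \<le> R")
      case True
      have "dist (F (t, x)) (F (t0, x)) < \<epsilon> / 3"
        by (rule \<delta>1(2)) (use d True in \<open>auto simp: dist_real_def dist_Pair_Pair abs_less_iff\<close>)
      then show ?thesis by (simp add: dist_real_def)
    qed (use supp[of x] \<epsilon> in auto)
    have "\<bar>(\<integral>x. F (t, x) \<partial>\<eta> t) - (\<integral>x. F (t0, x) \<partial>\<eta> t)\<bar> = \<bar>\<integral>x. F (t, x) - F (t0, x) \<partial>\<eta> t\<bar>"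
      using int[OF t] by simp
    also have "\<dots> \<le> (\<integral>x. \<bar>F (t, x) - F (t0, x)\<bar> \<partial>\<eta> t)" by (rule integral_abs_bound)
    also have "\<dots> \<le> \<epsilon> / 3"
      using int[OF t] le by (intro integral_le_const) auto
    finally have "\<bar>(\<integral>x. F (t, x) \<partial>\<eta> t) - (\<integral>x. F (t0, x) \<partial>\<eta> t)\<bar> \<le> \<epsilon> / 3" .
    then show "dist (\<integral>x. F (t, x) \<partial>\<eta> t) (\<integral>x. F (t0, x) \<partial>\<eta> t0) < \<epsilon>"
      using \<delta>2(2)[OF t] d \<epsilon> unfolding dist_real_def by linarith
  qed (use \<delta>1 \<delta>2 in auto)
qed

section \<open>Truncated plane waves\<close>

text \<open>Once smoothness is known, a directional derivative is an ordinary derivative along a line, and explicit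
formulas reduce to calculus in one variable.\<close>

lemma dir_deriv_eq_DERIV:
  assumes "\<And>k. Ck_fun k f" "((\<lambda>r. f (z + r *\<^sub>R v)) has_real_derivative D) (at 0)"
  shows "dir_deriv v f z = D"
proof -
  have "f differentiable (at z)" using assms(1)[of 1] by simp
  then have Df: "(f has_derivative (\<lambda>v. dir_deriv v f z)) (at (z + 0 *\<^sub>R v))"
    using has_derivative_frechet by simp
  have "((\<lambda>r. f (z + r *\<^sub>R v)) has_derivative (\<lambda>r. dir_deriv (r *\<^sub>R v) f z)) (at 0)"
    by (rule has_derivative_compose[where f="\<lambda>r. z + r *\<^sub>R v", OF _ Df]) (auto intro!: derivative_eq_intros)
  then have "(\<lambda>r. dir_deriv (r *\<^sub>R v) f z) = (*) D"
    using assms(2) has_derivative_unique unfolding has_field_derivative_def by blast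
  then have "dir_deriv (1 *\<^sub>R v) f z = D * 1" by (rule fun_cong)
  then show ?thesis by simp
qed

definition cutoff :: "real \<Rightarrow> real \<Rightarrow> real" where
  "cutoff R q = 1 - smooth_step (q / R\<^sup>2 - 1)"
definition cutoff_deriv :: "real \<Rightarrow> real \<Rightarrow> real" where
  "cutoff_deriv R q = - step_deriv (q / R\<^sup>2 - 1) / R\<^sup>2"
definition cutoff_deriv2 :: "real \<Rightarrow> real \<Rightarrow> real" where
  "cutoff_deriv2 R q = - step_deriv2 (q / R\<^sup>2 - 1) / R ^ 4"

lemma cutoff_has_derivative:
  "(cutoff R has_real_derivative cutoff_deriv R q) (at q)" "(cutoff_deriv R has_real_derivative cutoff_deriv2 R q) (at q)"
proof -
  have i: "((\<lambda>q. q / R\<^sup>2 - 1) has_real_derivative 1 / R\<^sup>2) (at q)"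
  proof -
    have "((\<lambda>q. q / R\<^sup>2) has_real_derivative 1 / R\<^sup>2) (at q)"
      by (rule DERIV_cdivide[OF DERIV_ident])
    from DERIV_diff[OF this DERIV_const[of 1]] show ?thesis by simp
  qed
  show "(cutoff R has_real_derivative cutoff_deriv R q) (at q)"
    unfolding cutoff_def[abs_def] cutoff_deriv_def
    using DERIV_diff[OF DERIV_const DERIV_chain2[OF smooth_step_has_derivative i]] by simp
  show "(cutoff_deriv R has_real_derivative cutoff_deriv2 R q) (at q)"
    unfolding cutoff_deriv_def[abs_def] cutoff_deriv2_def
    using DERIV_cdivide[OF DERIV_minus[OF DERIV_chain2[OF step_deriv_has_derivative i]], of "R\<^sup>2"]
    by (cases "R = 0") (simp_all add: power2_eq_square power4_eq_xxxx mult.assoc)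
qed

lemma Ck_fun_cutoff: "Ck_fun k (cutoff R)"
proof -
  have "Ck_fun k (\<lambda>q. smooth_step (q / R\<^sup>2 + - 1))"
    by (rule Ck_fun_affine[OF bounded_linear_divide Ck_fun_smooth_step])
  from Ck_fun_diff[OF Ck_fun_const[of k 1] this] show ?thesis
    unfolding cutoff_def[abs_def] by simp
qed

lemma continuous_cutoff: "continuous_on S (cutoff R)" "continuous_on S (cutoff_deriv R)" "continuous_on S (cutoff_deriv2 R)"
proof -
  have "continuous_on UNIV (\<lambda>q. q / R\<^sup>2 - 1)" unfolding divide_inverse by (intro continuous_intros)
  then have i: "continuous_on S (\<lambda>q. q / R\<^sup>2 - 1)" using continuous_on_subset by blast
  show "continuous_on S (cutoff R)" "continuous_on S (cutoff_deriv R)" "continuous_on S (cutoff_deriv2 R)"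
    unfolding cutoff_def[abs_def] cutoff_deriv_def[abs_def] cutoff_deriv2_def[abs_def] divide_inverse[of _ "R\<^sup>2"] divide_inverse[of _ "R^4"]
    by (intro continuous_intros continuous_on_compose2[OF continuous_step(1)[of UNIV]]
        continuous_on_compose2[OF continuous_step(2)[of UNIV]] continuous_on_compose2[OF continuous_step(3)[of UNIV]];
        auto simp: divide_inverse[symmetric] i)+
qed

lemma cutoff_eq_1: "0 < R \<Longrightarrow> norm x \<le> R \<Longrightarrow> cutoff R (x \<bullet> x) = 1"
  by (auto simp: cutoff_def power2_norm_eq_inner[symmetric] intro!: smooth_step_left)

lemma cutoff_eq_0: "0 < R \<Longrightarrow> 2 * R \<le> norm x \<Longrightarrow> cutoff R (x \<bullet> x) = 0"
proof -
  assume R: "0 < R" "2 * R \<le> norm x"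
  have "2 * R\<^sup>2 \<le> (2 * R)\<^sup>2" using R by (simp add: power2_eq_square)
  also have "\<dots> \<le> (norm x)\<^sup>2" using R by (intro power_mono) auto
  finally show ?thesis using R
    by (auto simp: cutoff_def power2_norm_eq_inner[symmetric] field_simps intro!: smooth_step_right)
qed

lemma cutoff_derivs_eq_0:
  assumes "0 < R" "norm x < R \<or> 2 * R < norm x"
  shows "cutoff_deriv R (x \<bullet> x) = 0" "cutoff_deriv2 R (x \<bullet> x) = 0"
proof -
  have "(norm x)\<^sup>2 / R\<^sup>2 - 1 \<notin> {0..1}"
    using assms(2)
  proof
    assume "norm x < R"
    then have "(norm x)\<^sup>2 < R\<^sup>2" by (intro power_strict_mono) auto
    then have "(norm x)\<^sup>2 / R\<^sup>2 < 1" using assms(1) by simp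
    then show ?thesis by auto
  next
    assume x: "2 * R < norm x"
    have "2 * R\<^sup>2 \<le> (2 * R)\<^sup>2" using assms by (simp add: power2_eq_square)
    also have "\<dots> < (norm x)\<^sup>2" using x assms by (intro power_strict_mono) auto
    finally show ?thesis using assms(1) by (auto simp: field_simps)
  qed
  then show "cutoff_deriv R (x \<bullet> x) = 0" "cutoff_deriv2 R (x \<bullet> x) = 0"
    by (simp_all add: cutoff_deriv_def cutoff_deriv2_def step_derivs_eq_0 power2_norm_eq_inner[symmetric])
qed

definition wave_amp :: "real^'d \<Rightarrow> real \<Rightarrow> real" where
  "wave_amp \<xi> s = exp ((norm \<xi>)\<^sup>2 * (exp s)\<^sup>2 / 2)"

text \<open>A solution of the backward equation \<open>\<partial>\<^sub>s u + \<Delta>u - x \<bullet> \<nabla>u = 0\<close>: the semigroup maps plane waves to damped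
plane waves of smaller frequency. The phase \<open>\<beta>\<close> covers sines and shifted cosines at once.\<close>

definition wave :: "real^'d \<Rightarrow> real \<Rightarrow> real \<times> (real^'d) \<Rightarrow> real" where
  "wave \<xi> \<beta> p = wave_amp \<xi> (fst p) * cos (exp (fst p) * (\<xi> \<bullet> snd p) + \<beta>)"

text \<open>What the backward operator leaves of \<open>cutoff R (x \<bullet> x) * wave \<xi> \<beta> (s, x)\<close>: the terms in which at
least one derivative falls on the cutoff.\<close>

definition wave_defect :: "real^'d \<Rightarrow> real \<Rightarrow> real \<Rightarrow> real \<times> (real^'d) \<Rightarrow> real" where
  "wave_defect \<xi> \<beta> R p = (let s = fst p; x = snd p; q = x \<bullet> x in
     wave_amp \<xi> s * ((4 * cutoff_deriv2 R q * q + 2 * real CARD('d) * cutoff_deriv R q - 2 * cutoff_deriv R q * q) * cos (exp s * (\<xi> \<bullet> x) + \<beta>)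
       - 4 * cutoff_deriv R q * (exp s * (\<xi> \<bullet> x)) * sin (exp s * (\<xi> \<bullet> x) + \<beta>)))"

lemma wave_amp_has_derivative: "(wave_amp \<xi> has_real_derivative wave_amp \<xi> s * ((norm \<xi>)\<^sup>2 * (exp s)\<^sup>2)) (at s)"
  unfolding wave_amp_def[abs_def] by (auto intro!: derivative_eq_intros simp: power2_eq_square)

lemma Ck_fun_wave_amp: "Ck_fun k (wave_amp \<xi>)"
proof -
  have "Ck_fun k (\<lambda>s. (norm \<xi>)\<^sup>2 / 2 * (exp s * exp s) :: real)"
    by (intro Ck_fun_cmult Ck_fun_mult Ck_fun_exp)
  from Ck_fun_compose[OF Ck_fun_exp this] show ?thesis
    by (simp add: wave_amp_def[abs_def] power2_eq_square)
qed

lemma Ck_fun_wave: "Ck_fun k (wave \<xi> \<beta>)"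
proof -
  have "Ck_fun k (\<lambda>p. exp (fst p) * (\<xi> \<bullet> snd p) + \<beta>)"
    by (intro Ck_fun_add Ck_fun_mult Ck_fun_const Ck_fun_compose[OF Ck_fun_exp] Ck_fun_linear
        bounded_linear_fst bounded_linear_compose[OF bounded_linear_inner_right bounded_linear_snd])
  from Ck_fun_compose[OF Ck_fun_cos_sin(1) this]
  show ?thesis unfolding wave_def[abs_def]
    by (rule Ck_fun_mult[OF Ck_fun_compose[OF Ck_fun_wave_amp Ck_fun_linear[OF bounded_linear_fst]]])
qed

lemma Ck_fun_cutoff_norm: "Ck_fun k (\<lambda>p :: real \<times> (real^'d). cutoff R (snd p \<bullet> snd p))"
proof (rule Ck_fun_compose[OF Ck_fun_cutoff])
  have "Ck_fun k (\<lambda>p :: real \<times> (real^'d). \<Sum>b\<in>Basis. (snd p \<bullet> b) * (snd p \<bullet> b))"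
    by (intro Ck_fun_sum Ck_fun_mult Ck_fun_linear bounded_linear_compose[OF bounded_linear_inner_left bounded_linear_snd])
  then show "Ck_fun k (\<lambda>p :: real \<times> (real^'d). snd p \<bullet> snd p)"
    by (simp add: euclidean_inner[symmetric])
qed

context
  fixes \<xi> :: "real^'d" and \<beta> R :: real and \<theta> \<theta>' :: "real \<Rightarrow> real" and \<phi> :: "real \<times> (real^'d) \<Rightarrow> real"
  assumes R: "0 < R" and \<theta>: "\<And>k. Ck_fun k \<theta>" and \<theta>': "\<And>s. (\<theta> has_real_derivative \<theta>' s) (at s)"
  defines "\<phi> \<equiv> \<lambda>p. \<theta> (fst p) * (cutoff R (snd p \<bullet> snd p) * wave \<xi> \<beta> p)"
begin

lemma Ck_fun_probe: "Ck_fun k \<phi>"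
  unfolding \<phi>_def by (intro Ck_fun_mult Ck_fun_compose[OF \<theta>] Ck_fun_linear bounded_linear_fst Ck_fun_cutoff_norm Ck_fun_wave)

lemma probe_time_deriv:
  "time_deriv \<phi> (s, x) = \<theta>' s * (cutoff R (x \<bullet> x) * wave \<xi> \<beta> (s, x))
     + \<theta> s * (cutoff R (x \<bullet> x) * wave_amp \<xi> s * ((norm \<xi>)\<^sup>2 * (exp s)\<^sup>2 * cos (exp s * (\<xi> \<bullet> x) + \<beta>)
        - exp s * (\<xi> \<bullet> x) * sin (exp s * (\<xi> \<bullet> x) + \<beta>)))" (is "_ = ?T")
  unfolding time_deriv_def
proof (rule dir_deriv_eq_DERIV[OF Ck_fun_probe])
  have 1: "((\<lambda>r. \<theta> (s + r)) has_real_derivative \<theta>' s) (at 0)"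
    using DERIV_shift[of \<theta> "\<theta>' s" 0 s] \<theta>'[of s] by (simp add: add.commute)
  have 2: "((\<lambda>r. wave_amp \<xi> (s + r)) has_real_derivative wave_amp \<xi> s * ((norm \<xi>)\<^sup>2 * (exp s)\<^sup>2)) (at 0)"
    using DERIV_shift[of "wave_amp \<xi>" _ 0 s] wave_amp_has_derivative[of \<xi> s] by (simp add: add.commute)
  have eq: "\<phi> ((s, x) + r *\<^sub>R (1, 0)) = \<theta> (s + r) * (cutoff R (x \<bullet> x) *
     (wave_amp \<xi> (s + r) * cos (exp (s + r) * (\<xi> \<bullet> x) + \<beta>)))" for r
    by (simp add: \<phi>_def wave_def)
  show "((\<lambda>r. \<phi> ((s, x) + r *\<^sub>R (1, 0))) has_real_derivative ?T) (at 0)"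
    unfolding eq by (rule derivative_eq_intros 1 2 refl)+ (simp add: wave_def algebra_simps)
qed

lemma probe_space_deriv:
  "dir_deriv (0, axis i 1) \<phi> = (\<lambda>(s, x). \<theta> s * wave_amp \<xi> s *
     (2 * cutoff_deriv R (x \<bullet> x) * x $ i * cos (exp s * (\<xi> \<bullet> x) + \<beta>)
      - cutoff R (x \<bullet> x) * (exp s * \<xi> $ i) * sin (exp s * (\<xi> \<bullet> x) + \<beta>)))" (is "_ = ?G")
  and probe_space_deriv2:
  "dir_deriv (0, axis i 1) (dir_deriv (0, axis i 1) \<phi>) (s, x) = \<theta> s * wave_amp \<xi> s *
     ((4 * cutoff_deriv2 R (x \<bullet> x) * (x $ i)\<^sup>2 + 2 * cutoff_deriv R (x \<bullet> x) - cutoff R (x \<bullet> x) * ((exp s)\<^sup>2 * (\<xi> $ i)\<^sup>2)) * cos (exp s * (\<xi> \<bullet> x) + \<beta>)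
      - 4 * cutoff_deriv R (x \<bullet> x) * (exp s * (x $ i * \<xi> $ i)) * sin (exp s * (\<xi> \<bullet> x) + \<beta>))" (is "_ = ?G2")
proof -
  have sq: "(x + r *\<^sub>R axis i 1) \<bullet> (x + r *\<^sub>R axis i 1) = x \<bullet> x + 2 * r * x $ i + r\<^sup>2" for x :: "real^'d" and r :: real
    by (simp add: inner_add_left inner_add_right inner_axis inner_axis' inner_axis_axis power2_eq_square algebra_simps)
  have lin: "\<xi> \<bullet> (x + r *\<^sub>R axis i 1) = \<xi> \<bullet> x + r * \<xi> $ i" "(x + r *\<^sub>R axis i 1) $ i = x $ i + r"
    for x :: "real^'d" and r :: real
    by (simp add: inner_add_right inner_axis, simp add: axis_def)
  have shift: "(s, x) + r *\<^sub>R (0, axis i 1) = (s, x + r *\<^sub>R axis i 1)" for s r :: real and x :: "real^'d"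
    by simp
  have c0: "((\<lambda>r. cutoff R (x \<bullet> x + 2 * r * x $ i + r\<^sup>2)) has_real_derivative cutoff_deriv R (x \<bullet> x) * (2 * x $ i)) (at 0)" for x :: "real^'d"
    by (rule DERIV_chain2[where f="cutoff R"]) (auto intro!: derivative_eq_intros cutoff_has_derivative)
  have c1: "((\<lambda>r. cutoff_deriv R (x \<bullet> x + 2 * r * x $ i + r\<^sup>2)) has_real_derivative cutoff_deriv2 R (x \<bullet> x) * (2 * x $ i)) (at 0)" for x :: "real^'d"
    by (rule DERIV_chain2[where f="cutoff_deriv R"]) (auto intro!: derivative_eq_intros cutoff_has_derivative)
  show G: "dir_deriv (0, axis i 1) \<phi> = ?G"
  proof (rule ext)
    fix p :: "real \<times> (real^'d)"
    obtain s x where p: "p = (s, x)" by (cases p)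
    show "dir_deriv (0, axis i 1) \<phi> p = ?G p"
      unfolding p
    proof (rule dir_deriv_eq_DERIV[OF Ck_fun_probe])
      show "((\<lambda>r. \<phi> ((s, x) + r *\<^sub>R (0, axis i 1))) has_real_derivative ?G (s, x)) (at 0)"
        unfolding \<phi>_def wave_def shift fst_conv snd_conv sq lin
        by (rule derivative_eq_intros c0 refl)+ (simp add: algebra_simps)
    qed
  qed
  show "dir_deriv (0, axis i 1) (dir_deriv (0, axis i 1) \<phi>) (s, x) = ?G2"
  proof (rule dir_deriv_eq_DERIV)
    show "Ck_fun k (dir_deriv (0, axis i 1) \<phi>)" for k
      using Ck_fun_probe[of "Suc k"] time_space_Basis(2)[of i] by simp
    show "((\<lambda>r. dir_deriv (0, axis i 1) \<phi> ((s, x) + r *\<^sub>R (0, axis i 1))) has_real_derivative ?G2) (at 0)"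
      unfolding G shift prod.case sq lin
      by (rule derivative_eq_intros c0 c1 refl)+ (simp add: algebra_simps power2_eq_square)
  qed
qed

text \<open>The terms without a derivative of \<open>\<theta>\<close> or of the cutoff cancel because the wave solves the backward
equation.\<close>

lemma probe_OU_operator:
  "time_deriv \<phi> (s, x) + space_laplacian \<phi> (s, x) - x \<bullet> space_grad \<phi> (s, x) =
    \<theta>' s * (cutoff R (x \<bullet> x) * wave \<xi> \<beta> (s, x)) + \<theta> s * wave_defect \<xi> \<beta> R (s, x)"
proof -
  let ?c = "cos (exp s * (\<xi> \<bullet> x) + \<beta>)" and ?s = "sin (exp s * (\<xi> \<bullet> x) + \<beta>)" and ?A = "\<theta> s * wave_amp \<xi> s"
  have n: "(norm \<xi>)\<^sup>2 = (\<Sum>i\<in>UNIV. (\<xi> $ i)\<^sup>2)" "x \<bullet> x = (\<Sum>i\<in>UNIV. (x $ i)\<^sup>2)" "\<xi> \<bullet> x = (\<Sum>i\<in>UNIV. x $ i * \<xi> $ i)"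
    unfolding power2_norm_eq_inner inner_vec_def inner_real_def by (simp_all add: power2_eq_square mult.commute)
  have L: "space_laplacian \<phi> (s, x) = ?A * ((4 * cutoff_deriv2 R (x \<bullet> x) * (x \<bullet> x) + 2 * real CARD('d) * cutoff_deriv R (x \<bullet> x)
      - cutoff R (x \<bullet> x) * ((exp s)\<^sup>2 * (norm \<xi>)\<^sup>2)) * ?c - 4 * cutoff_deriv R (x \<bullet> x) * (exp s * (\<xi> \<bullet> x)) * ?s)"
    unfolding space_laplacian_def probe_space_deriv2 sum_distrib_left[symmetric] sum_subtractf sum_distrib_right[symmetric] sum.distrib
      n[symmetric] by simp
  have G: "x \<bullet> space_grad \<phi> (s, x) = ?A * (2 * cutoff_deriv R (x \<bullet> x) * (x \<bullet> x) * ?c - cutoff R (x \<bullet> x) * (exp s * (\<xi> \<bullet> x)) * ?s)"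
  proof -
    have "x \<bullet> space_grad \<phi> (s, x) = (\<Sum>i\<in>UNIV. ?A * (2 * cutoff_deriv R (x \<bullet> x) * (x $ i)\<^sup>2 * ?c - cutoff R (x \<bullet> x) * (exp s * (x $ i * \<xi> $ i)) * ?s))"
      by (subst inner_vec_def) (simp add: space_grad_def probe_space_deriv power2_eq_square algebra_simps)
    then show ?thesis
      unfolding sum_distrib_left[symmetric] sum_subtractf sum_distrib_right[symmetric] n[symmetric] .
  qed
  show ?thesis
    unfolding L G probe_time_deriv wave_defect_def Let_def fst_conv snd_conv
    by (simp add: algebra_simps)
qed

lemma probe_test_function:
  assumes "0 < a" "a \<le> b" "\<And>s. s < a \<or> b < s \<Longrightarrow> \<theta> s = 0"
  shows "\<phi> \<in> test_functions ({0<..} \<times> UNIV)"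
proof -
  have "{z. \<phi> z \<noteq> 0} \<subseteq> {a..b} \<times> cball 0 (2 * R)"
  proof
    fix z assume "z \<in> {z. \<phi> z \<noteq> 0}"
    then have "\<theta> (fst z) \<noteq> 0" "cutoff R (snd z \<bullet> snd z) \<noteq> 0" by (auto simp: \<phi>_def)
    then have "fst z \<in> {a..b}" "norm (snd z) \<le> 2 * R"
      using assms(3) cutoff_eq_0[OF R, of "snd z"] by force+
    then show "z \<in> {a..b} \<times> cball 0 (2 * R)" by (auto simp: mem_Times_iff)
  qed
  moreover have K: "compact ({a..b} \<times> cball (0::real^'d) (2 * R))" by (intro compact_Times) auto
  ultimately have sub: "closure {z. \<phi> z \<noteq> 0} \<subseteq> {a..b} \<times> cball 0 (2 * R)"
    by (intro closure_minimal compact_imp_closed)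
  have "closed (closure {z. \<phi> z \<noteq> 0})" by simp
  with sub K have "compact (closure {z. \<phi> z \<noteq> 0})"
    by (metis compact_Int_closed inf.absorb_iff2)
  moreover have "closure {z. \<phi> z \<noteq> 0} \<subseteq> {0<..} \<times> UNIV" using sub assms(1) by force
  ultimately show ?thesis using Ck_fun_probe by (simp add: test_functions_def)
qed

end

section \<open>Uniqueness for the Ornstein--Uhlenbeck equation\<close>

lemma continuous_wave: "continuous_on S (wave \<xi> \<beta>)"
  using Ck_fun_imp_continuous[OF Ck_fun_wave[of 0]] continuous_on_subset by blast

lemma continuous_wave_defect: "continuous_on UNIV (wave_defect \<xi> \<beta> R)"
  unfolding wave_defect_def[abs_def] Let_def wave_amp_def
  by (intro continuous_intros continuous_on_compose2[OF continuous_cutoff(2)[of UNIV]]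
      continuous_on_compose2[OF continuous_cutoff(3)[of UNIV]]; auto intro!: continuous_intros)

lemma wave_amp_pos: "0 < wave_amp \<xi> s"
  by (simp add: wave_amp_def)

lemma wave_amp_mono: "s \<le> t \<Longrightarrow> wave_amp \<xi> s \<le> wave_amp \<xi> t"
  unfolding wave_amp_def by (auto intro!: mult_left_mono power_mono divide_right_mono)

lemma wave_bound: "\<bar>wave \<xi> \<beta> (s, x)\<bar> \<le> wave_amp \<xi> s"
  using wave_amp_pos[of \<xi> s] by (simp add: wave_def abs_mult mult_left_le)

lemma cutoff_bounds: "0 \<le> cutoff R q" "cutoff R q \<le> 1"
  using smooth_step_bounds by (auto simp: cutoff_def)

text \<open>The derivatives of the cutoff live on \<open>R \<le> |x| \<le> 2 R\<close> and are of size \<open>1/R\<^sup>2\<close> and \<open>1/R\<^sup>4\<close> in the variable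
\<open>x \<bullet> x\<close>, which compensates the factors \<open>x \<bullet> x\<close> and \<open>\<xi> \<bullet> x\<close>. In particular the drift term
\<open>x \<bullet> \<nabla>\<close> stays bounded; it does not become small, and only the shrinking mass of the region \<open>|x| \<ge> R\<close>
removes it in the limit.\<close>

lemma wave_defect_bound:
  fixes \<xi> :: "real^'d"
  obtains C where "0 < C" "\<And>R s x. 1 \<le> R \<Longrightarrow> s \<le> t \<Longrightarrow> \<bar>wave_defect \<xi> \<beta> R (s, x)\<bar> \<le> C"
proof -
  obtain B where B: "0 < B" "\<And>x. \<bar>step_deriv x\<bar> \<le> B" "\<And>x. \<bar>step_deriv2 x\<bar> \<le> B" using step_derivs_bounded by metis
  define C where "C = 16 * B + 2 * real CARD('d) * B + 8 * B + 8 * B * (exp t * norm \<xi>)"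
  have C: "0 < C" using B(1) unfolding C_def by (intro add_pos_nonneg) auto
  have bd: "\<bar>wave_defect \<xi> \<beta> R (s, x)\<bar> \<le> wave_amp \<xi> t * C" if R: "1 \<le> R" and s: "s \<le> t" for R s x
  proof (cases "norm x < R \<or> 2 * R < norm x")
    case True
    then have "cutoff_deriv R (x \<bullet> x) = 0" "cutoff_deriv2 R (x \<bullet> x) = 0" using cutoff_derivs_eq_0[of R x] R by auto
    then show ?thesis using C wave_amp_pos[of \<xi> t] by (simp add: wave_defect_def)
  next
    case False
    define k1 k2 q w where "k1 = cutoff_deriv R (x \<bullet> x)" "k2 = cutoff_deriv2 R (x \<bullet> x)" "q = x \<bullet> x" "w = exp s * (\<xi> \<bullet> x)"
    note defs = this
    have k1: "\<bar>k1\<bar> \<le> B / R\<^sup>2" using B(2)[of "(x \<bullet> x) / R\<^sup>2 - 1"] R by (simp add: defs cutoff_deriv_def divide_right_mono)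
    have k2: "\<bar>k2\<bar> \<le> B / R ^ 4" using B(3)[of "(x \<bullet> x) / R\<^sup>2 - 1"] R by (simp add: defs cutoff_deriv2_def divide_right_mono)
    have q: "0 \<le> q" "q \<le> 4 * R\<^sup>2"
      using False power_mono[of "norm x" "2 * R" 2] by (auto simp: defs power2_norm_eq_inner[symmetric] power_mult_distrib)
    have w: "\<bar>w\<bar> \<le> exp t * norm \<xi> * (2 * R)"
    proof -
      have "\<bar>\<xi> \<bullet> x\<bar> \<le> norm \<xi> * (2 * R)"
        using False by (intro order_trans[OF Cauchy_Schwarz_ineq2] mult_left_mono) auto
      then show ?thesis using s by (simp add: defs abs_mult mult.assoc mult_mono)
    qed
    have dl: "u / v \<le> u" if "1 \<le> v" "0 \<le> u" for u v :: real
      using mult_left_mono[OF that] that by (simp add: divide_le_eq)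
    have R1: "1 \<le> R\<^sup>2" using R by (simp add: one_le_power)
    have R4: "R ^ 4 = R\<^sup>2 * R\<^sup>2" by (simp add: power_add[symmetric])
    have "\<bar>k2 * q\<bar> \<le> B / R ^ 4 * (4 * R\<^sup>2)"
      using mult_mono[OF k2 q(2)] q(1) B(1) by (simp add: abs_mult)
    also have "\<dots> = 4 * B / R\<^sup>2" unfolding R4 using R by (simp add: divide_simps)
    also have "\<dots> \<le> 4 * B" using R1 B(1) by (intro dl) auto
    finally have 1: "\<bar>k2 * q\<bar> \<le> 4 * B" .
    have "\<bar>k1\<bar> \<le> B" using R1 B(1) by (intro order_trans[OF k1] dl) auto
    then have 2: "real CARD('d) * \<bar>k1\<bar> \<le> real CARD('d) * B" by (intro mult_left_mono) auto
    have "\<bar>k1 * q\<bar> \<le> B / R\<^sup>2 * (4 * R\<^sup>2)"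
      using mult_mono[OF k1 q(2)] q(1) B(1) by (simp add: abs_mult)
    also have "\<dots> = 4 * B" using R by simp
    finally have 3: "\<bar>k1 * q\<bar> \<le> 4 * B" .
    have "\<bar>k1 * w\<bar> \<le> B / R\<^sup>2 * (exp t * norm \<xi> * (2 * R))"
      using mult_mono[OF k1 w] B(1) by (simp add: abs_mult)
    also have "\<dots> = 2 * B * (exp t * norm \<xi>) / R" using R by (simp add: power2_eq_square field_simps)
    also have "\<dots> \<le> 2 * B * (exp t * norm \<xi>)" using R B(1) by (intro dl) auto
    finally have 4: "\<bar>k1 * w\<bar> \<le> 2 * B * (exp t * norm \<xi>)" .
    have trig: "\<bar>u * cos z\<bar> \<le> \<bar>u\<bar>" "\<bar>u * sin z\<bar> \<le> \<bar>u\<bar>" for u z :: real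
      by (auto simp: abs_mult mult_left_le)
    have "\<bar>(4 * (k2 * q) + 2 * (real CARD('d) * k1) - 2 * (k1 * q)) * cos (w + \<beta>) - 4 * (k1 * w) * sin (w + \<beta>)\<bar>
       \<le> \<bar>4 * (k2 * q) + 2 * (real CARD('d) * k1) - 2 * (k1 * q)\<bar> + \<bar>4 * (k1 * w)\<bar>"
      by (intro order_trans[OF abs_triangle_ineq4] add_mono trig)
    also have "\<dots> \<le> C"
    proof -
      have 5: "\<bar>real CARD('d) * k1\<bar> \<le> real CARD('d) * B" using 2 by (simp add: abs_mult)
      have sum4: "\<bar>4 * u + 2 * v - 2 * w\<bar> + \<bar>4 * y\<bar> \<le> 4 * a + 2 * b + 2 * c + 4 * d"
        if "\<bar>u\<bar> \<le> a" "\<bar>v\<bar> \<le> b" "\<bar>w\<bar> \<le> c" "\<bar>y\<bar> \<le> d" for u v w y a b c d :: real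
        using that by linarith
      have "\<bar>4 * (k2 * q) + 2 * (real CARD('d) * k1) - 2 * (k1 * q)\<bar> + \<bar>4 * (k1 * w)\<bar>
          \<le> 4 * (4 * B) + 2 * (real CARD('d) * B) + 2 * (4 * B) + 4 * (2 * B * (exp t * norm \<xi>))"
        by (rule sum4[OF 1 5 3 4])
      also have "\<dots> = C" by (simp add: C_def)
      finally show ?thesis .
    qed
    finally have "\<bar>(4 * (k2 * q) + 2 * (real CARD('d) * k1) - 2 * (k1 * q)) * cos (w + \<beta>) - 4 * (k1 * w) * sin (w + \<beta>)\<bar> \<le> C" .
    then have "wave_amp \<xi> s * \<bar>(4 * (k2 * q) + 2 * (real CARD('d) * k1) - 2 * (k1 * q)) * cos (w + \<beta>) - 4 * (k1 * w) * sin (w + \<beta>)\<bar> \<le> wave_amp \<xi> t * C"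
    proof (rule mult_mono[OF wave_amp_mono[OF s]])
      show "0 \<le> wave_amp \<xi> t" using wave_amp_pos[of \<xi> t] by simp
    qed auto
    moreover have "wave_defect \<xi> \<beta> R (s, x) = wave_amp \<xi> s *
        ((4 * (k2 * q) + 2 * (real CARD('d) * k1) - 2 * (k1 * q)) * cos (w + \<beta>) - 4 * (k1 * w) * sin (w + \<beta>))"
      by (simp only: wave_defect_def Let_def fst_conv snd_conv defs mult.assoc)
    ultimately show ?thesis
      using wave_amp_pos[of \<xi> s] by (simp only: abs_mult abs_of_pos)
  qed
  show thesis by (rule that[of "wave_amp \<xi> t * C"]) (use C wave_amp_pos[of \<xi> t] bd in auto)
qed

text \<open>Test the equation with a time window times the truncated wave. The window gives the increment of the
truncated integral over a time interval as the integral of the defect; the defect is bounded and vanishes for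
\<open>|x| < R\<close>, so its integrals tend to \<open>0\<close> as \<open>R \<rightarrow> \<infinity>\<close>.\<close>

lemma OU_solution_wave:
  fixes \<xi> :: "real^'d"
  assumes sol: "OU_solution \<eta>0 \<eta>" and t: "0 \<le> t"
  shows "(\<integral>x. wave \<xi> \<beta> (t, x) \<partial>\<eta> t) = (\<integral>x. wave \<xi> \<beta> (0, x) \<partial>\<eta>0)"
proof (cases "t = 0")
  case True
  then show ?thesis using sol by (simp add: OU_solution_def)
next
  case False
  with t have t: "0 < t" by simp
  have \<eta>0: "\<eta> 0 = \<eta>0" and pr: "\<And>s. 0 \<le> s \<Longrightarrow> \<eta> s \<in> borel_prob" and wc: "weakly_continuous_on {0..} \<eta>"
    and eqn: "\<And>\<phi>. \<phi> \<in> test_functions ({0<..} \<times> UNIV) \<Longrightarrow> (LBINT t:{0<..}. (\<integral>x. time_deriv \<phi> (t, x) + space_laplacian \<phi> (t, x)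
           - x \<bullet> space_grad \<phi> (t, x) \<partial>(\<eta> t))) = 0"
    using sol by (auto simp: OU_solution_def)
  have prD: "prob_space (\<eta> s)" "sets (\<eta> s) = sets borel" if "0 \<le> s" for s using pr[OF that] by (auto simp: borel_prob_def)
  have meas: "f \<in> borel_measurable (\<eta> s)" if "0 \<le> s" "continuous_on UNIV f" for f :: "real^'d \<Rightarrow> real" and s
    using borel_measurable_continuous_onI[OF that(2)] by (simp add: measurable_cong_sets[OF prD(2)[OF that(1)] refl])
  define k where "k R p = cutoff R (snd p \<bullet> snd p) * wave \<xi> \<beta> p" for R and p :: "real \<times> (real^'d)"
  \<comment> \<open>Times are clamped at \<open>0\<close>, which extends both integrals to continuous functions on the whole line.\<close>
  define m where "m R s = (\<integral>x. k R (max 0 s, x) \<partial>\<eta> (max 0 s))" for R s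
  define e where "e R s = (\<integral>x. wave_defect \<xi> \<beta> R (max 0 s, x) \<partial>\<eta> (max 0 s))" for R s
  have kcont: "continuous_on UNIV (k R)" for R
    unfolding k_def by (intro continuous_intros continuous_on_compose2[OF continuous_cutoff(1)[of UNIV]] continuous_wave)
      (auto intro!: continuous_intros)
  have xcont: "continuous_on UNIV (\<lambda>x. F (s, x))" if "continuous_on UNIV F" for F :: "real \<times> (real^'d) \<Rightarrow> real" and s
    by (rule continuous_on_compose2[OF that]) (auto intro!: continuous_intros)
  have kb: "\<bar>k R (s, x)\<bar> \<le> wave_amp \<xi> s" for R s x
  proof -
    have "\<bar>cutoff R (x \<bullet> x)\<bar> * \<bar>wave \<xi> \<beta> (s, x)\<bar> \<le> 1 * wave_amp \<xi> s"
      by (rule mult_mono) (use cutoff_bounds[of R "x \<bullet> x"] wave_bound[of \<xi> \<beta> s x] in auto)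
    then show ?thesis by (simp add: k_def abs_mult)
  qed
  have kint: "integrable (\<eta> s) (\<lambda>x. k R (s, x))" if "0 \<le> s" for R s
  proof -
    interpret prob_space "\<eta> s" by (rule prD[OF that])
    show ?thesis by (rule integrable_const_bound[where B="wave_amp \<xi> s"]) (auto simp: kb intro!: meas that xcont kcont)
  qed
  have supp: "k R (s, x) = 0" "wave_defect \<xi> \<beta> R (s, x) = 0" if "0 < R" "norm x > 2 * R" for R s x
    using that cutoff_eq_0[of R x] cutoff_derivs_eq_0[of R x] by (auto simp: k_def wave_defect_def)
  have dint: "integrable (\<eta> s) (\<lambda>x. wave_defect \<xi> \<beta> R (s, x))" if "0 \<le> s" "1 \<le> R" for R s
  proof -
    interpret prob_space "\<eta> s" by (rule prD[OF that(1)])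
    obtain C where "0 < C" "\<And>R s' x. 1 \<le> R \<Longrightarrow> s' \<le> s \<Longrightarrow> \<bar>wave_defect \<xi> \<beta> R (s', x)\<bar> \<le> C"
      using wave_defect_bound[of s \<xi> \<beta>] by metis
    then show ?thesis using that
      by (intro integrable_const_bound[where B=C]) (auto intro!: meas xcont continuous_wave_defect)
  qed
  have cont: "continuous_on UNIV (m R)" "continuous_on UNIV (e R)" if "1 \<le> R" for R
  proof -
    have "continuous_on {0..} (\<lambda>s. \<integral>x. k R (s, x) \<partial>\<eta> s)"
      by (rule weakly_continuous_integral_time_dependent[OF wc pr kcont, where R="2 * R"]) (use supp that in auto)
    then show "continuous_on UNIV (m R)"
      unfolding m_def by (rule continuous_on_compose2) (auto intro!: continuous_intros)
    have "continuous_on {0..} (\<lambda>s. \<integral>x. wave_defect \<xi> \<beta> R (s, x) \<partial>\<eta> s)"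
      by (rule weakly_continuous_integral_time_dependent[OF wc pr continuous_wave_defect, where R="2 * R"]) (use supp that in auto)
    then show "continuous_on UNIV (e R)"
      unfolding e_def by (rule continuous_on_compose2) (auto intro!: continuous_intros)
  qed
  have incr: "m R t - m R a = (\<integral>s. indicator {a<..t} s * e R s \<partial>lborel)" if R: "1 \<le> R" and a: "0 < a" "a < t" for R a
  proof (rule weak_derivative_imp_increment[OF cont[OF R] a(2)])
    fix \<epsilon> :: real assume \<epsilon>: "0 < \<epsilon>" "\<epsilon> \<le> 1"
    define \<phi> where "\<phi> = (\<lambda>p. window a t \<epsilon> (fst p) * (cutoff R (snd p \<bullet> snd p) * wave \<xi> \<beta> p))"
    have R0: "0 < R" using R by simp
    have "\<phi> \<in> test_functions ({0<..} \<times> UNIV)"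
      unfolding \<phi>_def
      by (rule probe_test_function[OF R0 Ck_fun_window window_has_derivative, where a=a and b="t + \<epsilon>"])
         (use a \<epsilon> window_eq_0[of \<epsilon> a t] in auto)
    from eqn[OF this] have "0 = (LBINT s:{0<..}. (\<integral>x. window_deriv a t \<epsilon> s * k R (s, x) + window a t \<epsilon> s * wave_defect \<xi> \<beta> R (s, x) \<partial>\<eta> s))"
      unfolding \<phi>_def probe_OU_operator[OF R0 Ck_fun_window window_has_derivative] by (simp add: k_def)
    also have "\<dots> = (LBINT s:{0<..}. window_deriv a t \<epsilon> s * m R s + window a t \<epsilon> s * e R s)"
      by (rule set_lebesgue_integral_cong) (use kint dint R in \<open>auto simp: m_def e_def\<close>)
    also have "\<dots> = (\<integral>s. window_deriv a t \<epsilon> s * m R s + window a t \<epsilon> s * e R s \<partial>lborel)"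
      unfolding set_lebesgue_integral_def
      by (rule Bochner_Integration.integral_cong) (use window_eq_0[OF \<epsilon>(1), of a t] a in \<open>auto split: split_indicator\<close>)
    finally show "(\<integral>s. window_deriv a t \<epsilon> s * m R s + window a t \<epsilon> s * e R s \<partial>lborel) = 0" by simp
  qed
  obtain C where C: "0 < C" "\<And>R s x. 1 \<le> R \<Longrightarrow> s \<le> t \<Longrightarrow> \<bar>wave_defect \<xi> \<beta> R (s, x)\<bar> \<le> C"
    using wave_defect_bound[of t \<xi> \<beta>] by metis
  have ebound: "\<bar>e R s\<bar> \<le> C" if "1 \<le> R" "s \<le> t" for R s
  proof -
    interpret prob_space "\<eta> (max 0 s)" by (rule prD) simp
    have "\<bar>e R s\<bar> \<le> (\<integral>x. \<bar>wave_defect \<xi> \<beta> R (max 0 s, x)\<bar> \<partial>\<eta> (max 0 s))"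
      unfolding e_def by (rule integral_abs_bound)
    also have "\<dots> \<le> C"
      using dint[of "max 0 s" R] that C(2)[of R "max 0 s"] t by (intro integral_le_const) auto
    finally show ?thesis .
  qed
  define \<delta> where "\<delta> R = (\<integral>s. indicator {0..t} s * \<bar>e R s\<bar> \<partial>lborel)" for R
  have em: "e R \<in> borel_measurable borel" if "1 \<le> R" for R using cont(2)[OF that] by (rule borel_measurable_continuous_onI)
  have iI: "integrable lborel (\<lambda>s. indicator {0..t} s * C)"
    using t by (intro integrable_mult_left integrable_real_indicator) auto
  have ei: "integrable lborel (\<lambda>s. indicator {u..t} s * e R s)" "integrable lborel (\<lambda>s. indicator {u<..t} s * e R s)"
     if "1 \<le> R" "0 \<le> u" for R u
    by (rule Bochner_Integration.integrable_bound[OF iI]; use em[OF that(1)] ebound[OF that(1)] that in \<open>auto split: split_indicator intro!: AE_I2 intro: order_trans[OF _ abs_ge_self]\<close>)+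
  have le_a: "\<bar>m R t - m R a\<bar> \<le> \<delta> R" if R: "1 \<le> R" and a: "0 < a" "a < t" for R a
  proof -
    have "\<bar>m R t - m R a\<bar> \<le> (\<integral>s. \<bar>indicator {a<..t} s * e R s\<bar> \<partial>lborel)"
      unfolding incr[OF that] by (rule integral_abs_bound)
    also have "\<dots> \<le> \<delta> R"
      unfolding \<delta>_def using ei(2)[OF R, of a] ei(1)[OF R, of 0] a
      by (intro integral_mono) (auto split: split_indicator simp: abs_mult dest: integrable_abs)
    finally show ?thesis .
  qed
  \<comment> \<open>Going down to the initial time before \<open>R \<rightarrow> \<infinity>\<close>: the truncated integral is continuous at \<open>0\<close> because its integrand has compact support in space.\<close>
  have le: "\<bar>m R t - m R 0\<bar> \<le> \<delta> R" if R: "1 \<le> R" for R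
  proof (rule tendsto_upperbound)
    have "isCont (m R) 0" using cont(1)[OF R] by (simp add: continuous_on_eq_continuous_at)
    then have "((\<lambda>a. m R a) \<longlongrightarrow> m R 0) (at_right 0)" by (simp add: isCont_def filterlim_at_split)
    then show "((\<lambda>a. \<bar>m R t - m R a\<bar>) \<longlongrightarrow> \<bar>m R t - m R 0\<bar>) (at_right 0)" by (intro tendsto_intros)
    show "\<forall>\<^sub>F a in at_right 0. \<bar>m R t - m R a\<bar> \<le> \<delta> R"
      using t le_a[OF R] by (auto simp: eventually_at_right_field)
  qed simp
  have Rn: "1 \<le> real n + 1" for n by simp
  have mlim: "(\<lambda>n. m (real n + 1) s) \<longlonglongrightarrow> (\<integral>x. wave \<xi> \<beta> (s, x) \<partial>\<eta> s)" if s: "0 \<le> s" for s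
  proof -
    interpret prob_space "\<eta> s" by (rule prD[OF s])
    have "(\<lambda>n. \<integral>x. k (real n + 1) (s, x) \<partial>\<eta> s) \<longlonglongrightarrow> (\<integral>x. wave \<xi> \<beta> (s, x) \<partial>\<eta> s)"
    proof (rule integral_dominated_convergence[where w="\<lambda>_. wave_amp \<xi> s"])
      show "AE x in \<eta> s. (\<lambda>n. k (real n + 1) (s, x)) \<longlonglongrightarrow> wave \<xi> \<beta> (s, x)"
      proof (rule AE_I2)
        fix x :: "real^'d"
        have "\<forall>\<^sub>F n in sequentially. wave \<xi> \<beta> (s, x) = k (real n + 1) (s, x)"
          using eventually_ge_at_top[of "nat \<lceil>norm x\<rceil>"]
        proof eventually_elim
          case (elim n)
          then have "norm x \<le> real n + 1" by linarith
          then show ?case using cutoff_eq_1[of "real n + 1" x] by (simp add: k_def)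
        qed
        from Lim_transform_eventually[OF tendsto_const this]
        show "(\<lambda>n. k (real n + 1) (s, x)) \<longlonglongrightarrow> wave \<xi> \<beta> (s, x)" .
      qed
    qed (auto simp: kb intro!: meas s xcont kcont continuous_wave)
    then show ?thesis using s by (simp add: m_def)
  qed
  have elim: "(\<lambda>n. e (real n + 1) s) \<longlonglongrightarrow> 0" if s: "s \<in> {0..t}" for s
  proof -
    have s0: "0 \<le> s" using s by simp
    interpret prob_space "\<eta> s" by (rule prD[OF s0])
    have "(\<lambda>n. \<integral>x. wave_defect \<xi> \<beta> (real n + 1) (s, x) \<partial>\<eta> s) \<longlonglongrightarrow> (\<integral>x. 0 \<partial>\<eta> s)"
    proof (rule integral_dominated_convergence[where w="\<lambda>_. C"])
      show "AE x in \<eta> s. (\<lambda>n. wave_defect \<xi> \<beta> (real n + 1) (s, x)) \<longlonglongrightarrow> 0"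
      proof (rule AE_I2)
        fix x :: "real^'d"
        have "\<forall>\<^sub>F n in sequentially. 0 = wave_defect \<xi> \<beta> (real n + 1) (s, x)"
          using eventually_ge_at_top[of "nat \<lceil>norm x\<rceil>"]
        proof eventually_elim
          case (elim n)
          then have "norm x < real n + 1" by linarith
          then show ?case using cutoff_derivs_eq_0[of "real n + 1" x] by (simp add: wave_defect_def)
        qed
        from Lim_transform_eventually[OF tendsto_const this]
        show "(\<lambda>n. wave_defect \<xi> \<beta> (real n + 1) (s, x)) \<longlonglongrightarrow> 0" .
      qed
    qed (use s C(2)[OF Rn] in \<open>auto intro!: meas xcont continuous_wave_defect\<close>)
    then show ?thesis using s by (simp add: e_def max_def)
  qed
  have "(\<lambda>n. \<delta> (real n + 1)) \<longlonglongrightarrow> (\<integral>s. 0 \<partial>(lborel :: real measure))"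
    unfolding \<delta>_def
  proof (rule integral_dominated_convergence[OF _ _ iI])
    show "AE s in lborel. (\<lambda>n. indicator {0..t} s * \<bar>e (real n + 1) s\<bar>) \<longlonglongrightarrow> 0"
    proof (rule AE_I2)
      fix s show "(\<lambda>n. indicator {0..t} s * \<bar>e (real n + 1) s\<bar>) \<longlonglongrightarrow> 0"
        using elim[of s] by (cases "s \<in> {0..t}") (auto intro: tendsto_rabs_zero)
    qed
  qed (use em[OF Rn] ebound[OF Rn] in \<open>auto split: split_indicator\<close>)
  then have \<delta>lim: "(\<lambda>n. \<delta> (real n + 1)) \<longlonglongrightarrow> 0" by simp
  have "\<bar>(\<integral>x. wave \<xi> \<beta> (t, x) \<partial>\<eta> t) - (\<integral>x. wave \<xi> \<beta> (0, x) \<partial>\<eta> 0)\<bar> \<le> 0"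
    by (rule LIMSEQ_le[OF tendsto_rabs[OF tendsto_diff[OF mlim mlim]] \<delta>lim]) (use t le[OF Rn] in auto)
  then show ?thesis by (simp add: \<eta>0)
qed

text \<open>The frequency \<open>exp (-t) \<xi>\<close> at time \<open>0\<close> has grown to \<open>\<xi>\<close> at time \<open>t\<close>, so all cosine transforms at time \<open>t\<close> are
determined by the initial measure.\<close>

lemma OU_solution_unique:
  fixes \<eta>0 :: "(real^'d) measure"
  assumes "OU_solution \<eta>0 \<eta>" "OU_solution \<eta>0 \<eta>'" "0 \<le> t"
  shows "\<eta> t = \<eta>' t"
proof (rule measure_eqI_cos_transform)
  fix \<xi> :: "real^'d" and \<beta>
  have "(\<integral>x. wave (exp (- t) *\<^sub>R \<xi>) \<beta> (t, x) \<partial>\<eta> t) = (\<integral>x. wave (exp (- t) *\<^sub>R \<xi>) \<beta> (t, x) \<partial>\<eta>' t)"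
    using OU_solution_wave[OF assms(1,3)] OU_solution_wave[OF assms(2,3)] by simp
  moreover have "wave (exp (- t) *\<^sub>R \<xi>) \<beta> (t, x) = wave_amp (exp (- t) *\<^sub>R \<xi>) t * cos (\<xi> \<bullet> x + \<beta>)" for x
  proof -
    have "exp t * (exp (- t) * (\<xi> \<bullet> x)) = \<xi> \<bullet> x" by (simp add: exp_minus)
    then show ?thesis by (simp only: wave_def fst_conv snd_conv inner_scaleR_left)
  qed
  ultimately show "(\<integral>x. cos (\<xi> \<bullet> x + \<beta>) \<partial>\<eta> t) = (\<integral>x. cos (\<xi> \<bullet> x + \<beta>) \<partial>\<eta>' t)"
    using wave_amp_pos[of "exp (- t) *\<^sub>R \<xi>" t] by simp
qed (use assms in \<open>auto simp: OU_solution_def borel_prob_def\<close>)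

lemma OU_eq_mehler:
  fixes \<mu> :: "(real^'d) measure"
  assumes \<mu>: "\<mu> \<in> P0Id" and t: "0 \<le> t"
  shows "OU t \<mu> = mehler t \<mu>"
proof -
  have m: "(\<lambda>x. x) \<in> borel_measurable \<mu>"
    by (simp add: measurable_cong_sets[OF P0IdD(2)[OF \<mu>] refl])
  have sol: "OU_solution \<mu> (\<lambda>t. mehler t \<mu>)"
    by (rule OU_solution_mehler[OF P0IdD(1,2)[OF \<mu>] integrable_norm_of_norm_square[OF P0IdD(1,3)[OF \<mu>] m]])
  show ?thesis
    unfolding OU_def
  proof (rule the_equality)
    show "\<exists>\<eta>. OU_solution \<mu> \<eta> \<and> mehler t \<mu> = \<eta> t"
      by (rule exI[of _ "\<lambda>t. mehler t \<mu>"]) (simp add: sol)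
    show "\<nu> = mehler t \<mu>" if "\<exists>\<eta>. OU_solution \<mu> \<eta> \<and> \<nu> = \<eta> t" for \<nu>
      using that OU_solution_unique[OF _ sol t] by metis
  qed
qed

section \<open>Smoothing a vector field along a Gaussian kernel\<close>

lemma integral_measurable_kernel:
  fixes f :: "'a \<Rightarrow> 'b \<Rightarrow> 'c::{banach, second_countable_topology}"
  assumes f[measurable]: "(\<lambda>(x, y). f x y) \<in> borel_measurable (M \<Otimes>\<^sub>M N)"
    and L[measurable]: "L \<in> measurable M (subprob_algebra N)"
  shows "(\<lambda>x. \<integral>y. f x y \<partial>L x) \<in> borel_measurable M"
proof -
  note measurable_distr2[measurable]
  have "(\<lambda>x. integral\<^sup>L (distr (L x) (M \<Otimes>\<^sub>M N) (\<lambda>y. (x, y))) (\<lambda>(x, y). f x y)) \<in> borel_measurable M"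
    by measurable
  moreover have "integral\<^sup>L (distr (L x) (M \<Otimes>\<^sub>M N) (\<lambda>y. (x, y))) (\<lambda>(x, y). f x y) = (\<integral>y. f x y \<partial>L x)"
    if "x \<in> space M" for x
  proof -
    have "sets (L x) = sets N" using L that by (rule sets_kernel)
    then have "(\<lambda>y. (x, y)) \<in> measurable (L x) (M \<Otimes>\<^sub>M N)"
      using measurable_Pair1'[OF that, of N] measurable_cong_sets[OF \<open>sets (L x) = sets N\<close> refl] by blast
    from integral_distr[OF this f] show ?thesis by simp
  qed
  ultimately show ?thesis by (simp cong: measurable_cong)
qed

text \<open>The mass of a closed set depends measurably on the parameter as a limit of continuous functions, and
closed sets generate the Borel sets.\<close>

lemma weakly_continuous_kernel:
  fixes \<kappa> :: "real \<Rightarrow> (real^'d) measure"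
  assumes wc: "weakly_continuous_on UNIV \<kappa>" and pr: "\<And>s. prob_space (\<kappa> s)" "\<And>s. sets (\<kappa> s) = sets borel"
  shows "\<kappa> \<in> measurable borel (subprob_algebra borel)"
proof (rule measurable_subprob_algebra_generated[where \<Omega>=UNIV and G="Collect closed"])
  have "(\<lambda>s. emeasure (\<kappa> s) F) \<in> borel_measurable borel" if F: "closed F" for F
  proof (cases "F = {}")
    case False
    have "(\<lambda>s. \<integral>x. max 0 (1 - real n * infdist x F) \<partial>\<kappa> s) \<in> borel_measurable borel" for n
    proof -
      have "continuous_on UNIV (\<lambda>x. max 0 (1 - real n * infdist x F))" by (intro continuous_intros)
      moreover have "bounded (range (\<lambda>x. max 0 (1 - real n * infdist x F)))"
        by (auto intro!: boundedI[of _ 1] simp: infdist_nonneg)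
      ultimately show ?thesis
        using wc by (intro borel_measurable_continuous_onI) (auto simp: weakly_continuous_on_def)
    qed
    then have "(\<lambda>s. measure (\<kappa> s) F) \<in> borel_measurable borel"
      by (rule borel_measurable_LIMSEQ_real[rotated]) (rule integral_infdist_tendsto_measure[OF F False pr])
    then have "(\<lambda>s. ennreal (measure (\<kappa> s) F)) \<in> borel_measurable borel" by measurable
    then show ?thesis
      using pr(1) by (simp add: finite_measure.emeasure_eq_measure prob_space.finite_measure)
  qed simp
  then show "\<And>A. A \<in> Collect closed \<Longrightarrow> (\<lambda>s. emeasure (\<kappa> s) A) \<in> borel_measurable borel"
    "(\<lambda>s. emeasure (\<kappa> s) UNIV) \<in> borel_measurable borel" by auto
qed (auto simp: pr prob_space_imp_subprob_space borel_eq_closed Int_stable_def)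

lemma nn_integral_gauss_kernel:
  fixes c :: "'a::euclidean_space"
  shows "s > 0 \<Longrightarrow> (\<integral>\<^sup>+y. ennreal (gauss_kernel s (y - c)) \<partial>lborel) = 1"
  using nn_integral_std_gauss_affine[of "\<lambda>_. 1" s c] prob_space.emeasure_space_1[OF prob_space_std_gauss[where 'a='a]]
  by simp

text \<open>The conditional expectation \<open>a E[v X | a X + s Z = y]\<close>, written with densities. This explicit form is
jointly measurable in \<open>y\<close> and in the parameters of the measure and the field.\<close>

definition smoothed_field :: "real \<Rightarrow> real \<Rightarrow> 'a::euclidean_space measure \<Rightarrow> ('a \<Rightarrow> 'a) \<Rightarrow> 'a \<Rightarrow> 'a" where
  "smoothed_field a s \<mu> v y = (a / smoothed_density a s \<mu> y) *\<^sub>R (\<integral>x. gauss_kernel s (y - a *\<^sub>R x) *\<^sub>R v x \<partial>\<mu>)"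

context
  fixes \<mu> :: "'a::euclidean_space measure" and v :: "'a \<Rightarrow> 'a" and a s :: real
  assumes pr: "prob_space \<mu>" and sets_\<mu>[measurable_cong]: "sets \<mu> = sets borel" and v[measurable]: "v \<in> borel_measurable borel" and s: "0 < s"
begin

interpretation \<mu>: prob_space \<mu> by (rule pr)
interpretation \<gamma>: prob_space "std_gauss :: 'a measure" by (rule prob_space_std_gauss)
interpretation P: pair_sigma_finite \<mu> "lborel :: 'a measure" ..
interpretation Q: pair_prob_space \<mu> "std_gauss :: 'a measure" ..

lemma smoothed_density_pos: "0 < smoothed_density a s \<mu> y"
proof -
  have nn: "0 \<le> smoothed_density a s \<mu> y"
    unfolding smoothed_density_def by (rule integral_nonneg_AE) (simp add: gauss_kernel_nonneg[OF s])
  have "smoothed_density a s \<mu> y \<noteq> 0"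
  proof
    assume "smoothed_density a s \<mu> y = 0"
    then have "AE x in \<mu>. gauss_kernel s (y - a *\<^sub>R x) = 0"
      using integral_nonneg_eq_0_iff_AE[OF integrable_gauss_kernel[OF pr sets_\<mu> s]] gauss_kernel_nonneg[OF s] by (auto simp: smoothed_density_def)
    then have "AE x in \<mu>. False"
      by eventually_elim (metis gauss_kernel_pos[OF s] less_irrefl)
    then show False by simp
  qed
  with nn show ?thesis by simp
qed

lemma borel_measurable_smoothed[measurable]:
  "smoothed_density a s \<mu> \<in> borel_measurable borel" "smoothed_field a s \<mu> v \<in> borel_measurable borel"
  unfolding smoothed_density_def[abs_def] smoothed_field_def[abs_def] by measurable

text \<open>Conditional Jensen inequality in the form of Cauchy--Schwarz: the kernel is split into two square
roots. If \<open>v\<close> is not integrable against the kernel, the Bochner integral in the definition is \<open>0\<close> and the bound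
is trivial.\<close>

lemma smoothed_field_Jensen:
  "ennreal (smoothed_density a s \<mu> y * (norm (smoothed_field a s \<mu> v y))\<^sup>2)
    \<le> ennreal (a\<^sup>2) * (\<integral>\<^sup>+x. ennreal (gauss_kernel s (y - a *\<^sub>R x)) * ennreal ((norm (v x))\<^sup>2) \<partial>\<mu>)"
proof -
  define d where "d = smoothed_density a s \<mu> y"
  define I where "I = (\<integral>x. gauss_kernel s (y - a *\<^sub>R x) *\<^sub>R v x \<partial>\<mu>)"
  define J where "J = (\<integral>\<^sup>+x. ennreal (gauss_kernel s (y - a *\<^sub>R x)) * ennreal ((norm (v x))\<^sup>2) \<partial>\<mu>)"
  have d: "0 < d" unfolding d_def by (rule smoothed_density_pos)
  have "ennreal (norm I) \<le> (\<integral>\<^sup>+x. ennreal (sqrt (gauss_kernel s (y - a *\<^sub>R x))) * ennreal (sqrt (gauss_kernel s (y - a *\<^sub>R x)) * norm (v x)) \<partial>\<mu>)"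
  proof (cases "integrable \<mu> (\<lambda>x. gauss_kernel s (y - a *\<^sub>R x) *\<^sub>R v x)")
    case True
    have "ennreal (norm I) \<le> (\<integral>\<^sup>+x. norm (gauss_kernel s (y - a *\<^sub>R x) *\<^sub>R v x) \<partial>\<mu>)"
      unfolding I_def by (rule integral_norm_bound_ennreal[OF True])
    also have "\<dots> = (\<integral>\<^sup>+x. ennreal (sqrt (gauss_kernel s (y - a *\<^sub>R x))) * ennreal (sqrt (gauss_kernel s (y - a *\<^sub>R x)) * norm (v x)) \<partial>\<mu>)"
      by (intro nn_integral_cong)
         (simp add: ennreal_mult[symmetric] gauss_kernel_nonneg[OF s] mult.assoc[symmetric])
    finally show ?thesis .
  qed (simp add: I_def not_integrable_integral_eq)
  then have "(ennreal (norm I))\<^sup>2 \<le> (\<integral>\<^sup>+x. ennreal (sqrt (gauss_kernel s (y - a *\<^sub>R x))) * ennreal (sqrt (gauss_kernel s (y - a *\<^sub>R x)) * norm (v x)) \<partial>\<mu>)\<^sup>2"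
    by (rule power_mono) simp
  also have "\<dots> \<le> (\<integral>\<^sup>+x. (ennreal (sqrt (gauss_kernel s (y - a *\<^sub>R x))))\<^sup>2 \<partial>\<mu>) * (\<integral>\<^sup>+x. (ennreal (sqrt (gauss_kernel s (y - a *\<^sub>R x)) * norm (v x)))\<^sup>2 \<partial>\<mu>)"
    by (rule Cauchy_Schwarz_nn_integral) measurable
  also have "\<dots> = ennreal d * J"
  proof -
    have "(\<integral>\<^sup>+x. (ennreal (sqrt (gauss_kernel s (y - a *\<^sub>R x))))\<^sup>2 \<partial>\<mu>) = ennreal d"
      unfolding d_def smoothed_density_def
      by (subst nn_integral_eq_integral[OF integrable_gauss_kernel[OF pr sets_\<mu> s], symmetric])
         (auto simp: gauss_kernel_nonneg[OF s] ennreal_power)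
    moreover have "(\<integral>\<^sup>+x. (ennreal (sqrt (gauss_kernel s (y - a *\<^sub>R x)) * norm (v x)))\<^sup>2 \<partial>\<mu>) = J"
      unfolding J_def
      by (intro nn_integral_cong) (auto simp: gauss_kernel_nonneg[OF s] ennreal_power ennreal_mult[symmetric] power_mult_distrib)
    ultimately show ?thesis by simp
  qed
  finally have CS: "ennreal ((norm I)\<^sup>2) \<le> ennreal d * J" by (simp add: ennreal_power)
  have "ennreal (d * (norm (smoothed_field a s \<mu> v y))\<^sup>2) = ennreal (a\<^sup>2 / d) * ennreal ((norm I)\<^sup>2)"
    using d by (simp add: smoothed_field_def d_def[symmetric] I_def[symmetric] ennreal_mult[symmetric] power_mult_distrib power_divide)
       (simp add: power2_eq_square)
  also have "\<dots> \<le> ennreal (a\<^sup>2 / d) * (ennreal d * J)" by (rule mult_left_mono[OF CS]) simp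
  also have "\<dots> = ennreal (a\<^sup>2) * J"
    using d by (simp add: mult.assoc[symmetric] ennreal_mult[symmetric])
  finally show ?thesis by (simp add: d_def J_def)
qed

lemma smoothed_field_energy:
  "(\<integral>\<^sup>+y. ennreal ((norm (smoothed_field a s \<mu> v y))\<^sup>2) \<partial>affine_gauss a s \<mu>) \<le> ennreal (a\<^sup>2) * (\<integral>\<^sup>+x. ennreal ((norm (v x))\<^sup>2) \<partial>\<mu>)"
proof -
  have "(\<integral>\<^sup>+y. ennreal ((norm (smoothed_field a s \<mu> v y))\<^sup>2) \<partial>affine_gauss a s \<mu>)
    = (\<integral>\<^sup>+y. ennreal (smoothed_density a s \<mu> y * (norm (smoothed_field a s \<mu> v y))\<^sup>2) \<partial>lborel)"
    unfolding affine_gauss_eq_density[OF pr sets_\<mu> s]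
    by (subst nn_integral_density) (auto simp: ennreal_mult[symmetric] less_imp_le[OF smoothed_density_pos])
  also have "\<dots> \<le> (\<integral>\<^sup>+y. ennreal (a\<^sup>2) * (\<integral>\<^sup>+x. ennreal (gauss_kernel s (y - a *\<^sub>R x)) * ennreal ((norm (v x))\<^sup>2) \<partial>\<mu>) \<partial>lborel)"
    by (intro nn_integral_mono smoothed_field_Jensen)
  also have "\<dots> = ennreal (a\<^sup>2) * (\<integral>\<^sup>+y. \<integral>\<^sup>+x. ennreal (gauss_kernel s (y - a *\<^sub>R x)) * ennreal ((norm (v x))\<^sup>2) \<partial>\<mu> \<partial>lborel)"
    by (rule nn_integral_cmult) measurable
  also have "(\<integral>\<^sup>+y. \<integral>\<^sup>+x. ennreal (gauss_kernel s (y - a *\<^sub>R x)) * ennreal ((norm (v x))\<^sup>2) \<partial>\<mu> \<partial>lborel)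
    = (\<integral>\<^sup>+x. \<integral>\<^sup>+y. ennreal (gauss_kernel s (y - a *\<^sub>R x)) * ennreal ((norm (v x))\<^sup>2) \<partial>lborel \<partial>\<mu>)"
    by (rule P.Fubini') measurable
  also have "\<dots> = (\<integral>\<^sup>+x. ennreal ((norm (v x))\<^sup>2) \<partial>\<mu>)"
    by (subst nn_integral_multc) (auto simp: nn_integral_gauss_kernel[OF s])
  finally show ?thesis .
qed

text \<open>The defining property of a conditional expectation, tested against a bounded field \<open>G\<close>.\<close>

lemma smoothed_field_pairing:
  fixes G :: "'a \<Rightarrow> 'a"
  assumes int: "integrable \<mu> (\<lambda>x. norm (v x))" and G[measurable]: "G \<in> borel_measurable borel" and B: "\<And>y. norm (G y) \<le> B"
  shows "(\<integral>y. smoothed_field a s \<mu> v y \<bullet> G y \<partial>affine_gauss a s \<mu>) = (\<integral>x. \<integral>z. (a *\<^sub>R v x) \<bullet> G (a *\<^sub>R x + s *\<^sub>R z) \<partial>std_gauss \<partial>\<mu>)"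
proof -
  define d where "d = smoothed_density a s \<mu>"
  have d: "0 < d y" for y unfolding d_def by (rule smoothed_density_pos)
  have [measurable]: "d \<in> borel_measurable borel" unfolding d_def by measurable
  have B0: "0 \<le> B" using norm_ge_zero B order_trans by blast
  have kv: "integrable \<mu> (\<lambda>x. gauss_kernel s (y - a *\<^sub>R x) *\<^sub>R v x)" for y
  proof (rule Bochner_Integration.integrable_bound[OF integrable_mult_right[OF int, of "(1 / sqrt (2 * pi)) ^ DIM('a) / s ^ DIM('a)"]])
    show "AE x in \<mu>. norm (gauss_kernel s (y - a *\<^sub>R x) *\<^sub>R v x) \<le> norm ((1 / sqrt (2 * pi)) ^ DIM('a) / s ^ DIM('a) * norm (v x))"
    proof (rule AE_I2)
      fix x
      show "norm (gauss_kernel s (y - a *\<^sub>R x) *\<^sub>R v x) \<le> norm ((1 / sqrt (2 * pi)) ^ DIM('a) / s ^ DIM('a) * norm (v x))"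
        using mult_right_mono[OF gauss_kernel_bounded[OF s, of "y - a *\<^sub>R x"], of "norm (v x)"]
          gauss_kernel_nonneg[OF s, of "y - a *\<^sub>R x"] s by (simp add: abs_mult)
    qed
  qed measurable
  have fub: "integrable (\<mu> \<Otimes>\<^sub>M lborel) (\<lambda>(x, y). gauss_kernel s (y - a *\<^sub>R x) * ((a *\<^sub>R v x) \<bullet> G y))"
  proof (rule integrableI_bounded)
    have "(\<integral>\<^sup>+p. ennreal (norm (case p of (x, y) \<Rightarrow> gauss_kernel s (y - a *\<^sub>R x) * ((a *\<^sub>R v x) \<bullet> G y))) \<partial>(\<mu> \<Otimes>\<^sub>M lborel))
      = (\<integral>\<^sup>+x. \<integral>\<^sup>+y. ennreal (norm (gauss_kernel s (y - a *\<^sub>R x) * ((a *\<^sub>R v x) \<bullet> G y))) \<partial>lborel \<partial>\<mu>)"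
      by (subst lborel.nn_integral_fst[symmetric]) auto
    also have "\<dots> \<le> (\<integral>\<^sup>+x. \<integral>\<^sup>+y. ennreal (gauss_kernel s (y - a *\<^sub>R x)) * ennreal (\<bar>a\<bar> * norm (v x) * B) \<partial>lborel \<partial>\<mu>)"
    proof (intro nn_integral_mono)
      fix x y
      have "\<bar>(a *\<^sub>R v x) \<bullet> G y\<bar> \<le> norm (a *\<^sub>R v x) * B"
        by (intro order_trans[OF Cauchy_Schwarz_ineq2] mult_left_mono B) simp
      then show "ennreal (norm (gauss_kernel s (y - a *\<^sub>R x) * ((a *\<^sub>R v x) \<bullet> G y))) \<le> ennreal (gauss_kernel s (y - a *\<^sub>R x)) * ennreal (\<bar>a\<bar> * norm (v x) * B)"
        using gauss_kernel_nonneg[OF s, of "y - a *\<^sub>R x"] B0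
        by (simp add: ennreal_mult[symmetric] abs_mult mult_left_mono)
    qed
    also have "\<dots> = (\<integral>\<^sup>+x. ennreal (\<bar>a\<bar> * norm (v x) * B) \<partial>\<mu>)"
      by (subst nn_integral_multc) (auto simp: nn_integral_gauss_kernel[OF s])
    also have "\<dots> < \<infinity>"
    proof -
      have "integrable \<mu> (\<lambda>x. \<bar>a\<bar> * norm (v x) * B)" using int by auto
      moreover have "norm (\<bar>a\<bar> * norm (v x) * B) = \<bar>a\<bar> * norm (v x) * B" for x
        using B0 by (simp add: abs_mult)
      ultimately show ?thesis by (simp only: integrable_iff_bounded)
    qed
    finally show "(\<integral>\<^sup>+p. ennreal (norm (case p of (x, y) \<Rightarrow> gauss_kernel s (y - a *\<^sub>R x) * ((a *\<^sub>R v x) \<bullet> G y))) \<partial>(\<mu> \<Otimes>\<^sub>M lborel)) < \<infinity>" .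
  qed measurable
  have "(\<integral>y. smoothed_field a s \<mu> v y \<bullet> G y \<partial>affine_gauss a s \<mu>) = (\<integral>y. d y * (smoothed_field a s \<mu> v y \<bullet> G y) \<partial>lborel)"
    unfolding affine_gauss_eq_density[OF pr sets_\<mu> s] d_def
    by (subst integral_density) (auto simp: less_imp_le[OF smoothed_density_pos])
  also have "\<dots> = (\<integral>y. \<integral>x. gauss_kernel s (y - a *\<^sub>R x) * ((a *\<^sub>R v x) \<bullet> G y) \<partial>\<mu> \<partial>lborel)"
  proof (rule Bochner_Integration.integral_cong[OF refl])
    fix y
    have "d y * (smoothed_field a s \<mu> v y \<bullet> G y) = a * ((\<integral>x. gauss_kernel s (y - a *\<^sub>R x) *\<^sub>R v x \<partial>\<mu>) \<bullet> G y)"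
      using d[of y] by (simp add: smoothed_field_def d_def)
    also have "\<dots> = a * (\<integral>x. (gauss_kernel s (y - a *\<^sub>R x) *\<^sub>R v x) \<bullet> G y \<partial>\<mu>)"
      by (subst integral_inner_left[OF kv]) simp
    also have "\<dots> = (\<integral>x. gauss_kernel s (y - a *\<^sub>R x) * ((a *\<^sub>R v x) \<bullet> G y) \<partial>\<mu>)"
      by (subst integral_mult_right_zero[symmetric]) (simp add: mult_ac)
    finally show "d y * (smoothed_field a s \<mu> v y \<bullet> G y) = (\<integral>x. gauss_kernel s (y - a *\<^sub>R x) * ((a *\<^sub>R v x) \<bullet> G y) \<partial>\<mu>)" .
  qed
  also have "\<dots> = (\<integral>x. \<integral>y. gauss_kernel s (y - a *\<^sub>R x) * ((a *\<^sub>R v x) \<bullet> G y) \<partial>lborel \<partial>\<mu>)"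
    by (rule P.Fubini_integral[OF fub])
  also have "\<dots> = (\<integral>x. \<integral>z. (a *\<^sub>R v x) \<bullet> G (a *\<^sub>R x + s *\<^sub>R z) \<partial>std_gauss \<partial>\<mu>)"
    by (intro Bochner_Integration.integral_cong refl integral_std_gauss_affine[OF _ s, symmetric]) measurable
  finally show ?thesis .
qed

text \<open>The spatial integral in the continuity equation at a fixed time, transferred from the smoothed measure back to the
original one and averaged over the noise. Here \<open>T\<close> and \<open>G\<close> stand for \<open>\<partial>\<^sub>t\<phi>\<close> and \<open>\<nabla>\<phi>\<close>.\<close>

lemma smoothed_field_test_integral:
  fixes T :: "'a \<Rightarrow> real" and G :: "'a \<Rightarrow> 'a"
  assumes sq: "integrable \<mu> (\<lambda>x. (norm (v x))\<^sup>2)"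
    and T[measurable]: "T \<in> borel_measurable borel" and B1: "\<And>y. \<bar>T y\<bar> \<le> B1"
    and G[measurable]: "G \<in> borel_measurable borel" and B2: "\<And>y. norm (G y) \<le> B2"
  shows "(\<integral>y. T y + smoothed_field a s \<mu> v y \<bullet> G y \<partial>affine_gauss a s \<mu>)
    = (\<integral>z. \<integral>x. T (a *\<^sub>R x + s *\<^sub>R z) + (a *\<^sub>R v x) \<bullet> G (a *\<^sub>R x + s *\<^sub>R z) \<partial>\<mu> \<partial>std_gauss)"
proof -
  let ?P = "\<mu> \<Otimes>\<^sub>M (std_gauss :: 'a measure)" and ?A = "affine_gauss a s \<mu>" and ?v = "smoothed_field a s \<mu> v"
  let ?Y = "\<lambda>p. a *\<^sub>R fst p + s *\<^sub>R snd p"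
  interpret A: prob_space ?A by (rule prob_space_affine_gauss[OF pr sets_\<mu>])
  have B2': "0 \<le> B2" using norm_ge_zero B2 order_trans by blast
  have [measurable]: "?v \<in> borel_measurable borel" by (rule borel_measurable_smoothed)
  have nv: "integrable \<mu> (\<lambda>x. norm (v x))" by (rule integrable_norm_of_norm_square[OF pr sq]) measurable
  have "(\<integral>\<^sup>+x. ennreal ((norm (v x))\<^sup>2) \<partial>\<mu>) < \<infinity>" using sq by (simp add: integrable_iff_bounded)
  then have "integrable ?A (\<lambda>y. (norm (?v y))\<^sup>2)"
    using order.strict_trans1[OF smoothed_field_energy] by (intro integrableI_nonneg) (auto simp: ennreal_mult_less_top)
  then have nv': "integrable ?A (\<lambda>y. norm (?v y))"
    by (rule integrable_norm_of_norm_square[OF A.prob_space_axioms]) simp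
  have CS: "\<bar>u \<bullet> G y\<bar> \<le> B2 * norm u" for u y
    using order_trans[OF Cauchy_Schwarz_ineq2 mult_left_mono[OF B2 norm_ge_zero]] by (simp add: mult.commute)
  have j1: "integrable ?A T" by (rule A.integrable_const_bound[where B=B1]) (simp_all add: B1)
  have j2: "integrable ?A (\<lambda>y. ?v y \<bullet> G y)"
    by (rule Bochner_Integration.integrable_bound[OF integrable_mult_right[OF nv', of B2]])
       (use CS B2' in \<open>auto simp: abs_mult\<close>)
  have i1: "integrable ?P (\<lambda>p. T (?Y p))"
    by (rule Q.integrable_const_bound[where B=B1]) (simp add: B1, measurable)
  have dom: "integrable ?P (\<lambda>p. B2 * (\<bar>a\<bar> * norm (v (fst p))))"
    using integrable_prod_mult[OF \<mu>.sigma_finite_measure_axioms \<gamma>.sigma_finite_measure_axioms nv, of "\<lambda>_. 1"]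
    by (auto simp: case_prod_unfold)
  have i2: "integrable ?P (\<lambda>p. (a *\<^sub>R v (fst p)) \<bullet> G (?Y p))"
  proof (rule Bochner_Integration.integrable_bound[OF dom])
    show "(\<lambda>p. (a *\<^sub>R v (fst p)) \<bullet> G (?Y p)) \<in> borel_measurable ?P" by measurable
    show "AE p in ?P. norm ((a *\<^sub>R v (fst p)) \<bullet> G (?Y p)) \<le> norm (B2 * (\<bar>a\<bar> * norm (v (fst p))))"
      using CS[of "a *\<^sub>R v _"] B2' by (auto simp: abs_mult)
  qed
  have "(\<integral>y. T y + ?v y \<bullet> G y \<partial>?A) = (\<integral>y. T y \<partial>?A) + (\<integral>y. ?v y \<bullet> G y \<partial>?A)"
    using j1 j2 by simp
  also have "(\<integral>y. T y \<partial>?A) = (\<integral>p. T (?Y p) \<partial>?P)"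
    by (rule integral_affine_gauss_pair(1)[OF pr sets_\<mu> T])
  also have "(\<integral>y. ?v y \<bullet> G y \<partial>?A) = (\<integral>p. (a *\<^sub>R v (fst p)) \<bullet> G (?Y p) \<partial>?P)"
    unfolding smoothed_field_pairing[OF nv G B2] using Q.integral_fst'[OF i2] by simp
  also have "(\<integral>p. T (?Y p) \<partial>?P) + \<dots> = (\<integral>p. T (?Y p) + (a *\<^sub>R v (fst p)) \<bullet> G (?Y p) \<partial>?P)"
    using i1 i2 by simp
  also have "\<dots> = (\<integral>z. \<integral>x. T (a *\<^sub>R x + s *\<^sub>R z) + (a *\<^sub>R v x) \<bullet> G (a *\<^sub>R x + s *\<^sub>R z) \<partial>\<mu> \<partial>std_gauss)"
    using Q.integral_snd[of "\<lambda>x z. T (a *\<^sub>R x + s *\<^sub>R z) + (a *\<^sub>R v x) \<bullet> G (a *\<^sub>R x + s *\<^sub>R z)"] i1 i2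
    by (simp add: case_prod_unfold)
  finally show ?thesis .
qed

end

section \<open>Transport of admissible pairs and the contraction\<close>

text \<open>Integrals against the smoothed measures are integrals of the averaged function \<open>x \<mapsto> E[f (a x + s Z)]\<close> against
the original ones, and averaging preserves bounded continuity.\<close>

lemma weakly_continuous_affine_gauss:
  fixes \<mu> :: "real \<Rightarrow> (real^'d) measure"
  assumes wc: "weakly_continuous_on T \<mu>" and pr: "\<And>t. t \<in> T \<Longrightarrow> prob_space (\<mu> t)" "\<And>t. t \<in> T \<Longrightarrow> sets (\<mu> t) = sets borel"
  shows "weakly_continuous_on T (\<lambda>t. affine_gauss a s (\<mu> t))"
  unfolding weakly_continuous_on_def
proof (intro allI impI, elim conjE)
  fix f :: "real^'d \<Rightarrow> real" assume f: "continuous_on UNIV f" "bounded (range f)"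
  interpret \<gamma>: prob_space "std_gauss :: (real^'d) measure" by (rule prob_space_std_gauss)
  have [measurable]: "f \<in> borel_measurable borel" using f(1) by (rule borel_measurable_continuous_onI)
  obtain B where B: "\<And>x. \<bar>f x\<bar> \<le> B" using f(2) by (auto simp: bounded_iff)
  define g where "g x = (\<integral>z. f (a *\<^sub>R x + s *\<^sub>R z) \<partial>std_gauss)" for x
  have gB: "\<bar>g x\<bar> \<le> B" for x
  proof -
    have "\<bar>g x\<bar> \<le> (\<integral>z. \<bar>f (a *\<^sub>R x + s *\<^sub>R z)\<bar> \<partial>std_gauss)" unfolding g_def by (rule integral_abs_bound)
    also have "\<dots> \<le> B" by (intro \<gamma>.integral_le_const \<gamma>.integrable_const_bound[where B=B]) (auto simp: B)
    finally show ?thesis .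
  qed
  have gc: "continuous_on UNIV g"
    unfolding continuous_on_sequentially comp_def
  proof (intro ballI allI impI, elim conjE)
    fix x and u :: "nat \<Rightarrow> real^'d" assume u: "u \<longlonglongrightarrow> x"
    show "(\<lambda>n. g (u n)) \<longlonglongrightarrow> g x"
      unfolding g_def
    proof (rule integral_dominated_convergence[where w="\<lambda>_. B"])
      show "AE z in std_gauss. (\<lambda>n. f (a *\<^sub>R u n + s *\<^sub>R z)) \<longlonglongrightarrow> f (a *\<^sub>R x + s *\<^sub>R z)"
        using f(1) by (intro AE_I2 isCont_tendsto_compose[of _ f] tendsto_intros u)
          (auto simp: continuous_on_eq_continuous_at)
    qed (auto simp: B)
  qed
  have "continuous_on T (\<lambda>t. \<integral>x. g x \<partial>\<mu> t)"
    using wc gc gB by (auto simp: weakly_continuous_on_def bounded_iff)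
  moreover have "(\<integral>x. f x \<partial>affine_gauss a s (\<mu> t)) = (\<integral>x. g x \<partial>\<mu> t)" if "t \<in> T" for t
  proof -
    interpret A: prob_space "affine_gauss a s (\<mu> t)" by (rule prob_space_affine_gauss[OF pr(1)[OF that] pr(2)[OF that]])
    have "integrable (affine_gauss a s (\<mu> t)) f" by (rule A.integrable_const_bound[where B=B]) (auto simp: B)
    from integral_affine_gauss[OF pr(1)[OF that] pr(2)[OF that] this] show ?thesis by (simp add: g_def)
  qed
  ultimately show "continuous_on T (\<lambda>t. \<integral>x. f x \<partial>affine_gauss a s (\<mu> t))" by (simp cong: continuous_on_cong)
qed

text \<open>An affine change of the space variable preserves compact supports since \<open>a \<noteq> 0\<close>. This is why the
continuity equation can be used for each value of the noise separately.\<close>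

lemma test_function_space_affine:
  fixes \<phi> :: "real \<times> (real^'d) \<Rightarrow> real" and a :: real and c :: "real^'d"
  assumes \<phi>: "\<phi> \<in> test_functions (I \<times> UNIV)" and a: "a \<noteq> 0"
  defines "\<psi> \<equiv> \<lambda>p. \<phi> (fst p, a *\<^sub>R snd p + c)"
  shows "\<psi> \<in> test_functions (I \<times> UNIV)"
    and "time_deriv \<psi> (t, x) = time_deriv \<phi> (t, a *\<^sub>R x + c)"
    and "space_grad \<psi> (t, x) = a *\<^sub>R space_grad \<phi> (t, a *\<^sub>R x + c)"
proof -
  obtain K where K: "compact K" "K \<subseteq> I \<times> UNIV" "smooth_supported K \<phi>"
    using test_function_smooth_supported[OF \<phi>] by metis
  have lin: "bounded_linear (\<lambda>p :: real \<times> (real^'d). (fst p, a *\<^sub>R snd p))"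
    by (intro bounded_linear_Pair bounded_linear_fst bounded_linear_scaleR_right[THEN bounded_linear_compose] bounded_linear_snd)
  have \<psi>_eq: "\<psi> = (\<lambda>p. \<phi> ((fst p, a *\<^sub>R snd p) + (0, c)))" by (simp add: \<psi>_def)
  have smooth: "Ck_fun k \<psi>" for k
    unfolding \<psi>_eq by (rule Ck_fun_affine[OF lin]) (use K(3) in \<open>simp add: smooth_supported_def\<close>)
  define K' where "K' = (\<lambda>p. (fst p, (1 / a) *\<^sub>R (snd p - c))) ` K"
  have K': "compact K'" unfolding K'_def by (intro compact_continuous_image K continuous_intros)
  have "{z. \<psi> z \<noteq> 0} \<subseteq> K'"
  proof
    fix z assume "z \<in> {z. \<psi> z \<noteq> 0}"
    then have "(fst z, a *\<^sub>R snd z + c) \<in> K" using K(3) by (auto simp: \<psi>_def smooth_supported_def)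
    then show "z \<in> K'" unfolding K'_def using a by (auto simp: image_iff intro!: bexI[of _ "(fst z, a *\<^sub>R snd z + c)"])
  qed
  then have sub: "closure {z. \<psi> z \<noteq> 0} \<subseteq> K'" using K' by (intro closure_minimal compact_imp_closed)
  have "closed (closure {z. \<psi> z \<noteq> 0})" by simp
  then have "compact (closure {z. \<psi> z \<noteq> 0})" using K' sub by (metis compact_Int_closed inf.absorb_iff2)
  moreover have "K' \<subseteq> I \<times> UNIV" using K(2) by (auto simp: K'_def)
  ultimately show "\<psi> \<in> test_functions (I \<times> UNIV)" using smooth sub by (auto simp: test_functions_def)
  have D: "dir_deriv v \<psi> (t, x) = dir_deriv (fst v, a *\<^sub>R snd v) \<phi> (t, a *\<^sub>R x + c)" for v
  proof (rule dir_deriv_eqI)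
    have D\<phi>: "(\<phi> has_derivative (\<lambda>v. dir_deriv v \<phi> (t, a *\<^sub>R x + c))) (at (fst (t, x), a *\<^sub>R snd (t, x) + c))"
      using smooth_supported_has_derivative[OF K(3)] by simp
    show "(\<psi> has_derivative (\<lambda>v. dir_deriv (fst v, a *\<^sub>R snd v) \<phi> (t, a *\<^sub>R x + c))) (at (t, x))"
      unfolding \<psi>_def
      by (rule has_derivative_compose[where f="\<lambda>p. (fst p, a *\<^sub>R snd p + c)", OF _ D\<phi>]) (auto intro!: derivative_eq_intros)
  qed
  show "time_deriv \<psi> (t, x) = time_deriv \<phi> (t, a *\<^sub>R x + c)" by (simp add: time_deriv_def D)
  have "dir_deriv (0, a *\<^sub>R axis i 1) \<phi> (t, a *\<^sub>R x + c) = a * dir_deriv (0, axis i 1) \<phi> (t, a *\<^sub>R x + c)" for i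
    using linear_cmul[OF has_derivative_linear[OF smooth_supported_has_derivative[OF K(3)]], of a "(0, axis i 1)"] by simp
  then show "space_grad \<psi> (t, x) = a *\<^sub>R space_grad \<phi> (t, a *\<^sub>R x + c)"
    by (simp add: space_grad_def D vec_eq_iff)
qed

text \<open>The energy bound and the weak continuity come from the lemmas on smoothed fields and measures. For the
continuity equation, \<open>A t z\<close> denotes the spatial integral that \<open>(\<mu>, V)\<close> produces for the shifted test function
\<open>\<phi> (t, a x + s z)\<close>. Its time integral is \<open>0\<close> for every \<open>z\<close>, and for almost every \<open>t\<close> its Gaussian average
over \<open>z\<close> is the spatial integral of the smoothed pair. Finite action provides the integrability for both uses of
Fubini's theorem.\<close>

lemma admissible_smoothed:
  fixes \<mu> :: "real \<Rightarrow> (real^'d) measure"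
  assumes adm: "(\<mu>, V) \<in> admissible_pairs \<mu>0 \<mu>1" and fin: "action \<mu> V < \<infinity>"
    and as: "a\<^sup>2 + s\<^sup>2 = 1" and a: "a \<noteq> 0" and s: "0 < s"
  shows "(\<lambda>t. affine_gauss a s (\<mu> t), \<lambda>t. smoothed_field a s (\<mu> t) (V t)) \<in> admissible_pairs (affine_gauss a s \<mu>0) (affine_gauss a s \<mu>1)"
    and "action (\<lambda>t. affine_gauss a s (\<mu> t)) (\<lambda>t. smoothed_field a s (\<mu> t) (V t)) \<le> ennreal (a\<^sup>2) * action \<mu> V"
proof -
  have P: "\<And>t. t \<in> {0..1} \<Longrightarrow> \<mu> t \<in> P0Id" and wc: "weakly_continuous_on {0..1} \<mu>" and ends: "\<mu> 0 = \<mu>0" "\<mu> 1 = \<mu>1"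
    and Vm: "(\<lambda>(t, x). V t x) \<in> borel_measurable (restrict_space borel ({0..1} \<times> UNIV))" and ce: "continuity_eq \<mu> V"
    using adm by (auto simp: admissible_pairs_def)
  interpret \<gamma>: prob_space "std_gauss :: (real^'d) measure" by (rule prob_space_std_gauss)
  \<comment> \<open>Extending the curve and the field constantly outside \<open>[0, 1]\<close> replaces measurability on a restricted space by Borel measurability.\<close>
  define cl where "cl t = max 0 (min 1 t)" for t :: real
  have cl: "cl t \<in> {0..1}" "t \<in> {0..1} \<Longrightarrow> cl t = t" for t by (auto simp: cl_def)
  have clc: "continuous_on UNIV cl" unfolding cl_def by (intro continuous_intros)
  define \<kappa> where "\<kappa> t = \<mu> (cl t)" for t
  define W where "W t = V (cl t)" for t
  have \<kappa>: "prob_space (\<kappa> t)" "sets (\<kappa> t) = sets borel" for t using P0IdD(1,2)[OF P[OF cl(1)[of t]]] by (auto simp: \<kappa>_def)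
  have wc\<kappa>: "weakly_continuous_on UNIV \<kappa>"
    unfolding weakly_continuous_on_def \<kappa>_def
    using wc cl(1) by (auto simp: weakly_continuous_on_def intro!: continuous_on_compose2[OF _ clc, of "{0..1}"])
  have Wm[measurable]: "(\<lambda>(t, x). W t x) \<in> borel_measurable (borel \<Otimes>\<^sub>M borel)"
  proof -
    have "(\<lambda>p :: real \<times> (real^'d). (cl (fst p), snd p)) \<in> measurable borel (restrict_space borel ({0..1} \<times> UNIV))"
    proof (rule measurable_restrict_space2)
      show "(\<lambda>p :: real \<times> (real^'d). (cl (fst p), snd p)) \<in> borel_measurable borel"
        by (intro borel_measurable_continuous_onI continuous_on_Pair continuous_on_compose2[OF clc] continuous_intros) auto
    qed (use cl in auto)
    from measurable_compose[OF this Vm] show ?thesis by (simp add: borel_prod W_def case_prod_unfold)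
  qed
  have Wsec[measurable]: "W t \<in> borel_measurable borel" for t using measurable_Pair2[OF Wm, of t] by simp
  have ker[measurable]: "\<kappa> \<in> measurable borel (subprob_algebra borel)" by (rule weakly_continuous_kernel[OF wc\<kappa> \<kappa>])
  define \<kappa>' where "\<kappa>' t = affine_gauss a s (\<kappa> t)" for t
  let ?\<mu>' = "\<lambda>t. affine_gauss a s (\<mu> t)" and ?V' = "\<lambda>t. smoothed_field a s (\<mu> t) (V t)"
  let ?\<gamma> = "std_gauss :: (real^'d) measure"
  define W' where "W' t = smoothed_field a s (\<kappa> t) (W t)" for t
  have \<kappa>': "prob_space (\<kappa>' t)" "sets (\<kappa>' t) = sets borel" for t
    unfolding \<kappa>'_def using prob_space_affine_gauss[OF \<kappa>] by auto
  have wc': "weakly_continuous_on UNIV \<kappa>'" unfolding \<kappa>'_def by (rule weakly_continuous_affine_gauss[OF wc\<kappa> \<kappa>])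
  have ker'[measurable]: "\<kappa>' \<in> measurable borel (subprob_algebra borel)" by (rule weakly_continuous_kernel[OF wc' \<kappa>'])
  have W'm[measurable]: "(\<lambda>(t, y). W' t y) \<in> borel_measurable (borel \<Otimes>\<^sub>M borel)"
  proof -
    have "(\<lambda>p. \<integral>x. gauss_kernel s (snd p - a *\<^sub>R x) \<partial>\<kappa> (fst p)) \<in> borel_measurable (borel \<Otimes>\<^sub>M borel)"
      by (rule integral_measurable_kernel[where N=borel]) measurable
    moreover have "(\<lambda>p. \<integral>x. gauss_kernel s (snd p - a *\<^sub>R x) *\<^sub>R W (fst p) x \<partial>\<kappa> (fst p)) \<in> borel_measurable (borel \<Otimes>\<^sub>M borel)"
      by (rule integral_measurable_kernel[where N=borel]) measurable
    ultimately show ?thesis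
      unfolding W'_def smoothed_field_def smoothed_density_def case_prod_unfold by measurable
  qed
  have W'sec[measurable]: "W' t \<in> borel_measurable borel" for t using measurable_Pair2[OF W'm, of t] by simp
  have on01: "\<kappa> t = \<mu> t" "W t = V t" "\<kappa>' t = affine_gauss a s (\<mu> t)" "W' t = smoothed_field a s (\<mu> t) (V t)" if "t \<in> {0..1}" for t
    using cl(2)[OF that] by (auto simp: \<kappa>_def W_def \<kappa>'_def W'_def)
  define D where "D t = (\<integral>\<^sup>+x. ennreal ((norm (W t x))\<^sup>2) \<partial>\<kappa> t)" for t
  have Dm[measurable]: "D \<in> borel_measurable borel"
    unfolding D_def by (rule nn_integral_measurable_subprob_algebra2[where N=borel]) measurable
  have meas\<kappa>: "measurable (\<kappa> t) N = measurable borel N" "measurable (\<kappa>' t) N = measurable borel N" for t and N :: "'z measure"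
    by (intro measurable_cong_sets \<kappa> \<kappa>' refl)+
  have half: "(\<integral>\<^sup>+x. ennreal (1/2 * (norm (U x))\<^sup>2) \<partial>M) = ennreal (1/2) * (\<integral>\<^sup>+x. ennreal ((norm (U x))\<^sup>2) \<partial>M)"
    if "U \<in> borel_measurable M" for U :: "real^'d \<Rightarrow> real^'d" and M
  proof -
    have "ennreal (1/2 * (norm (U x))\<^sup>2) = ennreal (1/2) * ennreal ((norm (U x))\<^sup>2)" for x
      by (rule ennreal_mult) auto
    then show ?thesis by (simp only:) (rule nn_integral_cmult, use that in measurable)
  qed
  have act: "action \<mu> V = ennreal (1/2) * (\<integral>\<^sup>+t\<in>{0..1}. D t \<partial>lborel)"
  proof -
    have "action \<mu> V = (\<integral>\<^sup>+t. ennreal (1/2) * (D t * indicator {0..1} t) \<partial>lborel)"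
      unfolding action_def D_def
    proof (intro nn_integral_cong)
      fix t :: real
      show "(\<integral>\<^sup>+x. ennreal (1/2 * (norm (V t x))\<^sup>2) \<partial>\<mu> t) * indicator {0..1} t =
        ennreal (1/2) * ((\<integral>\<^sup>+x. ennreal ((norm (W t x))\<^sup>2) \<partial>\<kappa> t) * indicator {0..1} t)"
        using half[of "W t" "\<kappa> t"] on01[of t] by (auto simp: meas\<kappa> split: split_indicator)
    qed
    then show ?thesis by (subst (asm) nn_integral_cmult) auto
  qed
  have Dfin: "(\<integral>\<^sup>+t\<in>{0..1}. D t \<partial>lborel) < \<infinity>"
    using fin unfolding act by (auto simp: ennreal_mult_less_top)
  have energy: "(\<integral>\<^sup>+y. ennreal ((norm (W' t y))\<^sup>2) \<partial>\<kappa>' t) \<le> ennreal (a\<^sup>2) * D t" for t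
    unfolding W'_def \<kappa>'_def D_def by (rule smoothed_field_energy[OF \<kappa> Wsec s])
  show "action ?\<mu>' ?V' \<le> ennreal (a\<^sup>2) * action \<mu> V"
  proof -
    have "action ?\<mu>' ?V' \<le> (\<integral>\<^sup>+t. ennreal (1/2) * (ennreal (a\<^sup>2) * (D t * indicator {0..1} t)) \<partial>lborel)"
      unfolding action_def
    proof (intro nn_integral_mono)
      fix t :: real
      have "ennreal (1/2) * (\<integral>\<^sup>+y. ennreal ((norm (W' t y))\<^sup>2) \<partial>\<kappa>' t) \<le> ennreal (1/2) * (ennreal (a\<^sup>2) * D t)"
        by (rule mult_left_mono[OF energy]) simp
      then show "(\<integral>\<^sup>+x. ennreal (1/2 * (norm (?V' t x))\<^sup>2) \<partial>?\<mu>' t) * indicator {0..1} t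
         \<le> ennreal (1/2) * (ennreal (a\<^sup>2) * (D t * indicator {0..1} t))"
        using half[of "W' t" "\<kappa>' t"] on01[of t] by (auto simp: meas\<kappa> split: split_indicator)
    qed
    also have "\<dots> = ennreal (a\<^sup>2) * action \<mu> V"
      unfolding act by (subst nn_integral_cmult, measurable, subst nn_integral_cmult, measurable) (simp add: mult_ac)
    finally show ?thesis .
  qed
  have ce': "continuity_eq ?\<mu>' ?V'"
    unfolding continuity_eq_def
  proof (intro conjI allI impI ballI)
    fix K :: "(real \<times> (real^'d)) set"
    have "(\<integral>\<^sup>+ t\<in>{0<..<1}. (\<integral>\<^sup>+ x. ennreal (norm (?V' t x)) * indicator K (t, x) \<partial>?\<mu>' t) \<partial>lborel)
      \<le> (\<integral>\<^sup>+t. indicator {0..1} t + ennreal (a\<^sup>2) * (D t * indicator {0..1} t) \<partial>lborel)"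
    proof (intro nn_integral_mono)
      fix t :: real
      show "(\<integral>\<^sup>+ x. ennreal (norm (?V' t x)) * indicator K (t, x) \<partial>?\<mu>' t) * indicator {0<..<1} t
        \<le> indicator {0..1} t + ennreal (a\<^sup>2) * (D t * indicator {0..1} t)"
      proof (cases "t \<in> {0<..<1}")
        case True
        then have t: "t \<in> {0..1}" by auto
        interpret K: prob_space "\<kappa>' t" by (rule \<kappa>')
        have "(\<integral>\<^sup>+x. ennreal (norm (W' t x)) * indicator K (t, x) \<partial>\<kappa>' t) \<le> (\<integral>\<^sup>+x. 1 + ennreal ((norm (W' t x))\<^sup>2) \<partial>\<kappa>' t)"
        proof (intro nn_integral_mono)
          fix x
          have "ennreal (norm (W' t x)) \<le> 1 + ennreal ((norm (W' t x))\<^sup>2)"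
            using ennreal_leI[OF le_one_plus_square] by fastforce
          then show "ennreal (norm (W' t x)) * indicator K (t, x) \<le> 1 + ennreal ((norm (W' t x))\<^sup>2)"
            by (auto split: split_indicator)
        qed
        also have "\<dots> = 1 + (\<integral>\<^sup>+x. ennreal ((norm (W' t x))\<^sup>2) \<partial>\<kappa>' t)"
          by (subst nn_integral_add) (auto simp: meas\<kappa> K.emeasure_space_1)
        also have "\<dots> \<le> 1 + ennreal (a\<^sup>2) * D t" by (intro add_left_mono energy)
        finally show ?thesis using True t on01[OF t] by simp
      qed simp
    qed
    also have "\<dots> = 1 + ennreal (a\<^sup>2) * (\<integral>\<^sup>+t\<in>{0..1}. D t \<partial>lborel)"
      by (subst nn_integral_add) (auto simp: nn_integral_cmult)
    also have "\<dots> < \<infinity>" using Dfin by (simp add: ennreal_mult_less_top)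
    finally show "(\<integral>\<^sup>+ t\<in>{0<..<1}. (\<integral>\<^sup>+ x. ennreal (norm (?V' t x)) * indicator K (t, x) \<partial>?\<mu>' t) \<partial>lborel) < \<infinity>" .
  next
    fix \<phi> :: "real \<times> (real^'d) \<Rightarrow> real" assume \<phi>: "\<phi> \<in> test_functions ({0<..<1} \<times> UNIV)"
    obtain K where K: "compact K" "smooth_supported K \<phi>"
      using test_function_smooth_supported[OF \<phi>] by metis
    note ss = smooth_supported_space_time[OF K(2,1)]
    note [measurable] = borel_measurable_test[OF K(2,1)]
    obtain B1 where B1: "0 < B1" "\<And>z. \<bar>time_deriv \<phi> z\<bar> \<le> B1" using smooth_supported_bounded[OF ss(1) K(1)] by metis
    obtain B2 where B2: "0 < B2" "\<And>z. norm (space_grad \<phi> z) \<le> B2" using space_grad_bounded[OF K(2,1)] by metis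
    define Y where "Y x z = a *\<^sub>R x + s *\<^sub>R z" for x z :: "real^'d"
    define F where "F t x z = time_deriv \<phi> (t, Y x z) + (a *\<^sub>R W t x) \<bullet> space_grad \<phi> (t, Y x z)" for t x z
    define A where "A t z = (\<integral>x. F t x z \<partial>\<kappa> t)" for t z
    define R where "R t = (\<integral>y. time_deriv \<phi> (t, y) + W' t y \<bullet> space_grad \<phi> (t, y) \<partial>\<kappa>' t)" for t
    define c0 where "c0 = B1 + \<bar>a\<bar> * B2"
    define c1 where "c1 = \<bar>a\<bar> * B2"
    have c: "0 \<le> c0" "0 \<le> c1" using B1 B2 by (auto simp: c0_def c1_def)
    have part: "\<bar>(a *\<^sub>R W t x) \<bullet> space_grad \<phi> p\<bar> \<le> c1 + c1 * (norm (W t x))\<^sup>2" for t x p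
    proof -
      have "\<bar>a\<bar> * norm (W t x) * norm (space_grad \<phi> p) \<le> \<bar>a\<bar> * (1 + (norm (W t x))\<^sup>2) * B2"
        using B2 by (intro mult_mono le_one_plus_square) auto
      then show ?thesis
        using Cauchy_Schwarz_ineq2[of "a *\<^sub>R W t x" "space_grad \<phi> p"] by (simp add: c1_def algebra_simps)
    qed
    have Fb: "\<bar>F t x z\<bar> \<le> c0 + c1 * (norm (W t x))\<^sup>2" for t x z
      using part[of t x "(t, Y x z)"] B1(2)[of "(t, Y x z)"] unfolding F_def c0_def c1_def by linarith
    have Fm[measurable]: "(\<lambda>q. F (fst (fst q)) (snd q) (snd (fst q))) \<in> borel_measurable ((borel \<Otimes>\<^sub>M borel) \<Otimes>\<^sub>M borel)"
      unfolding F_def Y_def by measurable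
    have Am[measurable]: "(\<lambda>p. A (fst p) (snd p)) \<in> borel_measurable (borel \<Otimes>\<^sub>M borel)"
      unfolding A_def
      by (rule integral_measurable_kernel[where N=borel and f="\<lambda>p x. F (fst p) x (snd p)"]) (use Fm in \<open>auto simp: case_prod_unfold\<close>)
    have Fsec: "(\<lambda>x. F t x z) \<in> borel_measurable (\<kappa> t)" for t z
      unfolding F_def Y_def by (simp add: meas\<kappa>)
    have zero: "(\<integral>t. indicator {0<..<1} t * A t z \<partial>lborel) = 0" for z
    proof -
      note \<psi> = test_function_space_affine[OF \<phi> a, of "s *\<^sub>R z"]
      have "0 = (LBINT t:{0<..<1}. (\<integral>x. time_deriv (\<lambda>p. \<phi> (fst p, a *\<^sub>R snd p + s *\<^sub>R z)) (t, x)
           + V t x \<bullet> space_grad (\<lambda>p. \<phi> (fst p, a *\<^sub>R snd p + s *\<^sub>R z)) (t, x) \<partial>(\<mu> t)))"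
        using ce \<psi>(1) unfolding continuity_eq_def by simp
      also have "\<dots> = (LBINT t:{0<..<1}. A t z)"
        by (rule set_lebesgue_integral_cong) (auto simp: \<psi>(2,3) A_def F_def Y_def on01)
      finally show ?thesis by (simp add: set_lebesgue_integral_def)
    qed
    have Ab: "ennreal \<bar>A t z\<bar> \<le> ennreal c0 + ennreal c1 * D t" for t z
    proof -
      interpret K: prob_space "\<kappa> t" by (rule \<kappa>)
      have "ennreal \<bar>A t z\<bar> \<le> (\<integral>\<^sup>+x. ennreal \<bar>F t x z\<bar> \<partial>\<kappa> t)"
      proof (cases "integrable (\<kappa> t) (\<lambda>x. F t x z)")
        case True
        from integral_norm_bound_ennreal[OF this] show ?thesis by (simp add: A_def)
      qed (simp add: A_def not_integrable_integral_eq)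
      also have "\<dots> \<le> (\<integral>\<^sup>+x. ennreal c0 + ennreal c1 * ennreal ((norm (W t x))\<^sup>2) \<partial>\<kappa> t)"
        using Fb c by (intro nn_integral_mono) (simp add: ennreal_mult[symmetric] ennreal_plus[symmetric] ennreal_leI del: ennreal_plus)
      also have "\<dots> = ennreal c0 + ennreal c1 * D t"
        by (subst nn_integral_add) (auto simp: meas\<kappa> nn_integral_cmult D_def K.emeasure_space_1)
      finally show ?thesis .
    qed
    interpret LG: pair_sigma_finite lborel ?\<gamma> ..
    have Aint: "integrable (lborel \<Otimes>\<^sub>M ?\<gamma>) (\<lambda>(t, z). indicator {0<..<1} t * A t z)"
    proof (rule integrableI_bounded)
      show m: "(\<lambda>(t, z). indicator {0<..<1} t * A t z) \<in> borel_measurable (lborel \<Otimes>\<^sub>M ?\<gamma>)"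
        unfolding case_prod_unfold by measurable
      have "(\<integral>\<^sup>+p. ennreal (norm (case p of (t, z) \<Rightarrow> indicator {0<..<1} t * A t z)) \<partial>(lborel \<Otimes>\<^sub>M ?\<gamma>))
        = (\<integral>\<^sup>+t. \<integral>\<^sup>+z. ennreal (norm (indicator {0<..<1} t * A t z)) \<partial>?\<gamma> \<partial>lborel)"
        using m by (subst \<gamma>.nn_integral_fst[symmetric]) auto
      also have "\<dots> \<le> (\<integral>\<^sup>+t. \<integral>\<^sup>+z. ennreal c0 * indicator {0..1} t + ennreal c1 * (D t * indicator {0..1} t) \<partial>?\<gamma> \<partial>lborel)"
        using Ab by (intro nn_integral_mono) (auto split: split_indicator)
      also have "\<dots> = ennreal c0 + ennreal c1 * (\<integral>\<^sup>+t\<in>{0..1}. D t \<partial>lborel)"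
        using \<gamma>.emeasure_space_1 by (simp add: nn_integral_add nn_integral_cmult)
      also have "\<dots> < \<infinity>" using Dfin by (simp add: ennreal_mult_less_top)
      finally show "(\<integral>\<^sup>+p. ennreal (norm (case p of (t, z) \<Rightarrow> indicator {0<..<1} t * A t z)) \<partial>(lborel \<Otimes>\<^sub>M ?\<gamma>)) < \<infinity>" .
    qed
    have slice: "R t = (\<integral>z. A t z \<partial>?\<gamma>)" if Dt: "D t < \<infinity>" for t
    proof -
      have "integrable (\<kappa> t) (\<lambda>x. (norm (W t x))\<^sup>2)"
        using Dt by (intro integrableI_nonneg) (auto simp: meas\<kappa> D_def)
      then show ?thesis
        unfolding R_def A_def F_def Y_def \<kappa>'_def W'_def
        by (rule smoothed_field_test_integral[OF \<kappa> Wsec s, where ?B1.0=B1 and ?B2.0=B2]) (auto simp: B1 B2)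
    qed
    \<comment> \<open>Finite action makes \<open>V t\<close> square integrable only for almost every \<open>t\<close>.\<close>
    have AED: "AE t in lborel. t \<in> {0<..<1} \<longrightarrow> D t < \<infinity>"
    proof -
      have "AE t in lborel. D t * indicator {0..1} t \<noteq> \<infinity>"
        by (rule nn_integral_noteq_infinite) (use Dfin in auto)
      then show ?thesis by eventually_elim (auto simp: top.not_eq_extremum split: split_indicator_asm)
    qed
    have "(LBINT t:{0<..<1}. (\<integral>x. time_deriv \<phi> (t, x) + ?V' t x \<bullet> space_grad \<phi> (t, x) \<partial>?\<mu>' t))
      = (\<integral>t. indicator {0<..<1} t * R t \<partial>lborel)"
      unfolding set_lebesgue_integral_def
      by (rule Bochner_Integration.integral_cong) (auto simp: on01 R_def split: split_indicator)
    also have "\<dots> = (\<integral>t. indicator {0<..<1} t * (\<integral>z. A t z \<partial>?\<gamma>) \<partial>lborel)"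
    proof (rule integral_cong_AE)
      have "R \<in> borel_measurable borel"
        unfolding R_def by (rule integral_measurable_kernel[where N=borel]) measurable
      then show "(\<lambda>t. indicator {0<..<1} t * R t) \<in> borel_measurable lborel"
        by measurable
      have "(\<lambda>t. \<integral>z. A t z \<partial>?\<gamma>) \<in> borel_measurable borel"
        by (rule \<gamma>.borel_measurable_lebesgue_integral) measurable
      then show "(\<lambda>t. indicator {0<..<1} t * (\<integral>z. A t z \<partial>?\<gamma>)) \<in> borel_measurable lborel" by measurable
      show "AE t in lborel. indicator {0<..<1} t * R t = indicator {0<..<1} t * (\<integral>z. A t z \<partial>?\<gamma>)"
        using AED by eventually_elim (auto simp: slice split: split_indicator)
    qed
    also have "\<dots> = (\<integral>t. \<integral>z. indicator {0<..<1} t * A t z \<partial>?\<gamma> \<partial>lborel)" by simp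
    also have "\<dots> = (\<integral>z. \<integral>t. indicator {0<..<1} t * A t z \<partial>lborel \<partial>?\<gamma>)"
      by (rule LG.Fubini_integral[OF Aint, symmetric])
    also have "\<dots> = 0" by (simp add: zero)
    finally show "(LBINT t:{0<..<1}. (\<integral>x. time_deriv \<phi> (t, x) + ?V' t x \<bullet> space_grad \<phi> (t, x) \<partial>?\<mu>' t)) = 0" .
  qed
  have V'm: "(\<lambda>(t, x). ?V' t x) \<in> borel_measurable (restrict_space borel ({0..1} \<times> UNIV))"
  proof -
    have "(\<lambda>(t, x). W' t x) \<in> borel_measurable (restrict_space borel ({0..1} \<times> UNIV))"
      using W'm by (intro measurable_restrict_space1) (simp add: borel_prod)
    then show ?thesis by (rule measurable_cong[THEN iffD1, rotated]) (auto simp: space_restrict_space on01)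
  qed
  show "(?\<mu>', ?V') \<in> admissible_pairs (affine_gauss a s \<mu>0) (affine_gauss a s \<mu>1)"
    unfolding admissible_pairs_def
    using affine_gauss_P0Id[OF P as] weakly_continuous_affine_gauss[OF wc] P0IdD(1,2)[OF P] ends V'm ce' by auto
qed

theorem corollary1p25:
  fixes \<eta>1 \<eta>2 :: "(real^'d) measure" and t :: real
  assumes "\<eta>1 \<in> P0Id" and "\<eta>2 \<in> P0Id" and "0 \<le> t"
  shows "W0Id (OU t \<eta>1) (OU t \<eta>2) \<le> ennreal (exp (- t)) * W0Id \<eta>1 \<eta>2"
proof (cases "t = 0")
  case True
  have "OU 0 \<eta> = \<eta>" if "\<eta> \<in> P0Id" for \<eta> :: "(real^'d) measure"
    using OU_eq_mehler[OF that, of 0] by (simp add: mehler_def affine_gauss_1_0[OF P0IdD(1,2)[OF that]])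
  then show ?thesis using True assms by simp
next
  case False
  with assms have t: "0 < t" by simp
  define a where "a = exp (- t)"
  define s where "s = sqrt (1 - exp (- (2 * t)))"
  have a: "0 < a" and s: "0 < s" using t by (auto simp: a_def s_def)
  have as: "a\<^sup>2 + s\<^sup>2 = 1" using t by (simp add: a_def s_def power2_eq_square exp_add[symmetric])
  have OU: "OU t \<eta> = affine_gauss a s \<eta>" if "\<eta> \<in> P0Id" for \<eta> :: "(real^'d) measure"
    using OU_eq_mehler[OF that, of t] t by (simp add: mehler_def a_def s_def)
  let ?I = "\<lambda>\<mu>0 \<mu>1 :: (real^'d) measure. \<Sqinter>(\<mu>, V)\<in>admissible_pairs \<mu>0 \<mu>1. action \<mu> V"
  define I I' where "I = ?I \<eta>1 \<eta>2" and "I' = ?I (affine_gauss a s \<eta>1) (affine_gauss a s \<eta>2)"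
  have le: "I' \<le> ennreal (a\<^sup>2) * action \<mu> V" if adm: "(\<mu>, V) \<in> admissible_pairs \<eta>1 \<eta>2" for \<mu> V
  proof (cases "action \<mu> V < \<infinity>")
    case True
    note * = admissible_smoothed[OF adm True as _ s]
    have "I' \<le> action (\<lambda>t. affine_gauss a s (\<mu> t)) (\<lambda>t. smoothed_field a s (\<mu> t) (V t))"
      unfolding I'_def using *(1) a by (intro INF_lower2) auto
    also have "\<dots> \<le> ennreal (a\<^sup>2) * action \<mu> V" using *(2) a by auto
    finally show ?thesis .
  next
    case False
    then have "action \<mu> V = \<infinity>" by (simp add: less_top[symmetric])
    then show ?thesis using a by (simp add: ennreal_mult_top)
  qed
  \<comment> \<open>The positive factor is moved to the other side before passing to the infimum, and back afterwards.\<close>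
  have inv: "ennreal (a\<^sup>2) * (ennreal (1 / a\<^sup>2) * x) = x" "ennreal (1 / a\<^sup>2) * (ennreal (a\<^sup>2) * x) = x" for x
    using a by (simp_all add: mult.assoc[symmetric] ennreal_mult[symmetric])
  have "ennreal (1 / a\<^sup>2) * I' \<le> I"
    unfolding I_def
  proof (intro INF_greatest, clarify)
    fix \<mu> V assume "(\<mu>, V) \<in> admissible_pairs \<eta>1 \<eta>2"
    from mult_left_mono[OF le[OF this], of "ennreal (1 / a\<^sup>2)"]
    show "ennreal (1 / a\<^sup>2) * I' \<le> action \<mu> V" by (simp add: inv)
  qed
  from mult_left_mono[OF this, of "ennreal (a\<^sup>2)"] have I': "I' \<le> ennreal (a\<^sup>2) * I" by (simp add: inv)
  have "ennreal_sqrt I' \<le> ennreal a * ennreal_sqrt I"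
  proof (cases "I = \<infinity>")
    case True
    then show ?thesis using a by (simp add: ennreal_sqrt_def ennreal_mult_top)
  next
    case False
    then obtain r where r: "0 \<le> r" "I = ennreal r" by (cases I) auto
    then have "I' \<le> ennreal (a\<^sup>2 * r)" using I' by (simp add: ennreal_mult)
    then obtain r' where r': "0 \<le> r'" "I' = ennreal r'" "r' \<le> a\<^sup>2 * r"
      using r by (cases I') (auto simp: top_unique)
    have "sqrt r' \<le> a * sqrt r"
      using real_sqrt_le_mono[OF r'(3)] a by (simp add: real_sqrt_mult)
    then show ?thesis using r r' a by (simp add: ennreal_sqrt_def ennreal_mult[symmetric] ennreal_leI)
  qed
  then show ?thesis
    using assms OU by (simp add: W0Id_def I_def I'_def a_def)
qed

end
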